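(* Algorithm 5, the procedure written out in full in the context, runs in space polynomial in the size of its input $(A,B)$.
   Context: Conventions. A procedure runs in polynomial space if the deterministic Turing machine executing it runs in space bounded by some polynomial in the size of the input. Integers are encoded in binary. Input. A Katsura pair $(A,B)$ consists of square integer matrices of the same dimension $\mathfrak N\ge1$, where $A$ has nonnegative entries and no zero row, and $A_{u,v}=0$ implies $B_{u,v}=0$. Graphs. $E_A$ is the directed graph with vertex set $E_A^0=\{1,\dots,\mathfrak N\}$ and, for all $u,v$, exactly $A_{u,v}$ edges with range $u$ and source $v$. Its underlying simple graph $\overline E_A$ is obtained by collapsing multiple edges: it has the same vertices and one edge with range $u$ and source $v$ whenever $A_{u,v}\ne0$. For an edge $e$ with range $u$ and source $v$ put $A_e=A_{u,v}$, $B_e=B_{u,v}$. A path $p=e_1\cdots e_n$ is a sequence of edges with source of $e_i$ equal to range of $e_{i+1}$; its range $\mathbf r(p)$ is the range of $e_1$ and its source $\mathbf s(p)$ is the source of $e_n$. Vertices are paths of length $0$, each being its own range and source. Put $A_p=\prod_l A_{e_l}$, $B_p=\prod_l B_{e_l}$, and $A_v=B_v=1$ for a vertex $v$. $v\overline E_A^*$ is the set of finite paths of $\overline E_A$ with range $v$, and $v\overline E_A^*v$ the set of those with range and source $v$. A cycle is a path of positive length with equal range and source. A path is simple if it contains no cycle as a subsequence of edges; a cycle is simple if it contains no cycle as a proper subsequence of edges. In the algorithms, paths of $\overline E_A$ are encoded as their vertex sequences, and vertices, simple paths and simple cycles are cycled through in lexicographic order. Algorithm 1, procedure Faithful$(A,B,v)$: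 - For all simple paths $p\in v\overline E_A^*$ with $B_p\ne0$: -- For all simple cycles $c\in \mathbf s(p)\overline E_A^*\mathbf s(p)$: --- If $B_c/A_c\notin\mathbb Z$: halt and return TRUE. - Return FALSE. Algorithm 3, procedure Order$(A,B,v)$: - If Faithful$(A,B,v)$ = TRUE: return $0$. - Else: set $N\gets1$; for each simple path $p\in v\overline E_A^*$ with $B_p\ne0$ set $N\gets\operatorname{lcm}\left(N,\frac{A_p}{\gcd(A_p,|B_p|)}\right)$; return $N$. Algorithm 4, procedure c-StableOrder$(A,B,c,N)$: - Set $r\gets1$; for each prefix $c'$ of $c$ set $r\gets\operatorname{lcm}\left(r,\frac{A_{c'}}{\gcd(A_{c'},|B_{c'}|)}\right)$. - Set $M\gets N/r$. - Set $k\gets\frac{M}{\gcd(M,\,B_c/A_c)}$. - Set $s\gets k$; while $s\ne\frac{s}{\gcd(s,M/s)}$, set $s\gets\frac{s}{\gcd(s,M/s)}$. - Set $n\gets M/s$; set $K\gets M/n$; return $K$. Algorithm 5, on input $(A,B)$: - For all $v\in E_A^0$: -- If Order$(A,B,v)\ne0$: --- Set $N\gets$ Order$(A,B,v)$. --- For all simple cycles $c\in v\overline E_A^*v$ with $B_c\ne0$: ---- Set $K\gets$ c-StableOrder$(A,B,c,N)$. ---- For all simple paths $q\in v\overline E_A^*$: ----- If $\frac{A_q}{\gcd(A_q,|B_q|)}=K$: continue with next $c$. ----- Halt and return NO. - Return YES. *)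

theory Defs
  imports
    "HOL-Computational_Algebra.Polynomial"
    "HOL-Library.List_Lexorder"
    "HOL-Library.Sublist"
    "Jordan_Normal_Form.Matrix"
begin

section \<open>Katsura pairs and paths\<close>

text \<open>
  Vertices are numbered \<open>0, \<dots>, N - 1\<close> instead of \<open>1, \<dots>, N\<close>, in agreement with the indices of
  \<^typ>\<open>int mat\<close>.
\<close>

definition katsura_pair :: "int mat \<Rightarrow> int mat \<Rightarrow> bool" where
  "katsura_pair A B \<longleftrightarrow>
     (\<exists>n\<ge>1. A \<in> carrier_mat n n \<and> B \<in> carrier_mat n n \<and>
        (\<forall>u<n. \<forall>w<n. A $$ (u, w) \<ge> 0) \<and>
        (\<forall>u<n. \<exists>w<n. A $$ (u, w) \<noteq> 0) \<and>
        (\<forall>u<n. \<forall>w<n. A $$ (u, w) = 0 \<longrightarrow> B $$ (u, w) = 0))"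

definition vertices :: "int mat \<Rightarrow> nat set" where
  "vertices A = {..<dim_row A}"

text \<open>
  An edge of the simple graph \<open>\<overline>E\<^sub>A\<close> is the pair (range, source).
\<close>

definition simple_graph_edges :: "int mat \<Rightarrow> (nat \<times> nat) set" where
  "simple_graph_edges A = {(u, w). u \<in> vertices A \<and> w \<in> vertices A \<and> A $$ (u, w) \<noteq> 0}"

text \<open>
  The path \<open>e\<^sub>1 \<dots> e\<^sub>m\<close> of the simple graph is represented by its vertex sequence
  \<open>[range e\<^sub>1, source e\<^sub>1, \<dots>, source e\<^sub>m]\<close>; in particular the vertex \<open>v\<close>, as a path of length 0,
  is \<open>[v]\<close>.  So the range of a path is its head and the source is its last element.
\<close>

definition path_edges :: "nat list \<Rightarrow> (nat \<times> nat) list" where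
  "path_edges p = zip p (tl p)"

definition is_path :: "int mat \<Rightarrow> nat list \<Rightarrow> bool" where
  "is_path A p \<longleftrightarrow> p \<noteq> [] \<and> set p \<subseteq> vertices A \<and> set (path_edges p) \<subseteq> simple_graph_edges A"

definition cyclic_edges :: "(nat \<times> nat) list \<Rightarrow> bool" where
  "cyclic_edges es \<longleftrightarrow> es \<noteq> [] \<and> successively (\<lambda>e f. snd e = fst f) es \<and> fst (hd es) = snd (last es)"

definition simple_path :: "int mat \<Rightarrow> nat list \<Rightarrow> bool" where
  "simple_path A p \<longleftrightarrow> is_path A p \<and> \<not> (\<exists>es. cyclic_edges es \<and> subseq es (path_edges p))"

definition simple_cycle :: "int mat \<Rightarrow> nat list \<Rightarrow> bool" where
  "simple_cycle A c \<longleftrightarrow>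
     is_path A c \<and> cyclic_edges (path_edges c) \<and>
     \<not> (\<exists>es. cyclic_edges es \<and> strict_subseq es (path_edges c))"

definition simple_paths :: "int mat \<Rightarrow> nat \<Rightarrow> nat list set" where
  "simple_paths A v = {p. simple_path A p \<and> hd p = v}"

definition simple_cycles :: "int mat \<Rightarrow> nat \<Rightarrow> nat list set" where
  "simple_cycles A v = {c. simple_cycle A c \<and> hd c = v}"

definition path_prefixes :: "nat list \<Rightarrow> nat list set" where
  "path_prefixes c = {c'. c' \<noteq> [] \<and> prefix c' c}"

text \<open>\<open>A\<^sub>p\<close> and \<open>B\<^sub>p\<close>\<close>

definition weight :: "int mat \<Rightarrow> nat list \<Rightarrow> int" where
  "weight A p = prod_list (map (\<lambda>e. A $$ e) (path_edges p))"

text \<open>\<open>A\<^sub>p / gcd(A\<^sub>p, |B\<^sub>p|)\<close>\<close>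

definition reduced :: "int mat \<Rightarrow> int mat \<Rightarrow> nat list \<Rightarrow> int" where
  "reduced A B p = weight A p div gcd (weight A p) \<bar>weight B p\<bar>"


section \<open>The algorithm\<close>

text \<open>
  The procedure is given as a flowchart: a state consists of a program line and the values of all
  variables of the pseudocode.  The procedures Faithful, Order and c-StableOrder
  are expanded at their places of call; Order is called at two places, which are told apart by the
  argument of type \<open>call\<close>.

  A loop ``for all \<open>x \<in> X\<close>'' assigns \<open>first X\<close> to \<open>x\<close> when it is entered and \<open>next_in X x\<close> after each
  pass; the value \<^const>\<open>None\<close> of a loop variable means that \<open>X\<close> is exhausted (or that the loop has
  not been entered yet).  The order on vertex sequences is the lexicographic order of
  \<^theory>\<open>HOL-Library.List_Lexorder\<close>, in which a proper prefix comes first.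
\<close>

definition first :: "'a::linorder set \<Rightarrow> 'a option" where
  "first X = (if X = {} then None else Some (Min X))"

definition next_in :: "'a::linorder set \<Rightarrow> 'a \<Rightarrow> 'a option" where
  "next_in X x = first {y \<in> X. x < y}"

datatype call = Condition | Assignment

datatype line =
    Start
  | For_v
  | Call_Order call
  | Faithful_For_p call
  | Faithful_For_c call
  | Order_For_p call
  | Order_Done call
  | For_c
  | Stable_For_prefix
  | Stable_Set_k
  | Stable_Set_s
  | Stable_While
  | Stable_Set_n
  | Stable_Set_K
  | For_q
  | Return_YES
  | Return_NO

text \<open>
  \<open>var_fp\<close>, \<open>var_fc\<close> are the loop variables of Faithful; \<open>var_op\<close>, \<open>var_oN\<close> are the variables of
  Order, and \<open>var_oN\<close> also receives the value it returns; \<open>var_c'\<close>, \<open>var_r\<close>, \<open>var_M\<close>, \<open>var_k\<close>,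
  \<open>var_s\<close>, \<open>var_n\<close> are those of c-StableOrder, whose returned value is \<open>var_K\<close>.
\<close>

record state =
  pc :: line
  var_v :: "nat option"
  var_fp :: "nat list option"
  var_fc :: "nat list option"
  var_op :: "nat list option"
  var_oN :: int
  var_N :: int
  var_c :: "nat list option"
  var_c' :: "nat list option"
  var_r :: int
  var_M :: int
  var_k :: int
  var_s :: int
  var_n :: int
  var_K :: int
  var_q :: "nat list option"

definition initial_state :: state where
  "initial_state =
     \<lparr>pc = Start, var_v = None, var_fp = None, var_fc = None, var_op = None, var_oN = 0,
      var_N = 0, var_c = None, var_c' = None, var_r = 0, var_M = 0, var_k = 0, var_s = 0,
      var_n = 0, var_K = 0, var_q = None\<rparr>"

text \<open>
  The innermost loop reads: for all simple paths \<open>q\<close>, if \<open>A\<^sub>q / gcd(A\<^sub>q, |B\<^sub>q|) = K\<close>, continue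
  with next \<open>c\<close>; halt and return NO.  With \<open>In_Loop\<close> the last instruction belongs to the body of
  the loop over \<open>q\<close>; with \<open>After_Loop\<close> it is reached when all \<open>q\<close> have failed the test.
\<close>

datatype halt_place = In_Loop | After_Loop

context
  fixes A B :: "int mat"
begin

definition faithful_paths :: "nat \<Rightarrow> nat list set" where
  "faithful_paths v = {p \<in> simple_paths A v. weight B p \<noteq> 0}"

definition nonzero_cycles :: "nat \<Rightarrow> nat list set" where
  "nonzero_cycles v = {c \<in> simple_cycles A v. weight B c \<noteq> 0}"

definition next_v :: "state \<Rightarrow> state" where
  "next_v s = s\<lparr>var_v := next_in (vertices A) (the (var_v s)), pc := For_v\<rparr>"

definition next_c :: "state \<Rightarrow> state" where
  "next_c s =
     s\<lparr>var_c := next_in (nonzero_cycles (the (var_v s))) (the (var_c s)), pc := For_c\<rparr>"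

text \<open>
  All integer quotients below are exact in the states that occur in a run on a Katsura pair.
\<close>

definition alg5_step :: "halt_place \<Rightarrow> state \<Rightarrow> state" where
  "alg5_step h s = (let v = the (var_v s) in case pc s of
     Start \<Rightarrow> s\<lparr>var_v := first (vertices A), pc := For_v\<rparr>
   | For_v \<Rightarrow> (case var_v s of
         None \<Rightarrow> s\<lparr>pc := Return_YES\<rparr>
       | Some _ \<Rightarrow> s\<lparr>pc := Call_Order Condition\<rparr>)
   | Call_Order k \<Rightarrow> s\<lparr>var_fp := first (faithful_paths v), pc := Faithful_For_p k\<rparr>
   | Faithful_For_p k \<Rightarrow> (case var_fp s of
         None \<Rightarrow> s\<lparr>var_oN := 1, var_op := first (faithful_paths v), pc := Order_For_p k\<rparr>
       | Some p \<Rightarrow> s\<lparr>var_fc := first (simple_cycles A (last p)), pc := Faithful_For_c k\<rparr>)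
   | Faithful_For_c k \<Rightarrow> (case var_fc s of
         None \<Rightarrow> s\<lparr>var_fp := next_in (faithful_paths v) (the (var_fp s)), pc := Faithful_For_p k\<rparr>
       | Some c \<Rightarrow>
           if (of_int (weight B c) / of_int (weight A c) :: rat) \<notin> \<int>
           then s\<lparr>var_oN := 0, pc := Order_Done k\<rparr>
           else s\<lparr>var_fc := next_in (simple_cycles A (last (the (var_fp s)))) c\<rparr>)
   | Order_For_p k \<Rightarrow> (case var_op s of
         None \<Rightarrow> s\<lparr>pc := Order_Done k\<rparr>
       | Some p \<Rightarrow> s\<lparr>var_oN := lcm (var_oN s) (reduced A B p),
                     var_op := next_in (faithful_paths v) p\<rparr>)
   | Order_Done Condition \<Rightarrow>
       if var_oN s \<noteq> 0 then s\<lparr>pc := Call_Order Assignment\<rparr> else next_v s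
   | Order_Done Assignment \<Rightarrow>
       s\<lparr>var_N := var_oN s, var_c := first (nonzero_cycles v), pc := For_c\<rparr>
   | For_c \<Rightarrow> (case var_c s of
         None \<Rightarrow> next_v s
       | Some c \<Rightarrow>
           s\<lparr>var_r := 1, var_c' := first (path_prefixes c), pc := Stable_For_prefix\<rparr>)
   | Stable_For_prefix \<Rightarrow> (case var_c' s of
         None \<Rightarrow> s\<lparr>var_M := var_N s div var_r s, pc := Stable_Set_k\<rparr>
       | Some c' \<Rightarrow> s\<lparr>var_r := lcm (var_r s) (reduced A B c'),
                      var_c' := next_in (path_prefixes (the (var_c s))) c'\<rparr>)
   | Stable_Set_k \<Rightarrow>
       s\<lparr>var_k := var_M s div
            gcd (var_M s) (weight B (the (var_c s)) div weight A (the (var_c s))),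
         pc := Stable_Set_s\<rparr>
   | Stable_Set_s \<Rightarrow> s\<lparr>var_s := var_k s, pc := Stable_While\<rparr>
   | Stable_While \<Rightarrow>
       (let s' = var_s s div gcd (var_s s) (var_M s div var_s s) in
        if var_s s \<noteq> s' then s\<lparr>var_s := s'\<rparr> else s\<lparr>pc := Stable_Set_n\<rparr>)
   | Stable_Set_n \<Rightarrow> s\<lparr>var_n := var_M s div var_s s, pc := Stable_Set_K\<rparr>
   | Stable_Set_K \<Rightarrow>
       s\<lparr>var_K := var_M s div var_n s, var_q := first (simple_paths A v), pc := For_q\<rparr>
   | For_q \<Rightarrow> (case var_q s of
         None \<Rightarrow> (case h of In_Loop \<Rightarrow> next_c s | After_Loop \<Rightarrow> s\<lparr>pc := Return_NO\<rparr>)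
       | Some q \<Rightarrow>
           if reduced A B q = var_K s then next_c s
           else (case h of
               In_Loop \<Rightarrow> s\<lparr>pc := Return_NO\<rparr>
             | After_Loop \<Rightarrow> s\<lparr>var_q := next_in (simple_paths A v) q\<rparr>))
   | Return_YES \<Rightarrow> s
   | Return_NO \<Rightarrow> s)"

end


section \<open>Binary encoding\<close>

text \<open>
  Tape symbols are natural numbers: 0 is the blank, 1 and 2 are the binary digits 0 and 1, 3 is the
  minus sign, 4 ends an entry of a list and 5 ends a row of a matrix.
\<close>

fun encode_nat :: "nat \<Rightarrow> nat list" where
  "encode_nat n = (if n < 2 then [n + 1] else encode_nat (n div 2) @ [n mod 2 + 1])"

declare encode_nat.simps [simp del]

definition encode_int :: "int \<Rightarrow> nat list" where
  "encode_int z = (if z < 0 then [3] else []) @ encode_nat (nat \<bar>z\<bar>)"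

definition encode_path :: "nat list \<Rightarrow> nat list" where
  "encode_path p = concat (map (\<lambda>v. encode_nat v @ [4]) p)"

definition encode_mat :: "int mat \<Rightarrow> nat list" where
  "encode_mat A =
     concat (map (\<lambda>u. concat (map (\<lambda>w. encode_int (A $$ (u, w)) @ [4]) [0..<dim_col A]) @ [5])
       [0..<dim_row A])"

definition encode_pair :: "int mat \<times> int mat \<Rightarrow> nat list" where
  "encode_pair = (\<lambda>(A, B). encode_mat A @ encode_mat B)"

definition encode_option :: "('a \<Rightarrow> nat list) \<Rightarrow> 'a option \<Rightarrow> nat list" where
  "encode_option f x = (case x of None \<Rightarrow> [] | Some y \<Rightarrow> f y)"

definition encode_vars :: "state \<Rightarrow> nat list list" where
  "encode_vars s =
     [encode_option encode_nat (var_v s),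
      encode_option encode_path (var_fp s),
      encode_option encode_path (var_fc s),
      encode_option encode_path (var_op s),
      encode_int (var_oN s),
      encode_int (var_N s),
      encode_option encode_path (var_c s),
      encode_option encode_path (var_c' s),
      encode_int (var_r s),
      encode_int (var_M s),
      encode_int (var_k s),
      encode_int (var_s s),
      encode_int (var_n s),
      encode_int (var_K s),
      encode_option encode_path (var_q s)]"


section \<open>Deterministic Turing machines\<close>

text \<open>
  Machines have finitely many tapes, each infinite in both directions.  States and symbols are
  natural numbers below the given bounds, the start state is 0 and the blank is 0.
\<close>

datatype dir = Left | Stay | Right

record tm =
  num_tapes :: nat
  num_symbols :: nat
  num_states :: nat
  halting :: "nat set"
  trans :: "nat \<Rightarrow> nat list \<Rightarrow> nat \<times> (nat \<times> dir) list"

text \<open>The bound 6 admits the symbols used by the encodings above.\<close>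

definition turing_machine :: "tm \<Rightarrow> bool" where
  "turing_machine M \<longleftrightarrow>
     num_tapes M \<ge> 1 \<and> num_symbols M \<ge> 6 \<and> num_states M \<ge> 1 \<and> halting M \<subseteq> {..<num_states M} \<and>
     (\<forall>q < num_states M. \<forall>as. length as = num_tapes M \<and> set as \<subseteq> {..<num_symbols M} \<longrightarrow>
        (case trans M q as of (q', acts) \<Rightarrow>
           q' < num_states M \<and> length acts = num_tapes M \<and>
           fst ` set acts \<subseteq> {..<num_symbols M}))"

text \<open>A tape consists of its contents and the head position.\<close>

type_synonym tape = "(int \<Rightarrow> nat) \<times> int"

type_synonym config = "nat \<times> tape list"

fun move :: "dir \<Rightarrow> int \<Rightarrow> int" where
  "move Left i = i - 1"
| "move Stay i = i"
| "move Right i = i + 1"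

fun act :: "tape \<Rightarrow> nat \<times> dir \<Rightarrow> tape" where
  "act (t, i) (a, d) = (t(i := a), move d i)"

fun tm_step :: "tm \<Rightarrow> config \<Rightarrow> config" where
  "tm_step M (q, ts) =
     (if q \<in> halting M then (q, ts)
      else case trans M q (map (\<lambda>(t, i). t i) ts) of (q', acts) \<Rightarrow> (q', map2 act ts acts))"

definition contents :: "nat list \<Rightarrow> int \<Rightarrow> nat" where
  "contents xs i = (if 0 \<le> i \<and> i < int (length xs) then xs ! nat i else 0)"

definition initial_config :: "tm \<Rightarrow> nat list \<Rightarrow> config" where
  "initial_config M xs = (0, (contents xs, 0) # replicate (num_tapes M - 1) (contents [], 0))"

definition config_at :: "tm \<Rightarrow> nat list \<Rightarrow> nat \<Rightarrow> config" where
  "config_at M xs t = (tm_step M ^^ t) (initial_config M xs)"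

definition scanned_cells :: "tm \<Rightarrow> nat list \<Rightarrow> (nat \<times> int) set" where
  "scanned_cells M xs = {(j, snd (snd (config_at M xs t) ! j)) | j t. j < num_tapes M}"

definition uses_space_at_most :: "tm \<Rightarrow> nat list \<Rightarrow> nat \<Rightarrow> bool" where
  "uses_space_at_most M xs b \<longleftrightarrow>
     finite (scanned_cells M xs) \<and> card (scanned_cells M xs) \<le> b"


section \<open>Execution of a procedure in polynomial space\<close>

text \<open>
  A procedure maps an input to its initial state and, step by step, to further states, until it
  reaches one of its final program lines.  The field \<open>shown_vars\<close> gives the encoded values of the
  variables.
\<close>

record ('i, 's, 'l) procedure =
  start_of :: "'i \<Rightarrow> 's"
  step_of :: "'i \<Rightarrow> 's \<Rightarrow> 's"
  line_of :: "'s \<Rightarrow> 'l"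
  final_lines :: "'l set"
  shown_vars :: "'s \<Rightarrow> nat list list"

definition run :: "('i, 's, 'l) procedure \<Rightarrow> 'i \<Rightarrow> nat \<Rightarrow> 's" where
  "run P x j = (step_of P x ^^ j) (start_of P x)"

text \<open>
  A configuration displays a state of the procedure if the machine is in the control state
  assigned to the current program line and the variables are, in this order, the contents of tapes
  1, 2, \<dots>; tape 0 is the input tape, and the tapes after those of the variables are work tapes.
\<close>

definition displays ::
  "('i, 's, 'l) procedure \<Rightarrow> ('l \<Rightarrow> nat) \<Rightarrow> config \<Rightarrow> 's \<Rightarrow> bool" where
  "displays P lab cfg s \<longleftrightarrow>
     fst cfg = lab (line_of P s) \<and>
     map fst (take (length (shown_vars P s)) (tl (snd cfg))) = map contents (shown_vars P s)"

text \<open>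
  The machine executes the procedure on \<open>x\<close>: its computation passes, in order, through
  configurations that display the successive states of the procedure, and it halts at the moment
  at which the procedure does.
\<close>

definition executes ::
  "tm \<Rightarrow> ('l \<Rightarrow> nat) \<Rightarrow> ('i, 's, 'l) procedure \<Rightarrow> ('i \<Rightarrow> nat list) \<Rightarrow> 'i \<Rightarrow> bool" where
  "executes M lab P enc x \<longleftrightarrow>
     (\<exists>m \<tau>. line_of P (run P x m) \<in> final_lines P \<and>
        (\<forall>j<m. line_of P (run P x j) \<notin> final_lines P \<and> \<tau> j < \<tau> (Suc j)) \<and>
        (\<forall>j\<le>m. displays P lab (config_at M (enc x) (\<tau> j)) (run P x j)) \<and>
        fst (config_at M (enc x) (\<tau> m)) \<in> halting M)"

text \<open>
  Injectivity of \<open>lab\<close> makes the current program line, hence also the answer in the final line,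
  readable from the control state.
\<close>

definition runs_in_polynomial_space ::
  "('i, 's, 'l) procedure \<Rightarrow> ('i \<Rightarrow> nat list) \<Rightarrow> 'i set \<Rightarrow> bool" where
  "runs_in_polynomial_space P enc I \<longleftrightarrow>
     (\<exists>M lab (f :: nat poly). turing_machine M \<and> inj lab \<and>
        (\<forall>x\<in>I. executes M lab P enc x \<and>
                uses_space_at_most M (enc x) (poly f (length (enc x)))))"

definition algorithm5 :: "halt_place \<Rightarrow> (int mat \<times> int mat, state, line) procedure" where
  "algorithm5 h =
     \<lparr>start_of = (\<lambda>_. initial_state),
      step_of = (\<lambda>(A, B). alg5_step A B h),
      line_of = pc,
      final_lines = {Return_YES, Return_NO},
      shown_vars = encode_vars\<rparr>"

end

theory Submission
  imports Defs "HOL-Library.Nat_Bijection"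
begin

text \<open>
  Space is all that counts, so the machine may be as slow as it likes. A word over the symbols 1,
  ..., 5 is read as a natural number, and the only operations that are carried out on tapes are
  increment, decrement and the test for zero. A Turing machine then is a program over counters,
  and it scans about as many cells as the largest value of a counter has digits
  (\<open>reach_exec\<close>).

  A function is regarded as computable in polynomial space if a counter program computes it on
  codes with intermediate values whose lengths are polynomial in the length of the argument. These
  functions are closed under composition, pairing, case distinction, and under iteration as long
  as the iterates remain short (\<open>pspace_iter\<close>). The number of iterations may be
  exponential, and so everything can be done by trial: arithmetic, bounded quantifiers, and the
  search for the lexicographically least list with a given property among all short lists of
  vertices (\<open>pspace_search\<close>). Simple paths are the paths with distinct vertices, and
  simple cycles those whose only repetition is that of the first vertex at the end
  (\<open>simple_path_iff\<close>, \<open>simple_cycle_iff\<close>); these conditions are bounded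
  formulas about the entries of the matrices. Hence one step of the algorithm is computable in
  polynomial space (\<open>pspace_coded_step\<close>).

  It remains to see that the states themselves are small and that a final line is reached. A
  simple path and a simple cycle use each edge at most once, so \<open>A\<^sub>p\<close>, the
  quotient \<open>A\<^sub>p / gcd(A\<^sub>p, |B\<^sub>p|)\<close> and the least common multiples
  of such quotients, although taken over exponentially many paths, all divide the product of the
  nonzero entries of \<open>A\<close>, whose length is polynomial. The other integers arise from
  these by division (\<open>state_ok_step\<close>, \<open>state_size_bound\<close>). Each step
  moves a loop variable on in a finite set, decreases \<open>s\<close>, or passes to a later place
  of a loop body, so the run ends (\<open>step_progress\<close>).

  The machine has a tape for the input, one for each displayed variable, and one for the code of
  the whole state. A step computes the code of the next state, renews the displayed variables from
  it, and jumps to the control state of the next line.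
\<close>

section \<open>Words over five symbols as numbers\<close>

text \<open>
  Bijective base 5, least significant digit first. As there is no digit 0, every word over 1, ...,
  5 is the numeral of exactly one number: the contents of a tape and a natural number are the same
  thing. A carry out of the last digit adds a cell at the right end and moves nothing.
\<close>

fun digit_value :: "nat list \<Rightarrow> nat" where
  "digit_value [] = 0"
| "digit_value (d # ds) = d + 5 * digit_value ds"

fun digits :: "nat \<Rightarrow> nat list" where
  "digits n = (if n = 0 then [] else Suc ((n - 1) mod 5) # digits ((n - 1) div 5))"

declare digits.simps [simp del]

lemma digits_0 [simp]: "digits 0 = []"
  by (simp add: digits.simps)

lemma digit_value_digits [simp]: "digit_value (digits n) = n"
proof (induction n rule: digits.induct)
  case (1 n)
  show ?case
  proof (cases "n = 0")
    case False
    then have "digit_value (digits n) = Suc ((n - 1) mod 5) + 5 * ((n - 1) div 5)"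
      using 1 by (subst digits.simps) simp
    also have "\<dots> = Suc (n - 1)"
      by simp
    finally show ?thesis using False by simp
  qed (simp add: digits.simps)
qed

lemma digits_digit_value: "set ds \<subseteq> {1..5} \<Longrightarrow> digits (digit_value ds) = ds"
proof (induction ds)
  case (Cons d ds)
  then obtain c where d: "d = Suc c" "c < 5" by (cases d) auto
  then have "(d + 5 * digit_value ds - 1) mod 5 = c" "(d + 5 * digit_value ds - 1) div 5 =
    digit_value ds"
    by simp_all
  then show ?case using Cons d by (subst digits.simps) auto
qed simp

lemma set_digits: "set (digits n) \<subseteq> {1..5}"
proof (induction n rule: digits.induct)
  case (1 n)
  have "(n - 1) mod 5 < 5" by simp
  then have "Suc ((n - 1) mod 5) \<le> 5" by linarith
  with 1 show ?case by (subst digits.simps) auto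
qed

fun incr_digits :: "nat list \<Rightarrow> nat list" where
  "incr_digits [] = [1]"
| "incr_digits (d # ds) = (if d = 5 then 1 # incr_digits ds else Suc d # ds)"

fun decr_digits :: "nat list \<Rightarrow> nat list" where
  "decr_digits [] = []"
| "decr_digits (d # ds) = (if d = 1 then if ds =
  [] then [] else 5 # decr_digits ds else (d - 1) # ds)"

lemma digits_Suc: "digits (Suc n) = incr_digits (digits n)"
proof -
  have "digit_value (incr_digits ds) = Suc (digit_value ds) \<and>
    set (incr_digits ds) \<subseteq> {1..5}" if "set ds \<subseteq> {1..5}" for ds
    using that by (induction ds) auto
  from this[OF set_digits] show ?thesis
    by (metis digits_digit_value digit_value_digits)
qed

lemma digits_pred: "digits (n - Suc 0) = decr_digits (digits n)"
proof -
  have "digit_value (decr_digits ds) = digit_value ds - 1 \<and>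
    set (decr_digits ds) \<subseteq> {1..5}" if "set ds \<subseteq> {1..5}" for ds
    using that
  proof (induction ds)
    case (Cons d ds)
    have "ds \<noteq> [] \<Longrightarrow> digit_value ds > 0" using Cons.prems by (cases ds) auto
    then show ?case using Cons by auto
  qed auto
  from this[OF set_digits] show ?thesis
    by (metis One_nat_def digits_digit_value digit_value_digits)
qed

fun bit_length :: "nat \<Rightarrow> nat" where
  "bit_length n = (if n = 0 then 0 else Suc (bit_length (n div 2)))"

declare bit_length.simps [simp del]

lemma bit_length_le_iff: "bit_length n \<le> l \<longleftrightarrow> n < 2 ^ l"
proof (induction n arbitrary: l rule: bit_length.induct)
  case (1 n)
  show ?case
  proof (cases "n = 0")
    case False
    then show ?thesis
    proof (cases l)
      case (Suc k)
      have "n div 2 < 2 ^ k \<longleftrightarrow> n < 2 ^ Suc k"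
        by (simp add: div_less_iff_less_mult mult.commute)
      then show ?thesis using 1 False Suc by (subst bit_length.simps) simp
    qed (simp add: bit_length.simps)
  qed (simp add: bit_length.simps)
qed

lemma less_two_power_bit_length: "n < 2 ^ bit_length n"
  using bit_length_le_iff by blast

lemma bit_length_mono: "m \<le> n \<Longrightarrow> bit_length m \<le> bit_length n"
  using bit_length_le_iff less_two_power_bit_length le_less_trans by blast

lemma length_digits: "length (digits n) \<le> bit_length n"
proof (induction n rule: digits.induct)
  case (1 n)
  show ?case
  proof (cases "n = 0")
    case False
    have "length (digits n) = Suc (length (digits ((n - 1) div 5)))"
      using False by (subst digits.simps) simp
    also have "\<dots> \<le> Suc (bit_length ((n - 1) div 5))"
      using 1 False by simp
    also have "\<dots> \<le> Suc (bit_length (n div 2))"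
      using bit_length_mono[of "(n - 1) div 5" "n div 2"] by simp
    finally show ?thesis using False by (simp add: bit_length.simps)
  qed simp
qed

section \<open>Counter programs\<close>

text \<open>
  \<open>Goto l\<close> stands for a line of a flowchart. It abandons whatever was still to be
  executed and has no rule in the big-step semantics below, which describes the work between two
  lines.
\<close>

datatype prog =
    Skip
  | Inc nat
  | Dec nat
  | Seq prog prog
  | IfNZ nat prog prog
  | WhileNZ nat prog
  | Goto nat

text \<open>
  Counters grow in increments only, so requiring the bound there bounds all intermediate values
  (\<open>exec_bound\<close>). This is how space enters; the number of steps is not recorded.
\<close>

inductive exec :: "nat \<Rightarrow> prog \<Rightarrow> (nat \<Rightarrow> nat) \<Rightarrow> (nat
  \<Rightarrow> nat) \<Rightarrow> bool" for b where
  exec_Skip: "exec b Skip e e"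
| exec_Inc: "e r < b \<Longrightarrow> exec b (Inc r) e (e(r := Suc (e r)))"
| exec_Dec: "exec b (Dec r) e (e(r := e r - Suc 0))"
| exec_Seq: "exec b p e e' \<Longrightarrow> exec b q e' e'' \<Longrightarrow>
  exec b (Seq p q) e e''"
| exec_If: "exec b (if e r \<noteq> 0 then p else q) e e' \<Longrightarrow>
  exec b (IfNZ r p q) e e'"
| exec_While_0: "e r = 0 \<Longrightarrow> exec b (WhileNZ r p) e e"
| exec_While: "e r \<noteq> 0 \<Longrightarrow> exec b p e e' \<Longrightarrow>
  exec b (WhileNZ r p) e' e'' \<Longrightarrow>
    exec b (WhileNZ r p) e e''"

lemma exec_mono: "exec b p e e' \<Longrightarrow> b \<le> b' \<Longrightarrow> exec b' p e e'"
  by (induction rule: exec.induct) (auto intro: exec.intros)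

lemma exec_bound: "exec b p e e' \<Longrightarrow> e i \<le> b' \<Longrightarrow>
  b \<le> b' \<Longrightarrow> e' i \<le> b'"
  by (induction rule: exec.induct) auto

fun regs :: "prog \<Rightarrow> nat set" where
  "regs Skip = {}"
| "regs (Inc r) = {r}"
| "regs (Dec r) = {r}"
| "regs (Seq p q) = regs p \<union> regs q"
| "regs (IfNZ r p q) = insert r (regs p \<union> regs q)"
| "regs (WhileNZ r p) = insert r (regs p)"
| "regs (Goto l) = {}"

lemma finite_regs: "finite (regs p)"
  by (induction p) auto

section \<open>Turing machines for counter programs\<close>

text \<open>
  The control states of the machine are the stacks of commands that are still to be executed;
  \<open>main\<close> is what \<open>Goto\<close> starts.
\<close>

fun succs :: "prog \<Rightarrow> prog list \<Rightarrow> prog list set" where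
  "succs main [] = {[]}"
| "succs main (Skip # K) = {K}"
| "succs main (Inc r # K) = {K}"
| "succs main (Dec r # K) = {K}"
| "succs main (Seq p q # K) = {p # q # K}"
| "succs main (IfNZ r p q # K) = {p # K, q # K}"
| "succs main (WhileNZ r p # K) = {K, p # WhileNZ r p # K}"
| "succs main (Goto l # K) = {[main]}"

text \<open>
  All stacks that occur while a command is executed on top of \<open>K\<close>. There are finitely
  many, because a loop is put back below its own body before the body starts, so that repeated
  passes lead to the same stacks.
\<close>

fun stacks :: "prog \<Rightarrow> prog list \<Rightarrow> prog list set" where
  "stacks (Seq p q) K = {Seq p q # K} \<union> stacks p (q # K) \<union> stacks q K"
| "stacks (IfNZ r p q) K = {IfNZ r p q # K} \<union> stacks p K \<union> stacks q K"
| "stacks (WhileNZ r p) K = {WhileNZ r p # K} \<union> stacks p (WhileNZ r p # K)"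
| "stacks c K = {c # K}"

lemma finite_stacks: "finite (stacks p K)"
  by (induction p K rule: stacks.induct) auto

lemma stacks_self: "p # K \<in> stacks p K"
  by (cases p) auto

lemma succs_stacks:
  "S \<in> stacks p K \<Longrightarrow> succs main S \<subseteq> stacks p K \<union> {K, [main]}"
proof (induction p K rule: stacks.induct)
  case (1 p q K)
  then show ?case using stacks_self[of p "q # K"] stacks_self[of q K] by auto
next
  case (2 r p q K)
  then show ?case using stacks_self[of p K] stacks_self[of q K] by auto
next
  case (3 r p K)
  then show ?case using stacks_self[of p "WhileNZ r p # K"] by auto
qed auto

lemma regs_stacks:
  "S \<in> stacks p K \<Longrightarrow> c \<in> set S \<Longrightarrow>
    regs c \<subseteq> regs p \<union> \<Union> (regs ` set K)"
  by (induction p K rule: stacks.induct) fastforce+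

definition keep :: "nat list \<Rightarrow> (nat \<times> dir) list" where
  "keep as = map (\<lambda>a. (a, Stay)) as"

definition put :: "nat list \<Rightarrow> nat \<Rightarrow> nat \<Rightarrow> dir \<Rightarrow>
  (nat \<times> dir) list" where
  "put as r a d = (keep as)[r := (a, d)]"

text \<open>
  An increment or decrement of a counter runs in phases. Phase 0 starts at position 0 and moves
  the carry to the right. After a borrow, phase 1 finds out whether a digit follows; if none does,
  the digit just written was the leading one and phase 2 erases it. Phase 3 brings the head back:
  it runs into the blank at position -1 and makes one step to the right.
\<close>

fun micro :: "prog \<Rightarrow> prog list \<Rightarrow> nat \<Rightarrow> nat list \<Rightarrow>
  (prog list \<times> nat) \<times> (nat \<times> dir) list" where
  "micro main [] m as = (([], 0), keep as)"
| "micro main (Skip # K) m as = ((K, 0), keep as)"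
| "micro main (Seq p q # K) m as = ((p # q # K, 0), keep as)"
| "micro main (IfNZ r p q # K) m as = ((if as ! r \<noteq> 0 then p # K else q # K, 0), keep as)"
| "micro main (WhileNZ r p # K) m as =
     ((if as ! r \<noteq> 0 then p # WhileNZ r p # K else K, 0), keep as)"
| "micro main (Goto l # K) m as = (([main], 0), keep as)"
| "micro main (Inc r # K) m as =
     (if m = 0 then
        if as ! r = 5 then ((Inc r # K, 0), put as r 1 Right)
        else ((Inc r # K, 3), put as r (Suc (as ! r)) Left)
      else
        if as ! r = 0 then ((K, 0), put as r 0 Right)
        else ((Inc r # K, 3), put as r (as ! r) Left))"
| "micro main (Dec r # K) m as =
     (if m = 0 \<and> as ! r = 0 then ((K, 0), keep as)
      else if m = 1 \<and> as ! r = 0 then ((Dec r # K, 2), put as r 0 Left)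
      else if m = 2 then ((Dec r # K, 3), put as r 0 Left)
      else if m = 0 \<or> m = 1 then
        if as ! r = 1 then ((Dec r # K, 1), put as r 5 Right)
        else ((Dec r # K, 3), put as r (as ! r - 1) Left)
      else
        if as ! r = 0 then ((K, 0), put as r 0 Right)
        else ((Dec r # K, 3), put as r (as ! r) Left))"

text \<open>
  The list \<open>Ks\<close> numbers the control stacks. It begins with the initial one, since
  machines start in state 0; a stack and a phase together make up a state.
\<close>

locale counter_machine =
  fixes start main :: prog and finals :: "nat set" and T :: nat and Ks :: "prog list list"
  assumes distinct_Ks: "distinct Ks"
    and start_Ks: "Ks \<noteq> []" "hd Ks = [start]"
    and closed_Ks: "\<And>K. K \<in> set Ks \<Longrightarrow> succs main K \<subseteq> set Ks"
    and regs_Ks: "\<And>K c. K \<in> set Ks \<Longrightarrow> c \<in> set K \<Longrightarrow>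
      regs c \<subseteq> {..<T}"
    and T_pos: "T \<ge> 1"
begin

definition idx :: "prog list \<Rightarrow> nat" where
  "idx K = (THE i. i < length Ks \<and> Ks ! i = K)"

lemma idx_nth: "i < length Ks \<Longrightarrow> idx (Ks ! i) = i"
  unfolding idx_def using distinct_Ks by (auto simp: nth_eq_iff_index_eq)

lemma idx_less: "K \<in> set Ks \<Longrightarrow> idx K < length Ks"
  by (metis idx_nth in_set_conv_nth)

lemma nth_idx: "K \<in> set Ks \<Longrightarrow> Ks ! idx K = K"
  by (metis idx_nth in_set_conv_nth)

definition machine :: tm where
  "machine =
     \<lparr>num_tapes = T, num_symbols = 6, num_states = 4 * length Ks,
      halting = {4 * idx [Goto l] | l. l \<in> finals \<and> [Goto l] \<in> set Ks},
      trans = (\<lambda>q as. case micro main (Ks ! (q div 4)) (q mod 4) as of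
         ((K, m), acts) \<Rightarrow> (4 * idx K + m, acts))\<rparr>"

lemma micro_valid:
  assumes "K \<in> set Ks" "length as = T" "set as \<subseteq> {..<6}"
    and "micro main K m as = ((K', m'), acts)"
  shows "K' \<in> set Ks" "m' < 4" "length acts = T" "fst ` set acts \<subseteq> {..<6}"
proof -
  note cl = closed_Ks[OF assms(1)]
  have 5: "as ! r \<le> 5" if "r < T" for r
    using assms(2,3) that nth_mem[of r as] by (auto simp del: nth_mem)
  have keep: "length (keep as) = T" "fst ` set (keep as) \<subseteq> {..<6}"
    using assms(2,3) by (auto simp: keep_def)
  have put: "length (put as r a d) = T" "(x, y) \<in> set (put as r a d) \<Longrightarrow>
    a < 6 \<Longrightarrow> x < 6" for r a d x y
    using keep set_update_subset_insert[of "keep as" r "(a, d)"]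
      by (auto simp: put_def image_iff dest!: subsetD)
  have "K' \<in> set Ks \<and> m' < 4 \<and> length acts = T \<and>
    fst ` set acts \<subseteq> {..<6}"
  proof (cases K)
    case Nil
    then show ?thesis using assms(1,4) keep by auto
  next
    case (Cons c K'')
    note regs = regs_Ks[OF assms(1), of c]
    show ?thesis
    proof (cases c)
      case (Inc r)
      then have "r < T" using regs Cons by auto
      from 5[OF this] have "as ! r \<noteq> 5 \<Longrightarrow> Suc (as ! r) < 6" "as ! r < 6"
        by simp_all
      then show ?thesis
        using assms(1,4) cl put(1) Cons Inc by (auto split: if_splits dest!: put(2))
    next
      case (Dec r)
      then have "r < T" using regs Cons by auto
      from 5[OF this] have "as ! r < 6" "as ! r - Suc 0 < 6" by simp_all
      then show ?thesis
        using assms(1,4) cl put(1) keep Cons Dec by (auto split: if_splits dest!: put(2))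
    qed (use assms(1,4) cl keep Cons in \<open>auto split: if_splits\<close>)
  qed
  then show "K' \<in> set Ks" "m' < 4" "length acts = T" "fst ` set acts \<subseteq> {..<6}" by auto
qed

lemma turing_machine_machine: "turing_machine machine"
proof -
  have "4 * idx K < 4 * length Ks" if "K \<in> set Ks" for K
    using idx_less[OF that] by simp
  then have 1: "halting machine \<subseteq> {..<num_states machine}"
    by (auto simp: machine_def)
  have 2: "case trans machine q as of (q', acts) \<Rightarrow>
      q' < num_states machine \<and> length acts = num_tapes machine \<and>
      fst ` set acts \<subseteq> {..<num_symbols machine}"
    if q: "q < num_states machine" and as: "length as = num_tapes machine"
      "set as \<subseteq> {..<num_symbols machine}" for q as
  proof -
    obtain K' m' acts where m: "micro main (Ks ! (q div 4)) (q mod 4) as = ((K', m'), acts)"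
      by (metis prod.collapse)
    have "Ks ! (q div 4) \<in> set Ks" using q by (auto simp: machine_def)
    from micro_valid[OF this _ _ m] as
    have "K' \<in> set Ks" "m' < 4" "length acts = T" "fst ` set acts \<subseteq> {..<6}"
      by (auto simp: machine_def)
    with idx_less[of K'] m show ?thesis by (auto simp: machine_def)
  qed
  show ?thesis
    unfolding turing_machine_def using 1 2 T_pos start_Ks by (auto simp: machine_def Suc_le_eq)
qed

definition heads_in :: "nat \<Rightarrow> config \<Rightarrow> bool" where
  "heads_in l c \<longleftrightarrow> (\<forall>j<T. snd (snd c ! j) \<in> {-1..int l})"

text \<open>
  At least one step is made, so that successive lines of a flowchart are displayed at increasing
  times.
\<close>

definition reach :: "nat \<Rightarrow> config \<Rightarrow> config \<Rightarrow> bool" where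
  "reach l c c' \<longleftrightarrow> (\<exists>t>0. (tm_step machine ^^ t) c = c' \<and>
     (\<forall>s\<le>t. heads_in l ((tm_step machine ^^ s) c)))"

lemma reach_step: "tm_step machine c = c' \<Longrightarrow> heads_in l c \<Longrightarrow>
  heads_in l c' \<Longrightarrow> reach l c c'"
  unfolding reach_def by (rule exI[of _ 1]) (auto simp: le_Suc_eq)

lemma reach_trans:
  assumes "reach l c c'" "reach l c' c''"
  shows "reach l c c''"
proof -
  obtain t where t: "t > 0" "(tm_step machine ^^ t) c = c'"
    "\<And>s. s \<le> t \<Longrightarrow> heads_in l ((tm_step machine ^^ s) c)"
    using assms(1) unfolding reach_def by blast
  obtain u where u: "u > 0" "(tm_step machine ^^ u) c' = c''"
    "\<And>s. s \<le> u \<Longrightarrow> heads_in l ((tm_step machine ^^ s) c')"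
    using assms(2) unfolding reach_def by blast
  have eq: "(tm_step machine ^^ (s + t)) c = (tm_step machine ^^ s) c'" for s
    using t(2) by (simp add: funpow_add)
  show ?thesis unfolding reach_def
  proof (rule exI[of _ "u + t"], intro conjI allI impI)
    show "(tm_step machine ^^ (u + t)) c = c''" using eq u(2) by simp
  next
    fix s assume s: "s \<le> u + t"
    show "heads_in l ((tm_step machine ^^ s) c)"
    proof (cases "s \<le> t")
      case False
      then have "heads_in l ((tm_step machine ^^ (s - t + t)) c)"
        unfolding eq using s by (intro u(3)) simp
      then show ?thesis using False by simp
    qed (rule t(3))
  qed (use t(1) in simp)
qed

definition tapes :: "(nat \<Rightarrow> nat) \<Rightarrow> tape list" where
  "tapes e = map (\<lambda>j. (contents (digits (e j)), 0)) [0..<T]"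

text \<open>
  The configurations between two commands. While a counter is changed, the head of its tape may be
  elsewhere, which is what \<open>conf_at\<close> is for.
\<close>

definition conf :: "prog list \<Rightarrow> (nat \<Rightarrow> nat) \<Rightarrow> config" where
  "conf K e = (4 * idx K, tapes e)"

definition conf_at :: "prog list \<Rightarrow> nat \<Rightarrow> (nat \<Rightarrow> nat)
  \<Rightarrow> nat \<Rightarrow> nat list \<Rightarrow> int \<Rightarrow> config" where
  "conf_at K m e r ds i = (4 * idx K + m, (tapes e)[r := (contents ds, i)])"

lemma length_tapes [simp]: "length (tapes e) = T"
  by (simp add: tapes_def)

lemma heads_in_conf: "heads_in l (conf K e)"
  by (simp add: heads_in_def conf_def tapes_def)

lemma heads_in_conf_at: "-1 \<le> i \<Longrightarrow> i \<le> int l \<Longrightarrow>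
  heads_in l (conf_at K m e r ds i)"
  unfolding heads_in_def
proof (intro allI impI)
  fix j assume *: "-1 \<le> i" "i \<le> int l" "j < T"
  then show "snd (snd (conf_at K m e r ds i) ! j) \<in> {-1..int l}"
    by (cases "j = r") (auto simp: conf_at_def tapes_def)
qed

lemma conf_eq_conf_at: "conf_at K 0 e r (digits x) 0 = conf K (e(r := x))"
  by (auto simp: conf_def conf_at_def tapes_def nth_list_update intro!: nth_equalityI)

lemma map2_act_keep: "map2 act ts (keep (map (\<lambda>(t, i). t i) ts)) = ts"
  by (rule nth_equalityI) (auto simp: keep_def split: prod.split)

lemma map2_act_put:
  "r < length ts \<Longrightarrow>
   map2 act ts (put (map (\<lambda>(t, i). t i) ts) r a d) = ts[r := act (ts ! r) (a, d)]"
  by (rule nth_equalityI) (auto simp: put_def keep_def nth_list_update split: prod.split)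

lemma not_halting: "K \<in> set Ks \<Longrightarrow> m < 4 \<Longrightarrow>
  (m = 0 \<Longrightarrow> \<forall>l. K \<noteq> [Goto l]) \<Longrightarrow>
   4 * idx K + m \<notin> halting machine"
proof
  assume *: "K \<in> set Ks" "m < 4" "m = 0 \<Longrightarrow> \<forall>l. K \<noteq> [Goto l]"
    "4 * idx K + m \<in> halting machine"
  then obtain l where l: "[Goto l] \<in> set Ks" "4 * idx K + m = 4 * idx [Goto l]"
    by (auto simp: machine_def)
  with *(2) have "m = 0 \<and> idx K = idx [Goto l]" by presburger
  then show False using *(1,3) l(1) by (metis nth_idx)
qed

lemma tm_step_micro:
  assumes "q = 4 * idx K + m" "K \<in> set Ks" "m < 4" "q \<notin> halting machine"
    and "micro main K m (map (\<lambda>(t, i). t i) ts) = ((K', m'), acts)"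
  shows "tm_step machine (q, ts) = (4 * idx K' + m', map2 act ts acts)"
proof -
  have "q div 4 = idx K" "q mod 4 = m" using assms(1,3) by auto
  then have "trans machine q (map (\<lambda>(t, i). t i) ts) = (4 * idx K' + m', acts)"
    using assms(5) by (simp add: machine_def nth_idx[OF assms(2)])
  then show ?thesis using assms(4) by simp
qed

lemma reach_keep:
  assumes "K \<in> set Ks" "\<forall>l\<in>finals. K \<noteq> [Goto l]"
    and "micro main K 0 (map (\<lambda>(t, i). t i) (tapes e)) =
      ((K', 0), keep (map (\<lambda>(t, i). t i) (tapes e)))"
  shows "reach l (conf K e) (conf K' e)"
proof -
  have "4 * idx K \<notin> halting machine"
    using assms(1,2) by (auto simp: machine_def dest: arg_cong[of _ _ "(!) Ks"] simp: nth_idx)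
  then have "tm_step machine (conf K e) = conf K' e"
    unfolding conf_def
    by (subst tm_step_micro[OF _ assms(1) _ _ assms(3)]) (simp_all only: map2_act_keep, simp_all)
  then show ?thesis by (intro reach_step heads_in_conf)
qed

lemma reach_put:
  assumes "K \<in> set Ks" "m < 4" "r < T" "\<And>l. K \<noteq> [Goto l]"
    and "\<And>as. as ! r = contents ds i \<Longrightarrow> micro main K m as =
      ((K', m'), put as r a d)"
    and "(contents ds)(i := a) = contents ds'"
    and "-1 \<le> i" "i \<le> int l" "-1 \<le> move d i" "move d i \<le> int l"
  shows "reach l (conf_at K m e r ds i) (conf_at K' m' e r ds' (move d i))"
proof -
  let ?ts = "(tapes e)[r := (contents ds, i)]"
  have r: "map (\<lambda>(t, i). t i) ?ts ! r = contents ds i"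
    using assms(3) by simp
  have "4 * idx K + m \<notin> halting machine"
    using not_halting assms by blast
  then have "tm_step machine (conf_at K m e r ds i) = conf_at K' m' e r ds' (move d i)"
    unfolding conf_at_def using assms(3,6)
    by (subst tm_step_micro[OF refl assms(1,2) _ assms(5)[OF r]]) (auto simp: map2_act_put)
  then show ?thesis using assms(7-) by (intro reach_step heads_in_conf_at)
qed

lemma contents_append_update:
  "(contents (pre @ d # ds))(int (length pre) := a) = contents (pre @ a # ds)"
  by (auto simp: contents_def fun_eq_iff nth_append nth_Cons' nat_eq_iff)

lemma contents_append_new: "(contents pre)(int (length pre) := a) = contents (pre @ [a])"
  by (auto simp: contents_def fun_eq_iff nth_append)

lemma contents_drop_last: "(contents (pre @ [d]))(int (length pre) := 0) = contents pre"
  by (auto simp: contents_def fun_eq_iff nth_append)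

lemma contents_pre: "contents (pre @ d # ds) (int (length pre)) = d"
  by (simp add: contents_def)

lemma contents_end: "contents pre (int (length pre)) = 0" "i < 0 \<Longrightarrow>
  contents pre i = 0"
  by (simp_all add: contents_def)

text \<open>
  The digits are not blank, so the first blank to the left is at position -1.
\<close>

lemma reach_return:
  assumes "c # K \<in> set Ks" "r < T" "c = Inc r \<or> c = Dec r" "set ds \<subseteq> {1..5}"
    and "int k \<le> int (length ds)" "length ds \<le> l"
  shows "reach l (conf_at (c # K) 3 e r ds (int k - 1)) (conf_at K 0 e r ds 0)"
  using assms(5)
proof (induction k)
  case 0
  have "reach l (conf_at (c # K) 3 e r ds (- 1)) (conf_at K 0 e r ds (move Right (- 1)))"
    using assms by (intro reach_put[where a = 0]) (auto simp: contents_end fun_eq_iff)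
  then show ?case by simp
next
  case (Suc k)
  then have k: "k < length ds" by simp
  then have "ds ! k \<in> {1..5}" using assms(4) nth_mem by blast
  then have "contents ds (int k) \<noteq> 0" using k by (simp add: contents_def)
  then have "reach l (conf_at (c # K) 3 e r ds (int k)) (conf_at (c # K) 3 e r ds (move Left (int
    k)))"
    using assms k by (intro reach_put[where a = "contents ds (int k)"]) auto
  from reach_trans[OF this] Suc show ?case by simp
qed

lemma reach_Inc_aux:
  assumes "Inc r # K \<in> set Ks" "r < T"
  shows "set (pre @ ds) \<subseteq> {1..5} \<Longrightarrow> length (pre @ ds) < l \<Longrightarrow>
    reach l (conf_at (Inc r # K) 0 e r (pre @ ds) (int (length pre)))
      (conf_at K 0 e r (pre @ incr_digits ds) 0)"
proof (induction ds arbitrary: pre)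
  case Nil
  have 1: "reach l (conf_at (Inc r # K) 0 e r pre (int (length pre)))
      (conf_at (Inc r # K) 3 e r (pre @ [1]) (move Left (int (length pre))))"
    using assms Nil by (intro reach_put[OF _ _ _ _ _ contents_append_new]) (auto simp: contents_end)
  have 2: "reach l (conf_at (Inc r # K) 3 e r (pre @ [1]) (int (length pre) - 1))
      (conf_at K 0 e r (pre @ [1]) 0)"
    using assms Nil by (intro reach_return) auto
  show ?case using reach_trans[OF 1] 2 by simp
next
  case (Cons d ds)
  show ?case
  proof (cases "d = 5")
    case True
    have 1: "reach l (conf_at (Inc r # K) 0 e r (pre @ d # ds) (int (length pre)))
        (conf_at (Inc r # K) 0 e r (pre @ 1 # ds) (move Right (int (length pre))))"
      using assms Cons.prems True
      by (intro reach_put[OF _ _ _ _ _ contents_append_update]) (auto simp: contents_pre)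
    have 2: "reach l (conf_at (Inc r # K) 0 e r ((pre @ [1]) @ ds) (int (length (pre @ [1]))))
      (conf_at K 0 e r ((pre @ [1]) @ incr_digits ds) 0)"
      using Cons.prems by (intro Cons.IH) auto
    show ?thesis using reach_trans[OF 1] 2 True by (simp add: add.commute)
  next
    case False
    have 1: "reach l (conf_at (Inc r # K) 0 e r (pre @ d # ds) (int (length pre)))
        (conf_at (Inc r # K) 3 e r (pre @ Suc d # ds) (move Left (int (length pre))))"
      using assms Cons.prems False
      by (intro reach_put[OF _ _ _ _ _ contents_append_update]) (auto simp: contents_pre)
    have 2: "reach l (conf_at (Inc r # K) 3 e r (pre @ Suc d # ds) (int (length pre) - 1))
      (conf_at K 0 e r (pre @ Suc d # ds) 0)"
      using assms Cons.prems False by (intro reach_return) auto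
    show ?thesis using reach_trans[OF 1] 2 False by simp
  qed
qed

lemma reach_Inc:
  assumes "Inc r # K \<in> set Ks" "bit_length (e r) < l"
  shows "reach l (conf (Inc r # K) e) (conf K (e(r := Suc (e r))))"
proof -
  have r: "r < T" using regs_Ks[OF assms(1), of "Inc r"] by auto
  show ?thesis
    using reach_Inc_aux[OF assms(1) r, of "[]" "digits (e r)" l e] set_digits[of "e r"]
      length_digits[of "e r"] assms(2) conf_eq_conf_at[of _ e r "e r"]
    by (simp flip: digits_Suc add: conf_eq_conf_at)
qed

lemma reach_Dec_aux:
  assumes "Dec r # K \<in> set Ks" "r < T"
  shows "set (pre @ ds) \<subseteq> {1..5} \<Longrightarrow> length (pre @ ds) < l
    \<Longrightarrow> ds \<noteq> [] \<Longrightarrow> m = 0 \<or> m = 1 \<Longrightarrow>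
    reach l (conf_at (Dec r # K) m e r (pre @ ds) (int (length pre)))
      (conf_at K 0 e r (pre @ decr_digits ds) 0)"
proof (induction ds arbitrary: pre m)
  case (Cons d ds)
  show ?case
  proof (cases "d = 1")
    case True
    have 1: "reach l (conf_at (Dec r # K) m e r (pre @ d # ds) (int (length pre)))
        (conf_at (Dec r # K) 1 e r (pre @ 5 # ds) (move Right (int (length pre))))"
      using assms Cons.prems True
      by (intro reach_put[OF _ _ _ _ _ contents_append_update]) (auto simp: contents_pre)
    show ?thesis
    proof (cases "ds = []")
      case ds: True
      have 2: "reach l (conf_at (Dec r # K) 1 e r (pre @ [5]) (int (length (pre @ [5]))))
        (conf_at (Dec r # K) 2 e r (pre @ [5]) (move Left (int (length (pre @ [5])))))"
        using assms Cons.prems ds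
        by (intro reach_put[where a = 0]) (auto simp only: contents_end, auto simp: contents_def)
      have 3: "reach l (conf_at (Dec r # K) 2 e r (pre @ [5]) (int (length pre)))
        (conf_at (Dec r # K) 3 e r pre (move Left (int (length pre))))"
        using assms Cons.prems ds
        by (intro reach_put[OF _ _ _ _ _ contents_drop_last]) auto
      have 4: "reach l (conf_at (Dec r # K) 3 e r pre (int (length pre) - 1))
        (conf_at K 0 e r pre 0)"
        using assms Cons.prems by (intro reach_return) auto
      show ?thesis
        using reach_trans[OF 1] reach_trans[OF 2] reach_trans[OF 3] 4 True ds
        by (simp add: add.commute)
    next
      case False
      have "reach l (conf_at (Dec r # K) 1 e r ((pre @ [5]) @ ds) (int (length (pre @ [5]))))
        (conf_at K 0 e r ((pre @ [5]) @ decr_digits ds) 0)"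
        using Cons.prems False by (intro Cons.IH) auto
      then show ?thesis using reach_trans[OF 1] True False by (simp add: add.commute)
    qed
  next
    case False
    have 1: "reach l (conf_at (Dec r # K) m e r (pre @ d # ds) (int (length pre)))
        (conf_at (Dec r # K) 3 e r (pre @ (d - 1) # ds) (move Left (int (length pre))))"
      using assms Cons.prems False
      by (intro reach_put[OF _ _ _ _ _ contents_append_update]) (auto simp: contents_pre)
    have 2: "reach l (conf_at (Dec r # K) 3 e r (pre @ (d - 1) # ds) (int (length pre) - 1))
      (conf_at K 0 e r (pre @ (d - 1) # ds) 0)"
      using assms Cons.prems False by (intro reach_return) auto
    show ?thesis using reach_trans[OF 1] 2 False by simp
  qed
qed simp

lemma tapes_nth: "r < T \<Longrightarrow> map (\<lambda>(t, i). t i) (tapes e) ! r =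
  0 \<longleftrightarrow> e r = 0"
proof -
  assume "r < T"
  then have "map (\<lambda>(t, i). t i) (tapes e) ! r = contents (digits (e r)) 0"
    by (simp add: tapes_def)
  also have "\<dots> = 0 \<longleftrightarrow> e r = 0"
    by (subst digits.simps) (simp add: contents_def)
  finally show ?thesis .
qed

lemma reach_Dec:
  assumes "Dec r # K \<in> set Ks" "bit_length (e r) < l"
  shows "reach l (conf (Dec r # K) e) (conf K (e(r := e r - Suc 0)))"
proof -
  have r: "r < T" using regs_Ks[OF assms(1), of "Dec r"] by auto
  show ?thesis
  proof (cases "e r = 0")
    case True
    then have "e(r := e r - Suc 0) = e" by auto
    moreover have "reach l (conf (Dec r # K) e) (conf K e)"
      using assms True tapes_nth[OF r, of e] by (intro reach_keep) auto
    ultimately show ?thesis by simp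
  next
    case False
    then have "digits (e r) \<noteq> []" by (subst digits.simps) simp
    then show ?thesis
      using reach_Dec_aux[OF assms(1) r, of "[]" "digits (e r)" l 0 e] set_digits[of "e r"]
        length_digits[of "e r"] assms(2) conf_eq_conf_at[of _ e r "e r"]
        conf_eq_conf_at[of _ e r "e r - Suc 0"]
      by (simp flip: digits_pred)
  qed
qed

lemma reach_Seq:
  assumes "Seq p q # K \<in> set Ks"
  shows "reach l (conf (Seq p q # K) e) (conf (p # q # K) e) \<and> p # q # K \<in> set Ks"
  using assms closed_Ks[OF assms] by (auto intro!: reach_keep)

lemma reach_IfNZ:
  assumes "IfNZ r p q # K \<in> set Ks"
  shows "reach l (conf (IfNZ r p q # K) e) (conf ((if e r \<noteq> 0 then p else q) # K) e) \<and>
    (if e r \<noteq> 0 then p else q) # K \<in> set Ks"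
proof -
  have r: "r < T" using regs_Ks[OF assms, of "IfNZ r p q"] by auto
  show ?thesis
    using assms closed_Ks[OF assms]
    by (auto intro!: reach_keep simp: tapes_nth[OF r] simp del: nth_map)
qed

text \<open>
  Counters bounded by \<open>b\<close> have at most \<open>bit_length b\<close> digits, and the
  heads leave the digits by at most one cell at either end: space is logarithmic in the counters,
  however long the execution takes.
\<close>

lemma reach_exec:
  assumes "exec b p e e'" "\<And>i. e i \<le> b" "p # K \<in> set Ks"
  shows "reach (Suc (bit_length b)) (conf (p # K) e) (conf K e') \<and> K \<in> set Ks"
  using assms
proof (induction arbitrary: K rule: exec.induct)
  case (exec_Skip e)
  then show ?case using closed_Ks[OF exec_Skip(2)] by (auto intro!: reach_keep)
next
  case (exec_Inc e r)
  have "bit_length (e r) \<le> bit_length b" by (rule bit_length_mono[OF exec_Inc(2)])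
  then have "reach (Suc (bit_length b)) (conf (Inc r # K) e) (conf K (e(r := Suc (e r))))"
    using exec_Inc by (intro reach_Inc) auto
  then show ?case using closed_Ks[OF exec_Inc(3)] by (simp add: fun_upd_def)
next
  case (exec_Dec r e)
  have "bit_length (e r) \<le> bit_length b" by (rule bit_length_mono[OF exec_Dec(1)])
  then have "reach (Suc (bit_length b)) (conf (Dec r # K) e) (conf K (e(r := e r - Suc 0)))"
    using exec_Dec by (intro reach_Dec) auto
  then show ?case using closed_Ks[OF exec_Dec(2)] by (simp add: fun_upd_def)
next
  case (exec_Seq p e e' q e'')
  have b: "e' i \<le> b" for i
    using exec_bound[OF exec_Seq.hyps(1)] exec_Seq.prems(1) by simp
  note step = reach_Seq[OF exec_Seq.prems(2), of "Suc (bit_length b)" e]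
  show ?case
    using exec_Seq.IH(1)[OF exec_Seq.prems(1), of "q # K"] exec_Seq.IH(2)[OF b, of K] step
    by (blast intro: reach_trans)
next
  case (exec_If e r p q e')
  note step = reach_IfNZ[OF exec_If.prems(2), of "Suc (bit_length b)" e]
  show ?case
    using exec_If.IH[OF exec_If.prems(1), of K] step by (blast intro: reach_trans)
next
  case (exec_While_0 e r p)
  have r: "r < T" using regs_Ks[OF exec_While_0.prems(2), of "WhileNZ r p"] by auto
  have "K \<in> set Ks" using closed_Ks[OF exec_While_0.prems(2)] by auto
  then show ?case
    using exec_While_0 by (auto intro!: reach_keep simp: tapes_nth[OF r] simp del: nth_map)
next
  case (exec_While e r p e' e'')
  have r: "r < T" using regs_Ks[OF exec_While.prems(2), of "WhileNZ r p"] by auto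
  have b: "e' i \<le> b" for i
    using exec_bound[OF exec_While.hyps(2)] exec_While.prems(1) by simp
  have 1: "reach (Suc (bit_length b)) (conf (WhileNZ r p # K) e) (conf (p # WhileNZ r p # K) e)"
    using exec_While.prems exec_While.hyps
    by (intro reach_keep) (auto simp: tapes_nth[OF r] simp del: nth_map)
  have K: "p # WhileNZ r p # K \<in> set Ks" using closed_Ks[OF exec_While.prems(2)] by auto
  show ?case
    using exec_While.IH(1)[OF exec_While.prems(1) K] exec_While.IH(2)[OF b] 1
    by (blast intro: reach_trans)
qed

end

section \<open>Codes of polynomial length\<close>

text \<open>
  Data are held in counters by their codes. Injectivity is what makes equality of data decidable.
\<close>

class code =
  fixes enc :: "'a \<Rightarrow> nat"
  assumes enc_inj: "enc x = enc y \<Longrightarrow> x = y"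

lemma enc_eq_iff: "enc x = enc y \<longleftrightarrow> x = y"
  by (auto dest: enc_inj)

instantiation nat :: code
begin
definition enc_nat :: "nat \<Rightarrow> nat" where "enc_nat n = n"
instance by standard (simp add: enc_nat_def)
end

instantiation prod :: (code, code) code
begin
definition enc_prod :: "'a \<times> 'b \<Rightarrow> nat" where "enc_prod z =
  prod_encode (enc (fst z), enc (snd z))"
instance by standard (auto simp: enc_prod_def prod_eq_iff enc_eq_iff)
end

instantiation bool :: code
begin
definition enc_bool :: "bool \<Rightarrow> nat" where "enc_bool b = of_bool b"
instance by standard (auto simp: enc_bool_def of_bool_def split: if_splits)
end

declare enc_nat_def [simp]

definition code_size :: "'a::code \<Rightarrow> nat" where
  "code_size a = bit_length (enc a)"

text \<open>
  Two ways of being polynomial in the length of the code of the argument: here for the value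
  itself, below for the length of the value.
\<close>

definition poly_value :: "('a::code \<Rightarrow> nat) \<Rightarrow> bool" where
  "poly_value m \<longleftrightarrow> (\<exists>q :: nat poly. \<forall>a. m a \<le>
    poly q (code_size a))"

definition poly_length :: "('a::code \<Rightarrow> nat) \<Rightarrow> bool" where
  "poly_length f \<longleftrightarrow> poly_value (\<lambda>a. bit_length (f a))"

lemma poly_nat_mono: "x \<le> y \<Longrightarrow> poly q x \<le> poly q (y :: nat)"
  by (induction q) (auto intro!: add_mono mult_mono)

lemma poly_valueI: "(\<And>a. m a \<le> poly q (code_size a)) \<Longrightarrow> poly_value m"
  unfolding poly_value_def by blast

lemma poly_value_mono: "poly_value m \<Longrightarrow> (\<And>a. m' a \<le> m a) \<Longrightarrow>
  poly_value m'"
  unfolding poly_value_def using le_trans by blast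

lemma poly_value_const: "poly_value (\<lambda>_. k)"
  by (rule poly_valueI[of _ "[:k:]"]) simp

lemma poly_value_code_size: "poly_value code_size"
  by (rule poly_valueI[of _ "[:0, 1:]"]) simp

lemma poly_value_add: "poly_value m \<Longrightarrow> poly_value m' \<Longrightarrow>
  poly_value (\<lambda>a. m a + m' a)"
  unfolding poly_value_def by (metis add_mono poly_add)

lemma poly_value_mult: "poly_value m \<Longrightarrow> poly_value m' \<Longrightarrow>
  poly_value (\<lambda>a. m a * m' a)"
  unfolding poly_value_def by (metis mult_mono' poly_mult zero_le)

lemma poly_value_poly:
  fixes q :: "nat poly"
  assumes "poly_value m"
  shows "poly_value (\<lambda>a. poly q (m a))"
proof -
  obtain p :: "nat poly" where "\<And>a. m a \<le> poly p (code_size a)"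
    using assms unfolding poly_value_def by blast
  then show ?thesis by (intro poly_valueI[of _ "pcompose q p"]) (simp add: poly_pcompose
    poly_nat_mono)
qed

lemma poly_value_comp: "poly_value m \<Longrightarrow> poly_value (\<lambda>a. code_size (f a))
  \<Longrightarrow> poly_value (\<lambda>a. m (f a))"
  unfolding poly_value_def[of m] by (blast intro: poly_value_mono poly_value_poly)

lemma poly_length_mono: "poly_length f \<Longrightarrow> (\<And>a. g a \<le>
  f a) \<Longrightarrow> poly_length g"
  unfolding poly_length_def by (blast intro: poly_value_mono bit_length_mono)

lemma poly_length_const: "poly_length (\<lambda>_. k)"
  unfolding poly_length_def by (rule poly_value_const)

lemma poly_length_enc: "poly_length enc"
  using poly_value_code_size by (simp add: poly_length_def code_size_def[abs_def])

lemma poly_length_add: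
  assumes "poly_length f" "poly_length g"
  shows "poly_length (\<lambda>a. f a + g a)"
proof -
  have "bit_length (x + y) \<le> bit_length x + bit_length y + 1" for x y
  proof -
    have "(2::nat) ^ bit_length x \<le> 2 ^ (bit_length x + bit_length y)" "(2::nat) ^ bit_length
      y \<le> 2 ^ (bit_length x + bit_length y)"
      by (rule power_increasing; simp)+
    then show ?thesis using less_two_power_bit_length[of x] less_two_power_bit_length[of y]
      unfolding bit_length_le_iff power_add[of _ _ 1] power_one_right by linarith
  qed
  moreover have "poly_value (\<lambda>a. bit_length (f a) + bit_length (g a) + 1)"
    using assms unfolding poly_length_def by (intro poly_value_add poly_value_const)
  ultimately show ?thesis
    unfolding poly_length_def by (elim poly_value_mono) simp
qed

lemma bit_length_mult: "bit_length (x * y) \<le> bit_length x + bit_length y"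
  unfolding bit_length_le_iff power_add
  using less_two_power_bit_length[of x] less_two_power_bit_length[of y]
    by (intro mult_strict_mono) auto

lemma poly_length_mult: "poly_length f \<Longrightarrow> poly_length g \<Longrightarrow>
  poly_length (\<lambda>a. f a * g a)"
  unfolding poly_length_def by (rule poly_value_mono[OF poly_value_add bit_length_mult])

lemma bit_length_le_self: "bit_length n \<le> n"
  by (subst bit_length_le_iff) simp

lemma poly_length_poly_value: "poly_value m \<Longrightarrow> poly_length m"
  unfolding poly_length_def by (rule poly_value_mono[OF _ bit_length_le_self])

lemma poly_value_bit_length: "poly_length f \<Longrightarrow> poly_value (\<lambda>a. bit_length
  (f a))"
  by (simp add: poly_length_def)

lemma poly_length_power:
  assumes "poly_length f" "poly_value m"
  shows "poly_length (\<lambda>a. f a ^ m a)"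
proof -
  have "bit_length (x ^ k) \<le> Suc (bit_length x * k)" for x k
  proof -
    have "x ^ k \<le> (2 ^ bit_length x) ^ k"
      using less_two_power_bit_length[of x] by (intro power_mono) auto
    also have "\<dots> < 2 ^ Suc (bit_length x * k)" by (simp add: power_mult)
    finally show ?thesis by (simp add: bit_length_le_iff)
  qed
  moreover have "poly_value (\<lambda>a. 1 + bit_length (f a) * m a)"
    using assms unfolding poly_length_def by (intro poly_value_add poly_value_mult poly_value_const)
  ultimately show ?thesis
    unfolding poly_length_def by (elim poly_value_mono) simp
qed

lemma poly_length_comp: "poly_length g \<Longrightarrow> poly_length (\<lambda>a. enc (f a))
  \<Longrightarrow> poly_length (\<lambda>a. g (f a))"
  unfolding poly_length_def by (rule poly_value_comp) (simp_all add: code_size_def)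

lemma prod_encode_le: "x \<le> x' \<Longrightarrow> y \<le> y' \<Longrightarrow>
  prod_encode (x, y) \<le> (x' + y' + 1) ^ 2"
proof -
  assume "x \<le> x'" "y \<le> y'"
  have "triangle n \<le> n * n" for n by (induction n) auto
  from this[of "x + y"] have "prod_encode (x, y) \<le> (x + y + 1) ^ 2"
    by (simp add: prod_encode_def power2_eq_square)
  also have "\<dots> \<le> (x' + y' + 1) ^ 2"
    using \<open>x \<le> x'\<close> \<open>y \<le> y'\<close> by (intro power_mono) auto
  finally show ?thesis .
qed

lemma poly_length_pair: "poly_length f \<Longrightarrow> poly_length g \<Longrightarrow>
  poly_length (\<lambda>a. prod_encode (f a, g a))"
  by (rule poly_length_mono[OF _ prod_encode_le[OF order_refl order_refl]])
    (intro poly_length_power poly_value_const poly_length_add poly_length_const)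

text \<open>
  Needed for loops: the body is executed on ever new values \<open>x\<close>, but if their lengths
  are polynomial in the length of \<open>c\<close>, one bound that depends on \<open>c\<close>
  alone serves all passes.
\<close>

lemma poly_length_uniform:
  fixes B :: "'a::code \<times> 'b::code \<Rightarrow> nat"
  assumes "poly_length B" "poly_length G"
  obtains B' where "poly_length B'" "\<And>c x. enc x \<le> G c \<Longrightarrow>
    B (c, x) \<le> B' c"
proof -
  obtain q :: "nat poly" where q: "\<And>z. bit_length (B z) \<le> poly q (code_size z)"
    using assms(1) unfolding poly_length_def poly_value_def by blast
  let ?B = "\<lambda>c. 2 ^ poly q (bit_length ((enc c + G c + 1) ^ 2)) :: nat"
  show ?thesis
  proof
    show "poly_length ?B"
      by (intro poly_length_power poly_length_const poly_value_poly poly_value_bit_length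
        poly_length_add poly_length_enc poly_value_const assms)
  next
    fix c and x :: 'b assume "enc x \<le> G c"
    then have "code_size (c, x) \<le> bit_length ((enc c + G c + 1) ^ 2)"
      unfolding code_size_def enc_prod_def by (intro bit_length_mono) (use prod_encode_le in simp)
    then have "bit_length (B (c, x)) \<le> poly q (bit_length ((enc c + G c + 1) ^ 2))"
      using q[of "(c, x)"] poly_nat_mono le_trans by blast
    then show "B (c, x) \<le> ?B c" by (simp add: bit_length_le_iff)
  qed
qed

section \<open>Elementary counter programs\<close>

lemma exec_eq: "exec b p e e1 \<Longrightarrow> e1 = e2 \<Longrightarrow> exec b p e e2"
  by simp

text \<open>
  \<open>E k\<close> is the environment after \<open>k\<close> passes; a loop is verified by
  giving all of them in closed form.
\<close>

lemma exec_While_iter: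
  assumes "\<And>k. k < n \<Longrightarrow> E k r \<noteq> 0 \<and>
    exec b p (E k) (E (Suc k))" "E n r = 0"
  shows "exec b (WhileNZ r p) (E 0) (E n)"
  using assms
proof (induction n arbitrary: E)
  case 0
  then show ?case by (auto intro: exec_While_0)
next
  case (Suc n)
  have "exec b (WhileNZ r p) (E (Suc 0)) (E (Suc n))"
    using Suc.IH[of "\<lambda>k. E (Suc k)"] Suc.prems by auto
  then show ?case using Suc.prems(1)[of 0] by (auto intro: exec_While)
qed

definition clear :: "nat \<Rightarrow> prog" where
  "clear r = WhileNZ r (Dec r)"

lemma exec_clear: "exec b (clear r) e (e(r := 0))"
proof -
  have "exec b (WhileNZ r (Dec r)) (e(r := e r - 0)) (e(r := e r - e r))"
  proof (rule exec_While_iter)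
    fix k assume "k < e r"
    then show "(e(r := e r - k)) r \<noteq> 0 \<and> exec b (Dec r) (e(r := e r - k)) (e(r := e r
      - Suc k))"
      by (intro conjI exec_eq[OF exec_Dec]) auto
  qed simp
  then show ?thesis by (simp add: clear_def)
qed

definition move_add :: "nat \<Rightarrow> nat \<Rightarrow> prog" where
  "move_add r w = WhileNZ r (Seq (Dec r) (Inc w))"

lemma exec_move_add:
  assumes "r \<noteq> w" "e r + e w \<le> b"
  shows "exec b (move_add r w) e (e(r := 0, w := e r + e w))"
proof -
  let ?E = "\<lambda>k. e(r := e r - k, w := e w + k)"
  have "exec b (WhileNZ r (Seq (Dec r) (Inc w))) (?E 0) (?E (e r))"
  proof (rule exec_While_iter)
    fix k assume k: "k < e r"
    have "exec b (Seq (Dec r) (Inc w)) (?E k) (?E (Suc k))"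
      by (rule exec_Seq[OF exec_Dec exec_eq[OF exec_Inc]]) (use assms k in \<open>auto simp:
        fun_eq_iff\<close>)
    then show "?E k r \<noteq> 0 \<and> exec b (Seq (Dec r) (Inc w)) (?E k) (?E (Suc k))"
      using k assms by simp
  qed (use assms in simp)
  then show ?thesis by (simp add: move_add_def add.commute)
qed

definition copy_add :: "nat \<Rightarrow> nat \<Rightarrow> nat \<Rightarrow> prog" where
  "copy_add r w t = Seq (WhileNZ r (Seq (Dec r) (Seq (Inc w) (Inc t)))) (move_add t r)"

lemma exec_copy_add:
  assumes "distinct [r, w, t]" "e t = 0" "e r + e w \<le> b"
  shows "exec b (copy_add r w t) e (e(w := e r + e w))"
proof -
  let ?E = "\<lambda>k. e(r := e r - k, w := e w + k, t := k)"
  have 1: "exec b (WhileNZ r (Seq (Dec r) (Seq (Inc w) (Inc t)))) (?E 0) (?E (e r))"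
  proof (rule exec_While_iter)
    fix k assume k: "k < e r"
    have "exec b (Seq (Dec r) (Seq (Inc w) (Inc t))) (?E k) (?E (Suc k))"
      by (rule exec_Seq[OF exec_Dec exec_Seq[OF exec_Inc exec_eq[OF exec_Inc]]])
        (use assms k in \<open>auto simp: fun_eq_iff\<close>)
    then show "?E k r \<noteq> 0 \<and> exec b (Seq (Dec r) (Seq (Inc w) (Inc t))) (?E k) (?E (Suc
      k))"
      using k assms by simp
  qed (use assms in simp)
  have 2: "exec b (move_add t r) (?E (e r)) (e(w := e r + e w))"
    by (rule exec_eq[OF exec_move_add]) (use assms in \<open>auto simp: fun_eq_iff\<close>)
  have "?E 0 = e" using assms by (auto simp: fun_eq_iff)
  then show ?thesis using exec_Seq[OF 1 2] by (simp add: copy_add_def)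
qed

text \<open>
  The loop adds up the numbers from \<open>x + y\<close> down to 1, which is the triangle number
  in the code of the pair \<open>(x, y)\<close>.
\<close>

definition pairing :: "nat \<Rightarrow> nat \<Rightarrow> nat \<Rightarrow> prog" where
  "pairing r s w =
     Seq (copy_add r (w + 1) (w + 2)) (Seq (copy_add s (w + 1) (w + 2))
       (Seq (WhileNZ (w + 1) (Seq (copy_add (w + 1) w (w + 2)) (Dec (w + 1)))) (copy_add r w (w +
         2))))"

lemma exec_pairing:
  assumes "r < w" "s < w" "\<And>i. i \<ge> w \<Longrightarrow> e i =
    0" "prod_encode (e r, e s) \<le> b"
  shows "exec b (pairing r s w) e (e(w := prod_encode (e r, e s)))"
proof -
  let ?n = "e r + e s"
  let ?E = "\<lambda>k. e(w + 1 := ?n - k, w := triangle ?n - triangle (?n - k))"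
  have b: "triangle ?n + e r \<le> b" using assms(4) by (simp add: prod_encode_def)
  have tn: "k \<le> triangle k" for k by (induction k) auto
  have mono: "triangle (?n - k) \<le> triangle ?n" for k
    by (rule lift_Suc_mono_le[of triangle]) auto
  have 1: "exec b (copy_add r (w + 1) (w + 2)) e (e(w + 1 := e r))"
    by (rule exec_eq[OF exec_copy_add]) (use assms b in auto)
  have 2: "exec b (copy_add s (w + 1) (w + 2)) (e(w + 1 := e r)) (?E 0)"
    by (rule exec_eq[OF exec_copy_add]) (use assms b tn[of ?n] in \<open>auto simp:
      fun_eq_iff\<close>)
  have 3: "exec b (WhileNZ (w + 1) (Seq (copy_add (w + 1) w (w + 2)) (Dec (w + 1)))) (?E 0) (?E ?n)"
  proof (rule exec_While_iter)
    fix k assume k: "k < ?n"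
    then obtain m where m: "?n - k = Suc m" by (metis Suc_diff_Suc)
    then have m': "?n - Suc k = m" by simp
    have le: "triangle (Suc m) \<le> triangle ?n" using mono[of k] m by simp
    have "exec b (Seq (copy_add (w + 1) w (w + 2)) (Dec (w + 1))) (?E k) (?E (Suc k))"
      by (rule exec_Seq[OF exec_copy_add exec_eq[OF exec_Dec]])
        (use assms(1-3) b k m m' le in \<open>auto simp: fun_eq_iff\<close>)
    then show "?E k (w + 1) \<noteq> 0 \<and>
        exec b (Seq (copy_add (w + 1) w (w + 2)) (Dec (w + 1))) (?E k) (?E (Suc k))"
      using k by simp
  qed simp
  have 4: "exec b (copy_add r w (w + 2)) (?E ?n) (e(w := prod_encode (e r, e s)))"
    by (rule exec_eq[OF exec_copy_add]) (use assms b in \<open>auto simp: fun_eq_iff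
      prod_encode_def\<close>)
  show ?thesis unfolding pairing_def by (intro exec_Seq[OF 1] exec_Seq[OF 2] exec_Seq[OF 3] 4)
qed

text \<open>
  Counts through the pairs in the order of their codes, see \<open>prod_decode_Suc\<close>.
\<close>

definition unpairing :: "nat \<Rightarrow> nat \<Rightarrow> prog" where
  "unpairing r w =
     Seq (copy_add r (w + 2) (w + 3)) (WhileNZ (w + 2) (Seq (Dec (w + 2))
       (IfNZ (w + 1) (Seq (Dec (w + 1)) (Inc w)) (Seq (move_add w (w + 1)) (Inc (w + 1))))))"

lemma prod_decode_Suc:
  "prod_decode (Suc k) =
    (case prod_decode k of (m, n) \<Rightarrow> if n = 0 then (0, Suc m) else (Suc m, n - 1))"
proof -
  obtain m n where mn: "prod_decode k = (m, n)" by fastforce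
  then have k: "k = prod_encode (m, n)" by (metis prod_decode_inverse)
  have "Suc k = prod_encode (if n = 0 then (0, Suc m) else (Suc m, n - 1))"
    using k by (cases n) (auto simp: prod_encode_def)
  then have "prod_decode (Suc k) = (if n = 0 then (0, Suc m) else (Suc m, n - 1))"
    by (metis prod_encode_inverse)
  then show ?thesis by (simp add: mn)
qed

lemma prod_decode_le: "fst (prod_decode k) + snd (prod_decode k) \<le> k"
proof -
  have tn: "k \<le> triangle k" for k by (induction k) auto
  obtain m n where mn: "prod_decode k = (m, n)" by fastforce
  then have "k = prod_encode (m, n)" by (metis prod_decode_inverse)
  then have "m + n \<le> k" using tn[of "m + n"] by (simp add: prod_encode_def)
  then show ?thesis by (simp add: mn)
qed

lemma exec_unpairing:
  assumes "r < w" "\<And>i. i \<ge> w \<Longrightarrow> e i = 0" "e r \<le> b"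
  shows "exec b (unpairing r w) e
    (e(w := fst (prod_decode (e r)), w + 1 := snd (prod_decode (e r))))"
proof -
  let ?E = "\<lambda>k. e(w := fst (prod_decode k), w + 1 := snd (prod_decode k), w + 2 := e r - k)"
  let ?p = "Seq (Dec (w + 2))
       (IfNZ (w + 1) (Seq (Dec (w + 1)) (Inc w)) (Seq (move_add w (w + 1)) (Inc (w + 1))))"
  have d0: "prod_decode 0 = (0, 0)"
    using prod_decode_le[of 0] by (simp add: prod_eq_iff)
  have 1: "exec b (copy_add r (w + 2) (w + 3)) e (?E 0)"
    by (rule exec_eq[OF exec_copy_add]) (use assms in \<open>auto simp: fun_eq_iff d0\<close>)
  have 2: "exec b (WhileNZ (w + 2) ?p) (?E 0) (?E (e r))"
  proof (rule exec_While_iter)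
    fix k assume k: "k < e r"
    obtain m n where mn: "prod_decode k = (m, n)" by fastforce
    have le: "m + n \<le> k" using prod_decode_le[of k] mn by simp
    let ?e = "(?E k)(w + 2 := e r - Suc k)"
    have a: "exec b (Dec (w + 2)) (?E k) ?e"
      by (rule exec_eq[OF exec_Dec]) (auto simp: fun_eq_iff)
    have b: "exec b (IfNZ (w + 1) (Seq (Dec (w + 1)) (Inc w)) (Seq (move_add w (w + 1)) (Inc (w +
      1))))
        ?e (?E (Suc k))"
    proof (cases "n = 0")
      case True
      have "exec b (Seq (move_add w (w + 1)) (Inc (w + 1))) ?e (?E (Suc k))"
        by (rule exec_Seq[OF exec_move_add exec_eq[OF exec_Inc]])
          (use True mn k le assms(3) in \<open>auto simp: fun_eq_iff prod_decode_Suc\<close>)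
      then show ?thesis using True mn by (intro exec_If) simp
    next
      case False
      have "exec b (Seq (Dec (w + 1)) (Inc w)) ?e (?E (Suc k))"
        by (rule exec_Seq[OF exec_Dec exec_eq[OF exec_Inc]])
          (use False mn k le assms(3) in \<open>auto simp: fun_eq_iff prod_decode_Suc\<close>)
      then show ?thesis using False mn by (intro exec_If) simp
    qed
    show "?E k (w + 2) \<noteq> 0 \<and> exec b ?p (?E k) (?E (Suc k))"
      using exec_Seq[OF a b] k by simp
  qed simp
  have "?E (e r) = e(w := fst (prod_decode (e r)), w + 1 := snd (prod_decode (e r)))"
    using assms(2)[of "w + 2"] by (auto simp: fun_eq_iff)
  with exec_Seq[OF 1 2] show ?thesis by (simp add: unpairing_def)
qed

section \<open>Functions computable in polynomial space\<close>

text \<open>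
  The argument is in counter \<open>r\<close>, the result is put into counter \<open>w\<close>,
  and the counters above \<open>w\<close> serve as scratch space. The program is a family in
  \<open>r\<close> and \<open>w\<close> because a composed program has to place its parts at
  different counters. Everything but the result is restored.
\<close>

definition computes ::
  "(nat \<Rightarrow> nat \<Rightarrow> prog) \<Rightarrow> ('a::code \<Rightarrow> nat)
    \<Rightarrow> ('a \<Rightarrow> 'b::code) \<Rightarrow> bool" where
  "computes p B f \<longleftrightarrow> (\<forall>r w a e b. r < w \<longrightarrow> e r =
    enc a \<longrightarrow> (\<forall>i\<ge>w. e i =
      0) \<longrightarrow> B a \<le> b \<longrightarrow>
     exec b (p r w) e (e(w := enc (f a))))"

definition pspace :: "('a::code \<Rightarrow> 'b::code) \<Rightarrow> bool" where
  "pspace f \<longleftrightarrow> (\<exists>B p. poly_length B \<and> computes p B f)"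

lemma computesD:
  "computes p B f \<Longrightarrow> r < w \<Longrightarrow> e r = enc a \<Longrightarrow>
    (\<And>i. i \<ge> w \<Longrightarrow> e i = 0) \<Longrightarrow> B a \<le> b \<Longrightarrow>
   exec b (p r w) e (e(w := enc (f a)))"
  by (simp add: computes_def)

lemma pspace_I:
  assumes "poly_length B"
    and "\<And>r w a e. r < w \<Longrightarrow> e r = enc a \<Longrightarrow>
      (\<And>i. i \<ge> w \<Longrightarrow> e i = 0) \<Longrightarrow>
      exec (B a) (p r w) e (e(w := enc (f a)))"
  shows "pspace f"
  unfolding pspace_def computes_def using assms exec_mono by blast

lemma pspace_E:
  assumes "pspace f"
  obtains B p where "poly_length B" "\<And>a. enc (f a) \<le> B a" "computes p B f"
proof -
  obtain B p where p: "poly_length B" "computes p B f"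
    using assms unfolding pspace_def by blast
  have "enc (f a) \<le> B a" for a
    using exec_bound[OF computesD[OF p(2), of 0 1 "(\<lambda>_. 0)(0 := enc a)" a],
      of "B a" 1 "B a"] by simp
  from that[OF p(1) this p(2)] show ?thesis .
qed

lemma pspace_length_bound: "pspace f \<Longrightarrow> poly_length (\<lambda>a. enc (f a))"
  by (erule pspace_E) (rule poly_length_mono)

text \<open>
  Only codes matter. A function on any type is therefore obtained from one on numbers that acts on
  codes in the same way.
\<close>

lemma pspace_recode: "pspace f \<Longrightarrow> (\<And>a. enc (g a) =
  enc (f a)) \<Longrightarrow> pspace g"
  by (simp add: pspace_def computes_def)

lemma pspace_id: "pspace (\<lambda>a. a)"
  by (rule pspace_I[where p = "\<lambda>r w. copy_add r w (w + 1)",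
    OF poly_length_enc]) (auto intro!: exec_eq[OF exec_copy_add])

lemma pspace_enc: "pspace enc"
  by (rule pspace_recode[OF pspace_id]) simp

lemma pspace_const: "pspace (\<lambda>_. k)"
proof (rule pspace_I[OF poly_length_const])
  have "exec b (((Seq (Inc w)) ^^ n) Skip) e (e(w := e w + n))"
    if "e w + n \<le> b" for b w n and e :: "nat \<Rightarrow> nat"
    using that
  proof (induction n arbitrary: e)
    case (Suc n)
    have "exec b ((Seq (Inc w) ^^ n) Skip) (e(w := Suc (e w))) (e(w := e w + Suc n))"
      using Suc.prems by (intro exec_eq[OF Suc.IH]) auto
    then have "exec b (Seq (Inc w) ((Seq (Inc w) ^^ n) Skip)) e (e(w := e w + Suc n))"
      by (rule exec_Seq[OF exec_Inc, rotated]) (use Suc.prems in simp)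
    then show ?case by (simp only: funpow.simps o_apply)
  qed (auto intro: exec_Skip)
  then show "exec (enc k) (((Seq (Inc w)) ^^ enc k) Skip) e (e(w := enc k))"
    if "\<And>i. i \<ge> w \<Longrightarrow> e i = 0" for w and e :: "nat \<Rightarrow> nat"
    using that[of w] by (metis add_0 order_refl)
qed

lemma pspace_Suc0: "pspace Suc"
proof (rule pspace_I[where p = "\<lambda>r w. Seq (copy_add r w (w + 1)) (Inc w)"])
  show "poly_length (\<lambda>a::nat. enc a + 1)"
    by (intro poly_length_add poly_length_enc poly_length_const)
qed (auto intro!: exec_Seq[OF exec_copy_add exec_eq[OF exec_Inc]] simp: fun_eq_iff)

lemma pspace_pred0: "pspace (\<lambda>n::nat. n - 1)"
proof (rule pspace_I[where p = "\<lambda>r w. Seq (copy_add r w (w + 1)) (Dec w)"])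
  show "poly_length (\<lambda>a::nat. enc a + 1)"
    by (intro poly_length_add poly_length_enc poly_length_const)
qed (auto intro!: exec_Seq[OF exec_copy_add exec_eq[OF exec_Dec]] simp: fun_eq_iff)

lemma pspace_fst0: "pspace fst"
proof (rule pspace_I[where p = "\<lambda>r w. Seq (unpairing r w) (clear (w + 1))",
  OF poly_length_enc])
  fix r w :: nat and a :: "'a \<times> 'b" and e
  assume *: "r < w" "e r = enc a" "\<And>i. i \<ge> w \<Longrightarrow> e i = (0::nat)"
  show "exec (enc a) (Seq (unpairing r w) (clear (w + 1))) e (e(w := enc (fst a)))"
    by (rule exec_Seq[OF exec_unpairing exec_eq[OF exec_clear]])
      (use * in \<open>auto simp: fun_eq_iff enc_prod_def\<close>)
qed

lemma pspace_snd0: "pspace snd"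
proof (rule pspace_I[where p = "\<lambda>r w. Seq (unpairing r w) (Seq (clear w) (move_add (w + 1)
  w))", OF poly_length_enc])
  fix r w :: nat and a :: "'a \<times> 'b" and e
  assume *: "r < w" "e r = enc a" "\<And>i. i \<ge> w \<Longrightarrow> e i = (0::nat)"
  show "exec (enc a) (Seq (unpairing r w) (Seq (clear w) (move_add (w + 1) w))) e (e(w := enc (snd
    a)))"
    by (rule exec_Seq[OF exec_unpairing exec_Seq[OF exec_clear exec_eq[OF exec_move_add]]])
      (use * le_prod_encode_2 in \<open>auto simp: fun_eq_iff enc_prod_def\<close>)
qed

lemma pspace_comp:
  fixes f :: "'a::code \<Rightarrow> 'b::code"
  assumes "pspace f" "pspace g"
  shows "pspace (\<lambda>a. g (f a))"
proof -
  obtain Bf pf where f: "poly_length Bf" "\<And>a. enc (f a) \<le> Bf a"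
    "computes pf Bf f"
    by (rule pspace_E[OF assms(1)]) (rule that)
  obtain Bg pg where g: "poly_length Bg" "\<And>a. enc (g a) \<le> Bg a"
    "computes pg Bg g"
    by (rule pspace_E[OF assms(2)]) (rule that)
  show ?thesis
  proof (rule pspace_I[where p = "\<lambda>r w. Seq (pf r w) (Seq (pg w (w + 1)) (Seq (clear w)
    (move_add (w + 1) w)))"])
    show "poly_length (\<lambda>a. Bf a + Bg (f a))"
      by (intro poly_length_add f(1) poly_length_comp[OF g(1)] pspace_length_bound assms)
  next
    fix r w :: nat and a :: 'a and e
    assume *: "r < w" "e r = enc a" "\<And>i. i \<ge> w \<Longrightarrow> e i = (0::nat)"
    show "exec (Bf a + Bg (f a)) (Seq (pf r w) (Seq (pg w (w + 1)) (Seq (clear w) (move_add (w +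
      1) w))))
        e (e(w := enc (g (f a))))"
      by (rule exec_Seq[OF computesD[OF f(3)] exec_Seq[OF computesD[OF g(3), where a =
        "f a"] exec_Seq[OF exec_clear exec_eq[OF exec_move_add]]]])
        (use * g(2)[of "f a"] in \<open>auto simp: fun_eq_iff\<close>)
  qed
qed

lemma pspace_Pair:
  fixes f :: "'a::code \<Rightarrow> 'b::code" and g :: "'a \<Rightarrow> 'c::code"
  assumes "pspace f" "pspace g"
  shows "pspace (\<lambda>a. (f a, g a))"
proof -
  obtain Bf pf where f: "poly_length Bf" "\<And>a. enc (f a) \<le> Bf a"
    "computes pf Bf f"
    by (rule pspace_E[OF assms(1)]) (rule that)
  obtain Bg pg where g: "poly_length Bg" "\<And>a. enc (g a) \<le> Bg a"
    "computes pg Bg g"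
    by (rule pspace_E[OF assms(2)]) (rule that)
  let ?p = "\<lambda>r w. Seq (pf r w) (Seq (pg r (w + 1)) (Seq (pairing w (w + 1) (w + 2))
    (Seq (clear w) (Seq (clear (w + 1)) (move_add (w + 2) w)))))"
  let ?B = "\<lambda>a. Bf a + Bg a + enc (f a, g a)"
  show ?thesis
  proof (rule pspace_I[where p = ?p])
    show "poly_length ?B" unfolding enc_prod_def fst_conv snd_conv
      by (intro poly_length_add f(1) g(1) poly_length_pair pspace_length_bound assms)
  next
    fix r w :: nat and a :: 'a and e
    assume *: "r < w" "e r = enc a" "\<And>i. i \<ge> w \<Longrightarrow> e i = (0::nat)"
    show "exec (?B a) (?p r w) e (e(w := enc (f a, g a)))"
      by (rule exec_Seq[OF computesD[OF f(3)] exec_Seq[OF computesD[OF g(3), where a =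
        a] exec_Seq[OF exec_pairing
              exec_Seq[OF exec_clear exec_Seq[OF exec_clear exec_eq[OF exec_move_add]]]]]])
        (use * in \<open>auto simp: fun_eq_iff enc_prod_def\<close>)
  qed
qed

lemma pspace_If:
  fixes f :: "'a::code \<Rightarrow> 'b::code"
  assumes "pspace c" "pspace f" "pspace g"
  shows "pspace (\<lambda>a. if c a then f a else g a)"
proof -
  obtain Bc pc where c: "poly_length Bc" "\<And>a. enc (c a) \<le> Bc a"
    "computes pc Bc c"
    by (rule pspace_E[OF assms(1)]) (rule that)
  obtain Bf pf where f: "poly_length Bf" "\<And>a. enc (f a) \<le> Bf a"
    "computes pf Bf f"
    by (rule pspace_E[OF assms(2)]) (rule that)
  obtain Bg pg where g: "poly_length Bg" "\<And>a. enc (g a) \<le> Bg a"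
    "computes pg Bg g"
    by (rule pspace_E[OF assms(3)]) (rule that)
  let ?p = "\<lambda>r w. Seq (pc r w) (IfNZ w (Seq (clear w) (pf r w)) (pg r w))"
  let ?B = "\<lambda>a. Bc a + Bf a + Bg a"
  show ?thesis
  proof (rule pspace_I[where p = ?p])
    show "poly_length ?B" by (intro poly_length_add c(1) f(1) g(1))
  next
    fix r w :: nat and a :: 'a and e
    assume *: "r < w" "e r = enc a" "\<And>i. i \<ge> w \<Longrightarrow> e i = (0::nat)"
    have 1: "exec (?B a) (pc r w) e (e(w := enc (c a)))"
      using * by (intro computesD[OF c(3)]) auto
    have 2: "exec (?B a) (IfNZ w (Seq (clear w) (pf r w)) (pg r w)) (e(w := enc (c a)))
        (e(w := enc (if c a then f a else g a)))"
    proof (cases "c a")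
      case True
      have "exec (?B a) (Seq (clear w) (pf r w)) (e(w := enc (c a))) (e(w := enc (f a)))"
        by (rule exec_Seq[OF exec_clear exec_eq[OF computesD[OF f(3)]]]) (use * in auto)
      then show ?thesis using True by (intro exec_If) (simp add: enc_bool_def)
    next
      case False
      have "exec (?B a) (pg r w) (e(w := enc (c a))) (e(w := enc (g a)))"
        using False * by (intro exec_eq[OF computesD[OF g(3)]]) (auto simp: enc_bool_def)
      then show ?thesis using False by (intro exec_If) (simp add: enc_bool_def)
    qed
    show "exec (?B a) (?p r w) e (e(w := enc (if c a then f a else g a)))"
      by (rule exec_Seq[OF 1 2])
  qed
qed

text \<open>
  The source of all computing power. The number \<open>n c\<close> of iterations need not be
  small, only the iterates have to be, since a loop uses no more space than its longest pass.
\<close>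

lemma pspace_iter:
  fixes x :: "'a::code \<Rightarrow> 'b::code" and s :: "'a \<Rightarrow> 'b \<Rightarrow> 'b"
  assumes n: "pspace n" and x: "pspace x" and s: "pspace (\<lambda>z. s (fst z) (snd z))"
    and G: "poly_length G" "\<And>c i. i \<le> n c \<Longrightarrow>
      enc ((s c ^^ i) (x c)) \<le> G c"
  shows "pspace (\<lambda>c. (s c ^^ n c) (x c))"
proof -
  obtain Bn pn where n: "poly_length Bn" "\<And>a. enc (n a) \<le> Bn a"
    "computes pn Bn n"
    by (rule pspace_E[OF n]) (rule that)
  obtain Bx px where x: "poly_length Bx" "\<And>a. enc (x a) \<le> Bx a"
    "computes px Bx x"
    by (rule pspace_E[OF x]) (rule that)
  obtain Bs qs where s: "poly_length Bs" "\<And>z. enc (s (fst z) (snd z)) \<le> Bs z"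
    "computes qs Bs (\<lambda>z. s (fst z) (snd z))"
    by (rule pspace_E[OF s]) (rule that)
  obtain B' where B': "poly_length B'" "\<And>c y. enc y \<le> G c \<Longrightarrow>
    Bs (c, y) \<le> B' c"
    by (rule poly_length_uniform[OF s(1) G(1)]) (rule that)
  let ?q = "\<lambda>r w. Seq (Dec w) (Seq (pairing r (w + 1) (w + 2)) (Seq (qs (w + 2) (w + 3))
    (Seq (clear (w + 1)) (Seq (clear (w + 2)) (move_add (w + 3) (w + 1))))))"
  let ?p = "\<lambda>r w. Seq (pn r w) (Seq (px r (w + 1)) (Seq (WhileNZ w (?q r w)) (move_add (w
    + 1) w)))"
  let ?B = "\<lambda>c. Bn c + Bx c + B' c + G c + (enc c + G c + 1) ^ 2"
  show ?thesis
  proof (rule pspace_I[where p = ?p])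
    show "poly_length ?B"
      by (intro poly_length_add n(1) x(1) B'(1) G(1) poly_length_power poly_value_const
        poly_length_enc poly_length_const)
  next
    fix r w :: nat and c :: 'a and e
    assume *: "r < w" "e r = enc c" "\<And>i. i \<ge> w \<Longrightarrow> e i = (0::nat)"
    let ?E = "\<lambda>k. e(w := n c - k, w + 1 := enc ((s c ^^ k) (x c)))"
    have 1: "exec (?B c) (pn r w) e (e(w := n c))"
      using * by (intro exec_eq[OF computesD[OF n(3)]]) auto
    have 2: "exec (?B c) (px r (w + 1)) (e(w := n c)) (?E 0)"
      using * by (intro exec_eq[OF computesD[OF x(3)]]) auto
    have 3: "exec (?B c) (WhileNZ w (?q r w)) (?E 0) (?E (n c))"
    proof (rule exec_While_iter)
      fix k assume k: "k < n c"
      let ?y = "(s c ^^ k) (x c)"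
      have y: "enc ?y \<le> G c" "enc (s c ?y) \<le> G c"
        using G(2)[of k c] G(2)[of "Suc k" c] k by auto
      have p: "prod_encode (enc c, enc ?y) \<le> (enc c + G c + 1) ^ 2"
        using y by (intro prod_encode_le) auto
      have "exec (?B c) (?q r w) (?E k) (?E (Suc k))"
        by (rule exec_Seq[OF exec_Dec exec_Seq[OF exec_pairing exec_Seq[OF computesD[OF s(3),
          where a = "(c, ?y)"]
                exec_Seq[OF exec_clear exec_Seq[OF exec_clear exec_eq[OF exec_move_add]]]]]])
          (use * y B'(2)[of ?y c] p in \<open>auto simp: fun_eq_iff enc_prod_def\<close>)
      then show "?E k w \<noteq> 0 \<and> exec (?B c) (?q r w) (?E k) (?E (Suc k))"
        using k by simp
    qed simp
    have 4: "exec (?B c) (move_add (w + 1) w) (?E (n c)) (e(w := enc ((s c ^^ n c) (x c))))"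
      using * G(2)[of "n c" c] by (intro exec_eq[OF exec_move_add]) (auto simp: fun_eq_iff)
    show "exec (?B c) (?p r w) e (e(w := enc ((s c ^^ n c) (x c))))"
      by (rule exec_Seq[OF 1 exec_Seq[OF 2 exec_Seq[OF 3 4]]])
  qed
qed

section \<open>Arithmetic and bounded search\<close>

named_theorems pspace_intros

lemma pspace_cong: "pspace f \<Longrightarrow> (\<And>a. g a = f a) \<Longrightarrow> pspace g"
  by (rule pspace_recode) auto

lemmas [pspace_intros] = pspace_id pspace_const pspace_Pair pspace_If pspace_length_bound

lemma pspace_fst [pspace_intros]: "pspace f \<Longrightarrow> pspace (\<lambda>c. fst (f c))"
  by (rule pspace_comp[OF _ pspace_fst0])

lemma pspace_snd [pspace_intros]: "pspace f \<Longrightarrow> pspace (\<lambda>c. snd (f c))"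
  by (rule pspace_comp[OF _ pspace_snd0])

lemma pspace_encode [pspace_intros]: "pspace f \<Longrightarrow> pspace (\<lambda>c. enc (f c))"
  by (rule pspace_comp[OF _ pspace_enc])

lemma pspace_Suc [pspace_intros]: "pspace f \<Longrightarrow> pspace (\<lambda>c. Suc (f c))"
  by (rule pspace_comp[OF _ pspace_Suc0])

lemma pspace_pred [pspace_intros]: "pspace f \<Longrightarrow> pspace (\<lambda>c. f c - 1 :: nat)"
  by (rule pspace_comp[OF _ pspace_pred0])

lemma pspace_let:
  assumes "pspace h" "pspace (\<lambda>z. g (fst z) (snd z))"
  shows "pspace (\<lambda>c. g c (h c))"
  using pspace_comp[OF pspace_Pair[OF pspace_id assms(1)] assms(2)] by simp

text \<open>
  Bodies of loops and of quantifiers are functions of one argument, the pair of the context and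
  the bound variable.
\<close>

lemma pspace_subst2:
  assumes "pspace (\<lambda>z. g (fst z) (snd z))" "pspace f" "pspace h"
  shows "pspace (\<lambda>c. g (f c) (h c))"
  using pspace_comp[OF pspace_Pair[OF assms(2,3)] assms(1)] by simp

lemma poly_length_nat: "pspace f \<Longrightarrow> poly_length (f :: _ \<Rightarrow> nat)"
  using pspace_length_bound[of f] by simp

lemma enc_bool_le: "enc (b :: bool) \<le> 1"
  by (simp add: enc_bool_def)

lemma pspace_plus [pspace_intros]:
  fixes f g :: "'a::code \<Rightarrow> nat"
  assumes "pspace f" "pspace g"
  shows "pspace (\<lambda>c. f c + g c)"
proof -
  have eq: "(Suc ^^ i) m = i + m" for i m by (induction i) auto
  have "pspace (\<lambda>c. (Suc ^^ f c) (g c))"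
  proof (rule pspace_iter[where G = "\<lambda>c. f c + g c"])
    show "poly_length (\<lambda>c. f c + g c)" by (intro poly_length_add poly_length_nat assms)
  qed (intro pspace_intros assms | simp add: eq)+
  then show ?thesis by (simp add: eq)
qed

lemma pspace_minus [pspace_intros]:
  fixes f g :: "'a::code \<Rightarrow> nat"
  assumes "pspace f" "pspace g"
  shows "pspace (\<lambda>c. f c - g c)"
proof -
  have eq: "((\<lambda>y. y - 1) ^^ i) m = m - i" for i m :: nat by (induction i) auto
  have "pspace (\<lambda>c. ((\<lambda>y. y - 1) ^^ g c) (f c))"
  proof (rule pspace_iter[where G = f])
    show "pspace (\<lambda>z::'a \<times> nat. snd z - 1)" by (intro pspace_intros)
  qed (use assms eq in \<open>auto intro: poly_length_nat simp del: One_nat_def\<close>)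
  then show ?thesis unfolding eq .
qed

lemma pspace_times [pspace_intros]:
  fixes f g :: "'a::code \<Rightarrow> nat"
  assumes "pspace f" "pspace g"
  shows "pspace (\<lambda>c. f c * g c)"
proof -
  have eq: "((\<lambda>y. y + m) ^^ i) 0 = i * m" for i m :: nat by (induction i) auto
  have "pspace (\<lambda>c. ((\<lambda>y. y + g c) ^^ f c) 0)"
  proof (rule pspace_iter[where G = "\<lambda>c. f c * g c"])
    show "pspace (\<lambda>z::'a \<times> nat. snd z + g (fst z))"
      by (intro pspace_intros pspace_comp[OF _ assms(2)])
    show "poly_length (\<lambda>c. f c * g c)" by (intro poly_length_mult poly_length_nat assms)
  qed (intro pspace_intros assms | simp add: eq)+
  then show ?thesis unfolding eq .
qed

lemma pspace_nonzero: "pspace f \<Longrightarrow> pspace (\<lambda>c. f c \<noteq> (0::nat))"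
proof -
  assume f: "pspace f"
  have eq: "((\<lambda>_. True) ^^ i) False \<longleftrightarrow> i \<noteq> 0" for i :: nat
    by (cases i) auto
  have "pspace (\<lambda>c. ((\<lambda>_. True) ^^ f c) False)"
    by (rule pspace_iter[where G = "\<lambda>_. 1"]) (use f enc_bool_le in \<open>auto intro!:
      poly_length_const pspace_intros\<close>)
  then show ?thesis unfolding eq .
qed

lemma pspace_not [pspace_intros]: "pspace b \<Longrightarrow> pspace (\<lambda>c. \<not> b c)"
  by (rule pspace_cong[OF pspace_If[OF _ pspace_const[of False] pspace_const[of True]]]) auto

lemma pspace_conj [pspace_intros]: "pspace b \<Longrightarrow> pspace b' \<Longrightarrow>
  pspace (\<lambda>c. b c \<and> b' c)"
  by (rule pspace_cong[OF pspace_If[where c = b and f = b', OF _ _ pspace_const[of False]]]) auto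

lemma pspace_disj [pspace_intros]: "pspace b \<Longrightarrow> pspace b' \<Longrightarrow>
  pspace (\<lambda>c. b c \<or> b' c)"
  by (rule pspace_cong[OF pspace_If[where c = b and g = b', OF _ pspace_const[of True]]]) auto

lemma pspace_imp [pspace_intros]: "pspace b \<Longrightarrow> pspace b' \<Longrightarrow>
  pspace (\<lambda>c. b c \<longrightarrow> b' c)"
  unfolding imp_conv_disj by (intro pspace_disj pspace_not)

lemma pspace_less [pspace_intros]: "pspace f \<Longrightarrow> pspace g \<Longrightarrow>
  pspace (\<lambda>c. f c < (g c :: nat))"
  by (rule pspace_cong[OF pspace_nonzero[OF pspace_minus[of g f]]]) auto

lemma pspace_le [pspace_intros]: "pspace f \<Longrightarrow> pspace g \<Longrightarrow>
  pspace (\<lambda>c. f c \<le> (g c :: nat))"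
  by (rule pspace_cong[OF pspace_not[OF pspace_less[of g f]]]) auto

lemma pspace_eq [pspace_intros]:
  assumes "pspace f" "pspace g"
  shows "pspace (\<lambda>c. f c = g c)"
proof -
  have "pspace (\<lambda>c. enc (f c) \<le> enc (g c) \<and> enc (g c) \<le> enc (f c))"
    by (intro pspace_intros assms)
  then show ?thesis by (simp add: enc_eq_iff flip: eq_iff)
qed

text \<open>
  Iteration of a step that counts its passes.
\<close>

lemma pspace_rec:
  fixes x :: "'a::code \<Rightarrow> 'b::code" and s :: "'a \<Rightarrow> nat \<Rightarrow> 'b
    \<Rightarrow> 'b"
  assumes n: "pspace n" and x: "pspace x" and s: "pspace (\<lambda>z. s (fst z) (fst (snd z)) (snd
    (snd z)))"
    and G: "poly_length G" "\<And>c i. i \<le> n c \<Longrightarrow>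
      enc (rec_nat (x c) (s c) i) \<le> G c"
  shows "pspace (\<lambda>c. rec_nat (x c) (s c) (n c))"
proof -
  let ?s = "\<lambda>c z. (Suc (fst z), s c (fst z) (snd z))"
  have eq: "(?s c ^^ i) (0, x c) = (i, rec_nat (x c) (s c) i)" for c i
    by (induction i) auto
  have "pspace (\<lambda>c. (?s c ^^ n c) (0, x c))"
  proof (rule pspace_iter[where G = "\<lambda>c. (n c + G c + 1) ^ 2"])
    show "pspace (\<lambda>z. ?s (fst z) (snd z))" by (intro pspace_intros s)
    show "poly_length (\<lambda>c. (n c + G c + 1)\<^sup>2)"
      by (intro poly_length_power poly_length_add poly_length_const poly_value_const
        poly_length_nat n G)
    show "enc ((?s c ^^ i) (0, x c)) \<le> (n c + G c + 1)\<^sup>2" if "i \<le> n c" for c i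
      using prod_encode_le[OF that G(2)[OF that]]
        by (simp only: eq enc_prod_def fst_conv snd_conv enc_nat_def)
  qed (intro pspace_intros n x)+
  from pspace_snd[OF this] show ?thesis by (simp add: eq)
qed

text \<open>
  Quantifiers that range over exponentially many numbers cost no more than their body.
\<close>

lemma pspace_ex [pspace_intros]:
  fixes P :: "'a::code \<Rightarrow> nat \<Rightarrow> bool"
  assumes "pspace n" "pspace (\<lambda>z. P (fst z) (snd z))"
  shows "pspace (\<lambda>c. \<exists>i<n c. P c i)"
proof -
  have eq: "rec_nat False (\<lambda>i b. b \<or> P c i) k \<longleftrightarrow>
    (\<exists>i<k. P c i)" for c and k :: nat
    by (induction k) (auto simp: less_Suc_eq)
  have "pspace (\<lambda>c. rec_nat False (\<lambda>i b. b \<or> P c i) (n c))"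
  proof (rule pspace_rec[where G = "\<lambda>_. 1"])
    show "pspace (\<lambda>z. snd (snd z) \<or> P (fst z) (fst (snd z)))"
      by (intro pspace_intros pspace_subst2[OF assms(2)])
  qed (use assms enc_bool_le in \<open>auto intro: pspace_const poly_length_const\<close>)
  then show ?thesis by (simp add: eq)
qed

lemma pspace_all [pspace_intros]:
  fixes P :: "'a::code \<Rightarrow> nat \<Rightarrow> bool"
  assumes "pspace n" "pspace (\<lambda>z. P (fst z) (snd z))"
  shows "pspace (\<lambda>c. \<forall>i<n c. P c i)"
  using pspace_not[OF pspace_ex[OF assms(1) pspace_not[OF assms(2)]]] by simp

text \<open>
  The least number below \<open>n\<close> with the property \<open>P\<close>, or \<open>n\<close>
  if there is none: the value \<open>i\<close> after \<open>i\<close> passes means that nothing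
  has been found so far.
\<close>

definition least_below :: "nat \<Rightarrow> (nat \<Rightarrow> bool) \<Rightarrow> nat" where
  "least_below n P = rec_nat 0 (\<lambda>i r. if r < i then r else if P i then i else Suc i) n"

lemma least_below_le: "least_below n P \<le> n"
  by (induction n) (auto simp: least_below_def)

lemma least_below_Suc:
  "least_below (Suc k) P = (if least_below k P < k then least_below k P else
    if P k then k else Suc k)"
  by (simp add: least_below_def)

lemma least_below_eq:
  assumes "P i" "i \<le> n" "\<And>j. j < i \<Longrightarrow> \<not> P j"
  shows "least_below n P = i"
proof -
  have "least_below k P = (if k \<le> i then k else i)" for k
  proof (induction k)
    case (Suc k)
    consider "k < i" | "k = i" | "k > i" by linarith
    then show ?case by cases (use Suc assms in \<open>auto simp: least_below_Suc\<close>)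
  qed (simp add: least_below_def)
  then show ?thesis using assms(2) by auto
qed

lemma least_below_unique: "P i \<Longrightarrow> i \<le> n \<Longrightarrow>
  (\<And>j. P j \<Longrightarrow> j = i) \<Longrightarrow> least_below n P = i"
  by (metis least_below_eq less_irrefl)

lemma pspace_least_below [pspace_intros]:
  assumes "pspace n" "pspace (\<lambda>z. P (fst z) (snd z))"
  shows "pspace (\<lambda>c. least_below (n c) (P c))"
  unfolding least_below_def
proof (rule pspace_rec[where G = n])
  show "pspace (\<lambda>z. if snd (snd z) < fst (snd z) then snd (snd z)
      else if P (fst z) (fst (snd z)) then fst (snd z) else Suc (fst (snd z)))"
    by (intro pspace_intros pspace_subst2[OF assms(2)])
  show "enc (rec_nat 0 (\<lambda>i r. if r < i then r else if P c i then i else Suc i) i) \<le> n c"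
    if "i \<le> n c" for c i
    using least_below_le[of i "P c"] that by (simp add: least_below_def)
qed (use assms in \<open>auto intro: pspace_const poly_length_nat\<close>)

lemma pspace_div [pspace_intros]:
  fixes f g :: "'a::code \<Rightarrow> nat"
  assumes "pspace f" "pspace g"
  shows "pspace (\<lambda>c. f c div g c)"
proof -
  have eq: "x div y = (if y = 0 then 0 else least_below x (\<lambda>q. x < Suc q * y))"
    for x y :: nat
  proof (cases "y = 0")
    case False
    have iff: "x < Suc q * y \<longleftrightarrow> x div y \<le> q" for q
      using False by (metis div_less_iff_less_mult le_simps(2) less_Suc_eq_le neq0_conv)
    have "least_below x (\<lambda>q. x < Suc q * y) = x div y"
      unfolding iff by (rule least_below_eq) (auto simp: le_neq_implies_less)
    then show ?thesis using False by simp
  qed simp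
  have "pspace (\<lambda>c. if g c = 0 then 0 else least_below (f c) (\<lambda>q. f c < Suc q * g
    c))"
    by (intro pspace_intros assms pspace_comp[OF _ assms(1)] pspace_comp[OF _ assms(2)])
  then show ?thesis unfolding eq .
qed

lemma pspace_mod [pspace_intros]:
  fixes f g :: "'a::code \<Rightarrow> nat"
  assumes "pspace f" "pspace g"
  shows "pspace (\<lambda>c. f c mod g c)"
proof -
  have "pspace (\<lambda>c. f c - g c * (f c div g c))" by (intro pspace_intros assms)
  then show ?thesis by (simp add: minus_mult_div_eq_mod)
qed

lemma pspace_dvd [pspace_intros]:
  fixes f g :: "'a::code \<Rightarrow> nat"
  assumes "pspace f" "pspace g"
  shows "pspace (\<lambda>c. f c dvd g c)"
  unfolding dvd_eq_mod_eq_0 by (intro pspace_intros assms)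

text \<open>
  Euclid's algorithm. The second component decreases until it vanishes, so its initial value is a
  sufficient number of passes.
\<close>

lemma pspace_gcd [pspace_intros]:
  fixes f g :: "'a::code \<Rightarrow> nat"
  assumes "pspace f" "pspace g"
  shows "pspace (\<lambda>c. gcd (f c) (g c))"
proof -
  let ?s = "\<lambda>z. if snd z = 0 then z else (snd z, fst z mod snd z) :: nat \<times> nat"
  have inv: "gcd (fst ((?s ^^ i) (x, y))) (snd ((?s ^^ i) (x, y))) = gcd x y \<and>
      snd ((?s ^^ i) (x, y)) \<le> y - i \<and> fst ((?s ^^ i) (x, y)) \<le> x + y" for i x y
  proof (induction i)
    case (Suc i)
    obtain u v where uv: "(?s ^^ i) (x, y) = (u, v)" by fastforce
    show ?case
    proof (cases "v = 0")
      case False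
      then have "u mod v < v" by simp
      moreover have "v \<le> y - i" using Suc uv by simp
      ultimately have "u mod v \<le> y - Suc i" "v \<le> x + y" by linarith+
      moreover have "gcd v (u mod v) = gcd u v" by (rule gcd_red_nat[symmetric])
      ultimately show ?thesis using Suc uv False by simp
    qed (use Suc uv in auto)
  qed simp
  have eq: "fst ((?s ^^ y) (x, y)) = gcd x y" for x y
  proof -
    obtain u v where uv: "(?s ^^ y) (x, y) = (u, v)" by fastforce
    have "gcd u v = gcd x y \<and> v \<le> y - y"
      using inv[of y x y] unfolding uv fst_conv snd_conv by blast
    then have "gcd u 0 = gcd x y" by auto
    then show ?thesis using uv by simp
  qed
  have "pspace (\<lambda>c. (?s ^^ g c) (f c, g c))"
  proof (rule pspace_iter[where G = "\<lambda>c. (f c + g c + g c + 1) ^ 2"])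
    show "pspace (\<lambda>z::'a \<times> nat \<times> nat. ?s (snd z))" by (intro pspace_intros)
    show "poly_length (\<lambda>c. (f c + g c + g c + 1)\<^sup>2)"
      by (intro poly_length_power poly_length_add poly_length_const poly_value_const
        poly_length_nat assms)
    show "enc ((?s ^^ i) (f c, g c)) \<le> (f c + g c + g c + 1)\<^sup>2" for c i
      unfolding enc_prod_def enc_nat_def
      using inv[of i "f c" "g c"] by (intro prod_encode_le) auto
  qed (intro pspace_intros assms)+
  from pspace_fst[OF this] show ?thesis by (simp add: eq)
qed

lemma pspace_lcm [pspace_intros]:
  fixes f g :: "'a::code \<Rightarrow> nat"
  assumes "pspace f" "pspace g"
  shows "pspace (\<lambda>c. lcm (f c) (g c))"
  unfolding lcm_nat_def by (intro pspace_intros assms)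

text \<open>
  The length of a power is proportional to its exponent, whence the condition on the value of
  \<open>m\<close>.
\<close>

lemma pspace_power:
  fixes f g :: "'a::code \<Rightarrow> nat"
  assumes "pspace f" "pspace m" "poly_value m"
  shows "pspace (\<lambda>c. f c ^ m c)"
proof -
  have eq: "((\<lambda>y. y * x) ^^ i) 1 = x ^ i" for x i :: nat by (induction i) auto
  have "pspace (\<lambda>c. ((\<lambda>y. y * f c) ^^ m c) 1)"
  proof (rule pspace_iter[where G = "\<lambda>c. (f c + 1) ^ m c"])
    show "poly_length (\<lambda>c. (f c + 1) ^ m c)"
      by (intro poly_length_power poly_length_add poly_length_nat poly_length_const assms)
    show "enc (((\<lambda>y. y * f c) ^^ i) 1) \<le> (f c + 1) ^ m c" if "i \<le> m c" for c i
    proof -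
      have "f c ^ i \<le> (f c + 1) ^ i" by (rule power_mono) auto
      also have "\<dots> \<le> (f c + 1) ^ m c" using that by (rule power_increasing) simp
      finally show ?thesis unfolding eq by simp
    qed
    show "pspace (\<lambda>z::'a \<times> nat. snd z * f (fst z))"
      by (intro pspace_intros pspace_comp[OF _ assms(1)])
  qed (intro pspace_intros assms)+
  then show ?thesis unfolding eq .
qed

section \<open>Options\<close>

instantiation option :: (code) code
begin
definition enc_option :: "'a option \<Rightarrow> nat" where
  "enc_option x = (case x of None \<Rightarrow> 0 | Some y \<Rightarrow> Suc (enc y))"
instance by standard (auto simp: enc_option_def enc_eq_iff split: option.splits)
end

lemma pspace_Some [pspace_intros]:
  assumes "pspace f"
  shows "pspace (\<lambda>c. Some (f c))"
  by (rule pspace_recode[of "\<lambda>c. Suc (enc (f c))"]) (auto intro!: pspace_intros assms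
    simp: enc_option_def)

text \<open>
  The unspecified value of \<open>the None\<close> is harmless: it is one constant.
\<close>

lemma pspace_the [pspace_intros]:
  fixes f :: "'a::code \<Rightarrow> 'b::code option"
  assumes "pspace f"
  shows "pspace (\<lambda>c. the (f c))"
proof (rule pspace_recode)
  show "pspace (\<lambda>c. if enc (f c) = 0 then enc (the (None :: 'b option)) else enc (f c) - 1)"
    by (intro pspace_intros assms)
qed (auto simp: enc_option_def split: option.split)

lemma pspace_case_option [pspace_intros]:
  assumes "pspace x" "pspace f" "pspace (\<lambda>z. g (fst z) (snd z))"
  shows "pspace (\<lambda>c. case x c of None \<Rightarrow> f c | Some y \<Rightarrow> g c y)"
proof -
  have "pspace (\<lambda>c. if x c = None then f c else g c (the (x c)))"
    by (intro pspace_intros assms pspace_let[where g = g])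
  then show ?thesis by (rule pspace_recode) (auto split: option.split)
qed

section \<open>Integers\<close>

definition mkint :: "bool \<Rightarrow> nat \<Rightarrow> int" where
  "mkint b m = (if b then - int m else int m)"

instantiation int :: code
begin
definition enc_int :: "int \<Rightarrow> nat" where "enc_int z = enc (z < 0, nat \<bar>z\<bar>)"
instance by standard (auto simp: enc_int_def enc_eq_iff)
end

lemma pspace_negative [pspace_intros]: "pspace f \<Longrightarrow>
  pspace (\<lambda>c. f c < (0 :: int))"
  by (rule pspace_comp[OF _ pspace_recode[OF pspace_comp[OF pspace_recode[OF pspace_id, where g =
    "\<lambda>z::int. (z < 0, nat \<bar>z\<bar>)"] pspace_fst0]]])
    (simp_all add: enc_int_def)

lemma pspace_nat_abs [pspace_intros]: "pspace f \<Longrightarrow>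
  pspace (\<lambda>c. nat \<bar>f c\<bar>)"
  by (rule pspace_comp[OF _ pspace_recode[OF pspace_comp[OF pspace_recode[OF pspace_id, where g =
    "\<lambda>z::int. (z < 0, nat \<bar>z\<bar>)"] pspace_snd0]]])
    (simp_all add: enc_int_def)

lemma pspace_mkint [pspace_intros]: "pspace b \<Longrightarrow> pspace m \<Longrightarrow>
  pspace (\<lambda>c. mkint (b c) (m c))"
  by (rule pspace_recode[of "\<lambda>c. (b c \<and> m c \<noteq> 0,
    m c)"]) (auto intro!: pspace_intros simp: enc_int_def mkint_def enc_eq_iff)

lemma pspace_int [pspace_intros]: "pspace m \<Longrightarrow> pspace (\<lambda>c. int (m c))"
  using pspace_mkint[OF pspace_const[of False]] by (simp add: mkint_def)

lemma pspace_int_times [pspace_intros]: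
  fixes f g :: "'a::code \<Rightarrow> int"
  assumes "pspace f" "pspace g"
  shows "pspace (\<lambda>c. f c * g c)"
proof -
  have eq: "x * y = mkint ((x < 0) \<noteq> (y < 0)) (nat \<bar>x\<bar> * nat \<bar>y\<bar>)"
    for x y :: int
    by (auto simp: mkint_def)
  show ?thesis unfolding eq by (intro pspace_intros assms)
qed

text \<open>
  For operands of opposite signs the quotient, being rounded down, has the absolute value of the
  quotient rounded up.
\<close>

lemma pspace_int_div [pspace_intros]:
  fixes f g :: "'a::code \<Rightarrow> int"
  assumes "pspace f" "pspace g"
  shows "pspace (\<lambda>c. f c div g c)"
proof -
  have neg: "(- x) div y = - ((x + y - 1) div y)" if "y > 0" for x y :: int
  proof (rule int_div_pos_eq)
    have "x + y - 1 = y * ((x + y - 1) div y) + (x + y - 1) mod y" by simp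
    then show "- x = y * - ((x + y - 1) div y) + (y - 1 - (x + y - 1) mod y)" by linarith
  qed (use that pos_mod_bound[of y "x + y - 1"] pos_mod_sign[of y "x + y - 1"] in linarith)+
  have eq: "x div y = (if y = 0 then 0 else if (x < 0) =
    (y < 0) then int (nat \<bar>x\<bar> div nat \<bar>y\<bar>)
      else mkint True ((nat \<bar>x\<bar> + nat \<bar>y\<bar> - 1) div nat \<bar>y\<bar>))"
        for x y :: int
  proof (cases "y = 0")
    case False
    have *: "int ((nat \<bar>x\<bar> + nat \<bar>y\<bar> - 1) div nat \<bar>y\<bar>) =
      (\<bar>x\<bar> + \<bar>y\<bar> - 1) div \<bar>y\<bar>"
      using False by (simp add: zdiv_int of_nat_diff)
    show ?thesis
    proof (cases "y < 0")
      case True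
      show ?thesis
      proof (cases "x < 0")
        case False
        have "x div y = (- x) div (- y)" by simp
        also have "\<dots> = - ((x + - y - 1) div (- y))" using True by (intro neg) simp
        finally show ?thesis using True False * by (simp add: mkint_def)
      qed (use True in \<open>simp add: zdiv_int\<close>)
    next
      case y: False
      show ?thesis
      proof (cases "x < 0")
        case True
        have "x div y = (- (- x)) div y" by simp
        also have "\<dots> = - ((- x + y - 1) div y)" using y \<open>y \<noteq> 0\<close>
          by (intro neg) simp
        finally show ?thesis using True y * \<open>y \<noteq> 0\<close> by (simp add: mkint_def)
      qed (use y in \<open>simp add: zdiv_int\<close>)
    qed
  qed simp
  show ?thesis unfolding eq by (intro pspace_intros assms)
qed

lemma pspace_int_gcd [pspace_intros]:
  fixes f g :: "'a::code \<Rightarrow> int"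
  assumes "pspace f" "pspace g"
  shows "pspace (\<lambda>c. gcd (f c) (g c))"
  unfolding gcd_int_def by (intro pspace_intros assms)

lemma pspace_int_lcm [pspace_intros]:
  fixes f g :: "'a::code \<Rightarrow> int"
  assumes "pspace f" "pspace g"
  shows "pspace (\<lambda>c. lcm (f c) (g c))"
  unfolding lcm_int_def by (intro pspace_intros assms)

lemma pspace_int_abs [pspace_intros]: "pspace f \<Longrightarrow>
  pspace (\<lambda>c. \<bar>f c :: int\<bar>)"
  using pspace_int[OF pspace_nat_abs[of f]] by simp

lemma pspace_int_dvd [pspace_intros]:
  fixes f g :: "'a::code \<Rightarrow> int"
  assumes "pspace f" "pspace g"
  shows "pspace (\<lambda>c. f c dvd g c)"
proof -
  have "x dvd y \<longleftrightarrow> nat \<bar>x\<bar> dvd nat \<bar>y\<bar>" for x y :: int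
    by simp
  then show ?thesis using pspace_dvd[OF pspace_nat_abs[OF assms(1)] pspace_nat_abs[OF assms(2)]]
    by simp
qed

lemma enc_int_le: "enc z \<le> (nat \<bar>z\<bar> + 2) ^ 2"
proof -
  have "enc z \<le> (1 + nat \<bar>z\<bar> + 1) ^ 2"
    unfolding enc_int_def enc_prod_def using enc_bool_le by (intro prod_encode_le) auto
  then show ?thesis by (simp add: add.commute)
qed

text \<open>
  The length of a product is at most the sum of the lengths of its factors, so the number of
  factors has to be polynomial.
\<close>

lemma pspace_int_prod:
  fixes f :: "'a::code \<Rightarrow> nat \<Rightarrow> int"
  assumes "pspace (\<lambda>z. f (fst z) (snd z))" "pspace m" "poly_value m"
  shows "pspace (\<lambda>c. \<Prod>i<m c. f c i)"
proof -
  have eq: "rec_nat 1 (\<lambda>i y. y * f c i) k = (\<Prod>i<k. f c i)" for c k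
    by (induction k) auto
  obtain B where B: "poly_length B" "\<And>c i. enc i \<le> m c \<Longrightarrow>
    nat \<bar>f c i\<bar> \<le> B c"
    using poly_length_uniform[OF poly_length_nat[OF pspace_nat_abs[OF assms(1)]]
      poly_length_nat[OF assms(2)]]
    by (metis fst_conv snd_conv)
  have "pspace (\<lambda>c. rec_nat 1 (\<lambda>i y. y * f c i) (m c))"
  proof (rule pspace_rec[where G = "\<lambda>c. ((B c + 1) ^ m c + 2) ^ 2"])
    show "pspace (\<lambda>z. snd (snd z) * f (fst z) (fst (snd z)))"
      by (intro pspace_intros pspace_subst2[OF assms(1)])
    show "poly_length (\<lambda>c. ((B c + 1) ^ m c + 2) ^ 2)"
      by (intro poly_length_power poly_length_add poly_length_const poly_value_const B assms)
    show "enc (rec_nat 1 (\<lambda>i y. y * f c i) i) \<le> ((B c + 1) ^ m c + 2) ^ 2"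
      if "i \<le> m c" for c i
    proof -
      have "nat \<bar>\<Prod>j<k. f c j\<bar> \<le> (B c + 1) ^ k" if "k \<le> m c" for k
        using that
      proof (induction k)
        case (Suc k)
        have "nat \<bar>f c k\<bar> \<le> B c + 1" using B(2)[of k c] Suc.prems by simp
        then have "nat \<bar>\<Prod>j<k. f c j\<bar> * nat \<bar>f c k\<bar> \<le>
          (B c + 1) ^ k * (B c + 1)"
          using Suc by (intro mult_mono) auto
        then show ?case by (simp add: abs_mult nat_mult_distrib mult.commute)
      qed simp
      from this[OF that] have "nat \<bar>\<Prod>j<i. f c j\<bar> \<le> (B c + 1) ^ m c"
        using power_increasing[OF that, of "B c + 1"] by simp
      then have "(nat \<bar>\<Prod>j<i. f c j\<bar> + 2) ^ 2 \<le> ((B c + 1) ^ m c + 2) ^ 2"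
        by (intro power_mono) auto
      then show ?thesis unfolding eq using enc_int_le le_trans by blast
    qed
  qed (intro pspace_intros assms)+
  then show ?thesis unfolding eq .
qed

section \<open>Lists\<close>

text \<open>
  Puts the binary digits of \<open>v\<close>, in the symbols of \<open>encode_nat\<close>, in
  front of the word with the number \<open>a\<close>, see
  \<open>digit_value_encode_nat_append\<close>.
\<close>

function push_nat :: "nat \<Rightarrow> nat \<Rightarrow> nat" where
  "push_nat v a = (if v < 2 then v + 1 + 5 * a else push_nat (v div 2) (v mod 2 + 1 + 5 * a))"
  by auto
termination by (relation "measure fst") auto

declare push_nat.simps [simp del]

lemma digit_value_encode_nat_append: "digit_value (encode_nat v @ s) = push_nat v (digit_value s)"
proof (induction v arbitrary: s rule: encode_nat.induct)
  case (1 v)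
  show ?case
  proof (cases "v < 2")
    case True
    then show ?thesis by (subst encode_nat.simps, subst push_nat.simps) simp
  next
    case False
    then show ?thesis
      using 1[OF False, of "(v mod 2 + 1) # s"]
      by (subst encode_nat.simps, subst push_nat.simps) simp
  qed
qed

lemma set_encode_nat: "set (encode_nat v) \<subseteq> {1, 2}"
proof (induction v rule: encode_nat.induct)
  case (1 v)
  have "v mod 2 + 1 \<in> {1, 2}" by (simp add: mod2_eq_if)
  with 1 show ?case by (subst encode_nat.simps) auto
qed

definition binval :: "nat \<Rightarrow> nat list \<Rightarrow> nat" where
  "binval a ds = foldl (\<lambda>a d. 2 * a + (d - 1)) a ds"

lemma binval_encode_nat: "binval 0 (encode_nat v) = v"
proof (induction v rule: encode_nat.induct)
  case (1 v)
  then show ?case by (subst encode_nat.simps) (auto simp: binval_def)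
qed

lemma encode_nat_inj: "encode_nat v = encode_nat w \<Longrightarrow> v = w"
  by (metis binval_encode_nat)

text \<open>
  The binary digits are the symbols 1 and 2, hence the first symbol 4 tells where they end.
\<close>

lemma push_nat_inj:
  assumes "push_nat v (4 + 5 * a) = push_nat w (4 + 5 * b)"
  shows "v = w \<and> a = b"
proof -
  let ?s = "\<lambda>v a. encode_nat v @ 4 # digits a"
  have s: "set (?s v a) \<subseteq> {1..5}" for v a
    using set_encode_nat[of v] set_digits[of a] by auto
  have "digit_value (?s v a) = digit_value (?s w b)"
    using assms by (simp add: digit_value_encode_nat_append)
  then have eq: "?s v a = ?s w b"
    using digits_digit_value[OF s] by metis
  have tw: "takeWhile (\<lambda>d. d \<noteq> 4) (?s v a) = encode_nat v" for v a
    using set_encode_nat[of v] by (subst takeWhile_append2) auto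
  from eq have "encode_nat v = encode_nat w" using tw by metis
  with eq have "v = w" "digits a = digits b" by (auto dest: encode_nat_inj)
  then show ?thesis by (metis digit_value_digits)
qed

text \<open>
  Every digit multiplies \<open>a\<close> by 5, and \<open>v\<close> has enough of them for the
  factor \<open>v + 1\<close>. Without this factor the induction hypothesis, which is about
  \<open>v div 2\<close>, would not give back \<open>v\<close>.
\<close>

lemma push_nat_ge: "v + (v + 1) * a \<le> push_nat v a"
proof (induction v a rule: push_nat.induct)
  case (1 v a)
  show ?case
  proof (cases "v < 2")
    case True
    then consider "v = 0" | "v = 1" by linarith
    then show ?thesis by cases (subst push_nat.simps, simp)+
  next
    case False
    define w r where "w = v div 2" and "r = v mod 2"
    have v: "v = 2 * w + r" by (simp add: w_def r_def)
    have "r < 2" by (simp add: r_def)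
    then have r: "r = 0 \<or> r = 1" by linarith
    have "v + (v + 1) * a \<le> w + (w + 1) * (r + 1 + 5 * a)"
      using r unfolding v by (auto simp: algebra_simps)
    also have "\<dots> \<le> push_nat w (r + 1 + 5 * a)"
      using 1[OF False] by (simp only: w_def r_def)
    also have "\<dots> = push_nat v a"
      using False by (subst (2) push_nat.simps) (simp add: w_def r_def)
    finally show ?thesis .
  qed
qed

lemma push_nat_le: "push_nat v a + 1 \<le> 8 ^ (bit_length v + 1) * (a + 1)"
proof (induction v a rule: push_nat.induct)
  case (1 v a)
  show ?case
  proof (cases "v < 2")
    case True
    have "v + 1 + 5 * a + 1 \<le> 8 * (a + 1)" using True by simp
    also have "\<dots> \<le> 8 ^ (bit_length v + 1) * (a + 1)"
      by (rule mult_right_mono) simp_all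
    finally show ?thesis using True by (subst push_nat.simps) simp
  next
    case False
    have "push_nat v a + 1 \<le> 8 ^ (bit_length (v div 2) + 1) * (v mod 2 + 1 + 5 * a + 1)"
      using 1[OF False] False by (subst push_nat.simps) simp
    also have "\<dots> \<le> 8 ^ (bit_length (v div 2) + 1) * (8 * (a + 1))"
      by (intro mult_left_mono) (auto simp: mod2_eq_if)
    also have "\<dots> = 8 ^ (bit_length v + 1) * (a + 1)"
      using False by (subst (2) bit_length.simps) (simp add: algebra_simps)
    finally show ?thesis .
  qed
qed

lemma pspace_push_nat [pspace_intros]:
  fixes f g :: "'a::code \<Rightarrow> nat"
  assumes "pspace f" "pspace g"
  shows "pspace (\<lambda>c. push_nat (f c) (g c))"
proof -
  let ?s = "\<lambda>z. if fst z < 2 then z else (fst z div 2, fst z mod 2 + 1 + 5 * snd z)"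
  have inv: "push_nat (fst ((?s ^^ i) (v, a))) (snd ((?s ^^ i) (v, a))) = push_nat v a \<and>
      fst ((?s ^^ i) (v, a)) \<le> v \<and> (fst ((?s ^^ i) (v, a)) < 2 \<or> fst ((?s ^^ i) (v,
        a)) \<le> v - i)" for i v a
  proof (induction i)
    case (Suc i)
    obtain u b where ub: "(?s ^^ i) (v, a) = (u, b)" by fastforce
    show ?case
    proof (cases "u < 2")
      case False
      then have "u div 2 \<le> v - Suc i" "u div 2 \<le> v" using Suc ub by auto
      moreover have "push_nat u b = push_nat (u div 2) (u mod 2 + 1 + 5 * b)"
        using False by (subst push_nat.simps) simp
      ultimately show ?thesis using Suc ub False by simp
    qed (use Suc ub in simp)
  qed simp
  have eq: "fst ((?s ^^ v) (v, a)) + 1 + 5 * snd ((?s ^^ v) (v, a)) = push_nat v a" for v a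
  proof -
    have "fst ((?s ^^ v) (v, a)) < 2" using inv[of v v a] by linarith
    then show ?thesis using inv[of v v a] by (simp add: push_nat.simps)
  qed
  let ?G = "\<lambda>c. (f c + 8 ^ (bit_length (f c) + 1) * (g c + 1) + 1) ^ 2"
  have pspace: "pspace (\<lambda>c. (?s ^^ f c) (f c, g c))"
  proof (rule pspace_iter[where G = ?G])
    show "pspace (\<lambda>z::'a \<times> nat \<times> nat. ?s (snd z))" by (intro pspace_intros)
    show "poly_length ?G"
      by (intro poly_length_power poly_length_add poly_length_mult poly_length_const
        poly_value_const poly_value_add poly_value_bit_length poly_length_nat assms)
    show "enc ((?s ^^ i) (f c, g c)) \<le> ?G c" for c i
    proof -
      obtain u b where ub: "(?s ^^ i) (f c, g c) = (u, b)" by fastforce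
      have "b \<le> push_nat u b" using push_nat_ge[of u b] by simp
      also have "\<dots> \<le> 8 ^ (bit_length (f c) + 1) * (g c + 1)"
        using inv[of i "f c" "g c"] ub push_nat_le[of "f c" "g c"] by simp
      finally show ?thesis
        using inv[of i "f c" "g c"] unfolding ub enc_prod_def by (intro prod_encode_le) auto
    qed
  qed (intro pspace_intros assms)+
  have "pspace (\<lambda>c. fst ((?s ^^ f c) (f c, g c)) + 1 + 5 * snd ((?s ^^ f c) (f c, g c)))"
    by (intro pspace_plus pspace_times pspace_fst pspace_snd pspace_const pspace)
  then show ?thesis by (simp only: eq)
qed

text \<open>
  The code of a path is the number of the word \<open>encode_path\<close>, see
  \<open>digit_value_encode_path\<close>; a counter that holds the code of a path therefore
  displays the path.
\<close>

instantiation list :: (code) code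
begin
definition enc_list :: "'a list \<Rightarrow> nat" where
  "enc_list xs = foldr (\<lambda>x a. push_nat (enc x) (4 + 5 * a)) xs 0"
instance
proof
  fix xs ys :: "'a list"
  have pos: "push_nat v (4 + 5 * a) \<noteq> 0" for v a
    using push_nat_ge[of v "4 + 5 * a"] by simp
  show "enc xs = enc ys \<Longrightarrow> xs = ys"
  proof (induction xs arbitrary: ys)
    case Nil
    then show ?case using pos by (cases ys) (auto simp: enc_list_def)
  next
    case (Cons x xs)
    show ?case
    proof (cases ys)
      case Nil
      then show ?thesis using Cons.prems pos by (auto simp: enc_list_def)
    next
      case ys: (Cons y ys')
      from Cons.prems have "enc x = enc y \<and> enc xs = enc ys'"
        unfolding ys by (intro push_nat_inj) (simp add: enc_list_def)
      then show ?thesis using Cons.IH ys by (simp add: enc_eq_iff)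
    qed
  qed
qed
end

lemma enc_Nil [simp]: "enc [] = 0"
  by (simp add: enc_list_def)

lemma enc_Cons [simp]: "enc (x # xs) = push_nat (enc x) (4 + 5 * enc xs)"
  by (simp add: enc_list_def)

lemma digit_value_encode_path: "digit_value (encode_path p) = enc p"
proof (induction p)
  case (Cons v p)
  have "digit_value ((encode_nat v @ [4]) @ encode_path p) =
    push_nat v (4 + 5 * digit_value (encode_path p))"
    by (simp add: digit_value_encode_nat_append)
  then show ?case using Cons by (simp add: encode_path_def)
qed (simp add: encode_path_def)

lemma enc_Cons_ge: "enc x \<le> enc (x # xs)" "2 * enc xs < enc (x # xs)"
  using push_nat_ge[of "enc x" "4 + 5 * enc xs"] by auto

lemma two_power_length_le: "2 ^ length xs \<le> enc xs + 1"
proof (induction xs)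
  case (Cons x xs)
  then show ?case using enc_Cons_ge(2)[where x = x and xs = xs] unfolding length_Cons power_Suc
    by linarith
qed simp

lemma length_le_code_size: "length xs \<le> code_size xs"
proof -
  have "2 ^ length xs \<le> enc xs + 1" by (rule two_power_length_le)
  also have "\<dots> \<le> 2 ^ bit_length (enc xs)" using less_two_power_bit_length[of "enc xs"]
    by simp
  finally show ?thesis by (simp add: code_size_def)
qed

lemma enc_drop_le: "enc (drop i xs) \<le> enc xs"
proof (induction xs arbitrary: i)
  case (Cons x xs)
  show ?case
  proof (cases i)
    case (Suc j)
    have "enc (drop j xs) \<le> enc (x # xs)"
      using Cons[of j] enc_Cons_ge(2)[where x = x and xs = xs] by linarith
    then show ?thesis using Suc by simp
  qed simp
qed simp

lemma pspace_Cons [pspace_intros]: "pspace f \<Longrightarrow> pspace g \<Longrightarrow>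
  pspace (\<lambda>c. f c # g c)"
  by (rule pspace_recode[of "\<lambda>c. push_nat (enc (f c)) (4 + 5 * enc (g c))"]) (auto intro!:
    pspace_intros)

text \<open>
  Head and tail of a list are found in its code by trying all numbers up to the code.
\<close>

definition code_hd :: "nat \<Rightarrow> nat" where
  "code_hd z = least_below z (\<lambda>x. \<exists>a<z. push_nat x (4 + 5 * a) = z)"

definition code_tl :: "nat \<Rightarrow> nat" where
  "code_tl z = least_below z (\<lambda>a. \<exists>x<Suc z. push_nat x (4 + 5 * a) = z)"

lemma code_hd_push_nat: "code_hd (push_nat x (4 + 5 * a)) = x"
  unfolding code_hd_def
proof (rule least_below_unique)
  show "\<exists>b<push_nat x (4 + 5 * a). push_nat x (4 + 5 * b) = push_nat x (4 + 5 * a)"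
    using push_nat_ge[of x "4 + 5 * a"] by (intro exI[of _ a]) simp
qed (use push_nat_ge[of x "4 + 5 * a"] in \<open>auto dest: push_nat_inj\<close>)

lemma code_tl_push_nat: "code_tl (push_nat x (4 + 5 * a)) = a"
  unfolding code_tl_def
proof (rule least_below_unique)
  show "\<exists>y<Suc (push_nat x (4 + 5 * a)). push_nat y (4 + 5 * a) = push_nat x (4 + 5 * a)"
    using push_nat_ge[of x "4 + 5 * a"] by (intro exI[of _ x]) simp
qed (use push_nat_ge[of x "4 + 5 * a"] in \<open>auto dest: push_nat_inj\<close>)

lemma code_tl_0: "code_tl 0 = 0"
  by (simp add: code_tl_def least_below_def)

lemma pspace_code_hd: "pspace f \<Longrightarrow> pspace (\<lambda>c. code_hd (f c))"
proof (rule pspace_comp[of f code_hd])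
  show "pspace code_hd" unfolding code_hd_def[abs_def] by (intro pspace_intros)
qed

lemma pspace_code_tl: "pspace f \<Longrightarrow> pspace (\<lambda>c. code_tl (f c))"
proof (rule pspace_comp[of f code_tl])
  show "pspace code_tl" unfolding code_tl_def[abs_def] by (intro pspace_intros)
qed

lemma pspace_tl [pspace_intros]:
  fixes f :: "'a::code \<Rightarrow> 'b::code list"
  assumes "pspace f"
  shows "pspace (\<lambda>c. tl (f c))"
proof -
  have "enc (tl xs) = code_tl (enc xs)" for xs :: "'b list"
    by (cases xs) (simp_all add: code_tl_push_nat code_tl_0)
  then show ?thesis
    by (intro pspace_recode[OF pspace_code_tl[OF pspace_encode[OF assms]]]) simp
qed

lemma pspace_drop [pspace_intros]:
  fixes f :: "'a::code \<Rightarrow> 'b::code list"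
  assumes "pspace n" "pspace f"
  shows "pspace (\<lambda>c. drop (n c) (f c))"
proof -
  have eq: "(tl ^^ i) xs = drop i xs" for i and xs :: "'b list"
    by (induction i) (auto simp: drop_Suc tl_drop)
  have "pspace (\<lambda>c. (tl ^^ n c) (f c))"
  proof (rule pspace_iter[where G = "\<lambda>c. enc (f c)"])
    show "poly_length (\<lambda>c. enc (f c))" by (intro pspace_length_bound assms)
  qed (intro pspace_intros assms | simp add: eq enc_drop_le)+
  then show ?thesis by (simp only: eq)
qed

lemma pspace_length [pspace_intros]:
  fixes f :: "'a::code \<Rightarrow> 'b::code list"
  assumes "pspace f"
  shows "pspace (\<lambda>c. length (f c))"
proof -
  have eq: "length xs = least_below (enc xs) (\<lambda>i. drop i xs = [])" for xs :: "'b list"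
  proof (rule sym, rule least_below_eq)
    have "length xs < 2 ^ length xs" by simp
    then show "length xs \<le> enc xs" using two_power_length_le[of xs] by linarith
  qed auto
  show ?thesis unfolding eq by (intro pspace_intros assms pspace_comp[OF _ assms])
qed

lemma poly_value_length: "pspace f \<Longrightarrow> poly_value (\<lambda>c. length (f c))"
  using poly_value_mono[OF poly_value_bit_length[OF pspace_length_bound],
    of f "\<lambda>c. length (f c)"] length_le_code_size[unfolded code_size_def] by blast

text \<open>
  A total version of list access, which is unspecified beyond the end of the list.
\<close>

definition nth_or_0 :: "nat list \<Rightarrow> nat \<Rightarrow> nat" where
  "nth_or_0 p i = (if i < length p then p ! i else 0)"

lemma pspace_nth_or_0 [pspace_intros]:
  assumes "pspace f" "pspace n"
  shows "pspace (\<lambda>c. nth_or_0 (f c) (n c))"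
proof -
  have eq: "nth_or_0 p i = (if drop i p = [] then 0 else code_hd (enc (drop i p)))" for p i
  proof (cases "i < length p")
    case True
    then have "drop i p = p ! i # drop (Suc i) p" by (simp add: Cons_nth_drop_Suc)
    then show ?thesis using True by (simp add: nth_or_0_def code_hd_push_nat)
  qed (simp add: nth_or_0_def)
  show ?thesis unfolding eq by (intro pspace_intros assms pspace_code_hd)
qed

lemma enc_list_le:
  assumes "\<And>x. x \<in> set xs \<Longrightarrow> enc x \<le> F"
  shows "enc xs + 1 \<le> (8 ^ (bit_length F + 1) * 5) ^ length xs"
  using assms
proof (induction xs)
  case (Cons x xs)
  have "enc (x # xs) + 1 \<le> 8 ^ (bit_length (enc x) + 1) * (4 + 5 * enc xs + 1)"
    unfolding enc_Cons by (rule push_nat_le)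
  also have "\<dots> \<le> 8 ^ (bit_length F + 1) * (5 * (enc xs + 1))"
    using bit_length_mono[of "enc x" F] Cons.prems by (intro mult_mono power_increasing) auto
  also have "\<dots> \<le> 8 ^ (bit_length F + 1) * (5 * (8 ^ (bit_length F + 1) * 5) ^ length xs)"
    using Cons by (intro mult_left_mono) auto
  finally show ?case by (simp add: mult_ac)
qed simp

text \<open>
  The list is built from its end. Its length has to be polynomial, for its code is longer still.
\<close>

lemma pspace_map_upt:
  fixes f :: "'a::code \<Rightarrow> nat \<Rightarrow> 'b::code"
  assumes "pspace (\<lambda>z. f (fst z) (snd z))" "pspace m" "poly_value m"
  shows "pspace (\<lambda>c. map (f c) [0..<m c])"
proof -
  have eq: "rec_nat [] (\<lambda>i xs. f c (m c - 1 - i) # xs) k = map (f c) [m c - k..<m c]"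
    if "k \<le> m c" for c k
    using that
  proof (induction k)
    case (Suc k)
    then have "m c - k = Suc (m c - 1 - k)" by simp
    then show ?case using Suc by (simp add: upt_conv_Cons)
  qed simp
  obtain B where B: "poly_length B" "\<And>c i. enc i \<le> m c \<Longrightarrow>
    enc (f c i) \<le> B c"
    using poly_length_uniform[OF pspace_length_bound[OF assms(1)] poly_length_nat[OF assms(2)]]
    by (metis fst_conv snd_conv)
  have "pspace (\<lambda>c. rec_nat [] (\<lambda>i xs. f c (m c - 1 - i) # xs) (m c))"
  proof (rule pspace_rec[where G = "\<lambda>c. (8 ^ (bit_length (B c) + 1) * 5) ^ m c"])
    show "pspace (\<lambda>z. f (fst z) (m (fst z) - 1 - fst (snd z)) # snd (snd z))"
      by (intro pspace_intros pspace_subst2[OF assms(1)] pspace_comp[OF _ assms(2)])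
    show "poly_length (\<lambda>c. (8 ^ (bit_length (B c) + 1) * 5) ^ m c)"
      by (intro poly_length_power poly_length_mult poly_length_const poly_value_add
        poly_value_const poly_value_bit_length B assms)
    show "enc (rec_nat [] (\<lambda>i xs. f c (m c - 1 - i) # xs) i) \<le>
      (8 ^ (bit_length (B c) + 1) * 5) ^ m c"
      if "i \<le> m c" for c i
    proof -
      let ?xs = "map (f c) [m c - i..<m c]"
      have "enc ?xs + 1 \<le> (8 ^ (bit_length (B c) + 1) * 5) ^ length ?xs"
        by (rule enc_list_le) (auto intro!: B(2))
      also have "\<dots> \<le> (8 ^ (bit_length (B c) + 1) * 5) ^ m c"
        by (rule power_increasing) auto
      finally show ?thesis using eq[OF that] by simp
    qed
  qed (intro pspace_intros assms)+
  then show ?thesis by (rule pspace_cong) (subst eq, simp_all)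
qed

section \<open>States of the algorithm\<close>

instantiation unit :: code
begin
definition enc_unit :: "unit \<Rightarrow> nat" where "enc_unit u = 0"
instance by standard simp
end

fun call_number :: "call \<Rightarrow> nat" where
  "call_number Condition = 0"
| "call_number Assignment = 1"

fun line_number :: "line \<Rightarrow> nat" where
  "line_number Start = 0"
| "line_number For_v = 1"
| "line_number (Call_Order k) = 2 + call_number k"
| "line_number (Faithful_For_p k) = 4 + call_number k"
| "line_number (Faithful_For_c k) = 6 + call_number k"
| "line_number (Order_For_p k) = 8 + call_number k"
| "line_number (Order_Done k) = 10 + call_number k"
| "line_number For_c = 12"
| "line_number Stable_For_prefix = 13"
| "line_number Stable_Set_k = 14"
| "line_number Stable_Set_s = 15"
| "line_number Stable_While = 16"
| "line_number Stable_Set_n = 17"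
| "line_number Stable_Set_K = 18"
| "line_number For_q = 19"
| "line_number Return_YES = 20"
| "line_number Return_NO = 21"

lemma line_number_less: "line_number l < 22"
proof -
  have "call_number k < 2" for k by (cases k) auto
  then have "call_number k < n" if "2 \<le> n" for k n using that less_le_trans by blast
  then show ?thesis by (cases l) simp_all
qed

lemma line_number_inj: "line_number l = line_number l' \<Longrightarrow> l = l'"
proof -
  have "[Start, For_v, Call_Order Condition, Call_Order Assignment,
      Faithful_For_p Condition, Faithful_For_p Assignment,
      Faithful_For_c Condition, Faithful_For_c Assignment,
      Order_For_p Condition, Order_For_p Assignment, Order_Done Condition, Order_Done Assignment,
      For_c, Stable_For_prefix, Stable_Set_k, Stable_Set_s, Stable_While, Stable_Set_n,
      Stable_Set_K, For_q, Return_YES, Return_NO] ! line_number l = l" for l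
    proof (cases l)
    case (Call_Order k)
    then show ?thesis by (cases k) simp_all
  next
    case (Faithful_For_p k)
    then show ?thesis by (cases k) simp_all
  next
    case (Faithful_For_c k)
    then show ?thesis by (cases k) simp_all
  next
    case (Order_For_p k)
    then show ?thesis by (cases k) simp_all
  next
    case (Order_Done k)
    then show ?thesis by (cases k) simp_all
  qed simp_all
  then show "line_number l = line_number l' \<Longrightarrow> l = l'" by metis
qed

instantiation line :: code
begin
definition enc_line :: "line \<Rightarrow> nat" where "enc_line = line_number"
instance by standard (simp add: enc_line_def line_number_inj)
end

instantiation state_ext :: (code) code
begin
definition enc_state_ext :: "'a state_ext \<Rightarrow> nat" where
  "enc_state_ext s = enc
     (pc s, var_v s, var_fp s, var_fc s, var_op s, var_oN s, var_N s, var_c s, var_c' s, var_r s,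
      var_M s, var_k s, var_s s, var_n s, var_K s, var_q s, state.more s)"
instance by standard (auto simp: enc_state_ext_def enc_eq_iff)
end

lemma pspace_stateI:
  fixes f :: "'a::code \<Rightarrow> state"
  assumes "pspace (\<lambda>c. pc (f c))" "pspace (\<lambda>c. var_v (f c))" "pspace (\<lambda>c.
    var_fp (f c))"
    "pspace (\<lambda>c. var_fc (f c))" "pspace (\<lambda>c. var_op (f c))" "pspace (\<lambda>c.
      var_oN (f c))"
    "pspace (\<lambda>c. var_N (f c))" "pspace (\<lambda>c. var_c (f c))" "pspace (\<lambda>c.
      var_c' (f c))"
    "pspace (\<lambda>c. var_r (f c))" "pspace (\<lambda>c. var_M (f c))" "pspace (\<lambda>c.
      var_k (f c))"
    "pspace (\<lambda>c. var_s (f c))" "pspace (\<lambda>c. var_n (f c))" "pspace (\<lambda>c.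
      var_K (f c))"
    "pspace (\<lambda>c. var_q (f c))"
  shows "pspace f"
  by (rule pspace_recode[OF pspace_Pair[OF assms(1) pspace_Pair[OF assms(2) pspace_Pair[OF assms(3)
            pspace_Pair[OF assms(4) pspace_Pair[OF assms(5) pspace_Pair[OF assms(6) pspace_Pair[OF
              assms(7)
            pspace_Pair[OF assms(8) pspace_Pair[OF assms(9) pspace_Pair[OF assms(10)
              pspace_Pair[OF assms(11)
            pspace_Pair[OF assms(12) pspace_Pair[OF assms(13) pspace_Pair[OF assms(14)
              pspace_Pair[OF assms(15)
            pspace_Pair[OF assms(16) pspace_const[of "()"]]]]]]]]]]]]]]]]]])
    (simp add: enc_state_ext_def)

lemma pspace_state_select [pspace_intros]:
  fixes s :: "'a::code \<Rightarrow> state"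
  assumes "pspace s"
  shows "pspace (\<lambda>c. pc (s c))" "pspace (\<lambda>c. var_v (s c))" "pspace (\<lambda>c.
    var_fp (s c))"
    "pspace (\<lambda>c. var_fc (s c))" "pspace (\<lambda>c. var_op (s c))" "pspace (\<lambda>c.
      var_oN (s c))"
    "pspace (\<lambda>c. var_N (s c))" "pspace (\<lambda>c. var_c (s c))" "pspace (\<lambda>c.
      var_c' (s c))"
    "pspace (\<lambda>c. var_r (s c))" "pspace (\<lambda>c. var_M (s c))" "pspace (\<lambda>c.
      var_k (s c))"
    "pspace (\<lambda>c. var_s (s c))" "pspace (\<lambda>c. var_n (s c))" "pspace (\<lambda>c.
      var_K (s c))"
    "pspace (\<lambda>c. var_q (s c))"
proof -
  let ?t = "\<lambda>s :: state. (pc s, var_v s, var_fp s, var_fc s, var_op s, var_oN s, var_N s,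
    var_c s,
    var_c' s, var_r s, var_M s, var_k s, var_s s, var_n s, var_K s, var_q s, state.more s)"
  have t: "pspace (\<lambda>c. ?t (s c))"
    by (rule pspace_recode[OF assms]) (simp add: enc_state_ext_def)
  note s = pspace_snd[OF t, unfolded snd_conv]
  note s2 = pspace_snd[OF s, unfolded snd_conv]
  note s3 = pspace_snd[OF s2, unfolded snd_conv]
  note s4 = pspace_snd[OF s3, unfolded snd_conv]
  note s5 = pspace_snd[OF s4, unfolded snd_conv]
  note s6 = pspace_snd[OF s5, unfolded snd_conv]
  note s7 = pspace_snd[OF s6, unfolded snd_conv]
  note s8 = pspace_snd[OF s7, unfolded snd_conv]
  note s9 = pspace_snd[OF s8, unfolded snd_conv]
  note s10 = pspace_snd[OF s9, unfolded snd_conv]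
  note s11 = pspace_snd[OF s10, unfolded snd_conv]
  note s12 = pspace_snd[OF s11, unfolded snd_conv]
  note s13 = pspace_snd[OF s12, unfolded snd_conv]
  note s14 = pspace_snd[OF s13, unfolded snd_conv]
  note s15 = pspace_snd[OF s14, unfolded snd_conv]
  note all = t s s2 s3 s4 s5 s6 s7 s8 s9 s10 s11 s12 s13 s14 s15
  show "pspace (\<lambda>c. pc (s c))" "pspace (\<lambda>c. var_v (s c))" "pspace (\<lambda>c.
    var_fp (s c))"
    "pspace (\<lambda>c. var_fc (s c))" "pspace (\<lambda>c. var_op (s c))" "pspace (\<lambda>c.
      var_oN (s c))"
    "pspace (\<lambda>c. var_N (s c))" "pspace (\<lambda>c. var_c (s c))" "pspace (\<lambda>c.
      var_c' (s c))"
    "pspace (\<lambda>c. var_r (s c))" "pspace (\<lambda>c. var_M (s c))" "pspace (\<lambda>c.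
      var_k (s c))"
    "pspace (\<lambda>c. var_s (s c))" "pspace (\<lambda>c. var_n (s c))" "pspace (\<lambda>c.
      var_K (s c))"
    "pspace (\<lambda>c. var_q (s c))"
    by (rule all[THEN pspace_fst, unfolded fst_conv])+
qed

lemma pspace_state_update [pspace_intros]:
  fixes s :: "'a::code \<Rightarrow> state"
  assumes "pspace s"
  shows "pspace x0 \<Longrightarrow> pspace (\<lambda>c. (s c)\<lparr>pc := x0 c\<rparr>)"
    and "pspace x1 \<Longrightarrow> pspace (\<lambda>c. (s c)\<lparr>var_v := x1 c\<rparr>)"
    and "pspace x2 \<Longrightarrow> pspace (\<lambda>c. (s c)\<lparr>var_fp := x2 c\<rparr>)"
    and "pspace x2 \<Longrightarrow> pspace (\<lambda>c. (s c)\<lparr>var_fc := x2 c\<rparr>)"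
    and "pspace x2 \<Longrightarrow> pspace (\<lambda>c. (s c)\<lparr>var_op := x2 c\<rparr>)"
    and "pspace x3 \<Longrightarrow> pspace (\<lambda>c. (s c)\<lparr>var_oN := x3 c\<rparr>)"
    and "pspace x3 \<Longrightarrow> pspace (\<lambda>c. (s c)\<lparr>var_N := x3 c\<rparr>)"
    and "pspace x2 \<Longrightarrow> pspace (\<lambda>c. (s c)\<lparr>var_c := x2 c\<rparr>)"
    and "pspace x2 \<Longrightarrow> pspace (\<lambda>c. (s c)\<lparr>var_c' := x2 c\<rparr>)"
    and "pspace x3 \<Longrightarrow> pspace (\<lambda>c. (s c)\<lparr>var_r := x3 c\<rparr>)"
    and "pspace x3 \<Longrightarrow> pspace (\<lambda>c. (s c)\<lparr>var_M := x3 c\<rparr>)"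
    and "pspace x3 \<Longrightarrow> pspace (\<lambda>c. (s c)\<lparr>var_k := x3 c\<rparr>)"
    and "pspace x3 \<Longrightarrow> pspace (\<lambda>c. (s c)\<lparr>var_s := x3 c\<rparr>)"
    and "pspace x3 \<Longrightarrow> pspace (\<lambda>c. (s c)\<lparr>var_n := x3 c\<rparr>)"
    and "pspace x3 \<Longrightarrow> pspace (\<lambda>c. (s c)\<lparr>var_K := x3 c\<rparr>)"
    and "pspace x2 \<Longrightarrow> pspace (\<lambda>c. (s c)\<lparr>var_q := x2 c\<rparr>)"
  by (rule pspace_stateI; simp add: pspace_state_select[OF assms])+

lemma pspace_case_line [pspace_intros]:
  fixes l :: "'a::code \<Rightarrow> line"
  assumes "pspace l" "pspace f0" "pspace f1"
    "pspace (\<lambda>c. f2 c Condition)" "pspace (\<lambda>c. f2 c Assignment)"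
    "pspace (\<lambda>c. f3 c Condition)" "pspace (\<lambda>c. f3 c Assignment)"
    "pspace (\<lambda>c. f4 c Condition)" "pspace (\<lambda>c. f4 c Assignment)"
    "pspace (\<lambda>c. f5 c Condition)" "pspace (\<lambda>c. f5 c Assignment)"
    "pspace (\<lambda>c. f6 c Condition)" "pspace (\<lambda>c. f6 c Assignment)"
    "pspace f7" "pspace f8" "pspace f9" "pspace f10" "pspace f11" "pspace f12" "pspace f13"
      "pspace f14" "pspace f15" "pspace f16"
  shows "pspace (\<lambda>c. case l c of Start \<Rightarrow> f0 c | For_v \<Rightarrow> f1 c |
    Call_Order k \<Rightarrow> f2 c k
    | Faithful_For_p k \<Rightarrow> f3 c k | Faithful_For_c k \<Rightarrow> f4 c k | Order_For_p
      k \<Rightarrow> f5 c k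
    | Order_Done k \<Rightarrow> f6 c k | For_c \<Rightarrow> f7 c | Stable_For_prefix
      \<Rightarrow> f8 c | Stable_Set_k \<Rightarrow> f9 c
    | Stable_Set_s \<Rightarrow> f10 c | Stable_While \<Rightarrow> f11 c | Stable_Set_n
      \<Rightarrow> f12 c
    | Stable_Set_K \<Rightarrow> f13 c | For_q \<Rightarrow> f14 c | Return_YES \<Rightarrow> f15
      c | Return_NO \<Rightarrow> f16 c)"
proof -
  note eq = pspace_eq[OF assms(1) pspace_const]
  note ifs =
    pspace_If[OF eq[of Start] assms(2) pspace_If[OF eq[of For_v] assms(3)
      pspace_If[OF eq[of "Call_Order Condition"] assms(4)
      pspace_If[OF eq[of "Call_Order Assignment"] assms(5)
      pspace_If[OF eq[of "Faithful_For_p Condition"] assms(6)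
      pspace_If[OF eq[of "Faithful_For_p Assignment"] assms(7)
      pspace_If[OF eq[of "Faithful_For_c Condition"] assms(8)
      pspace_If[OF eq[of "Faithful_For_c Assignment"] assms(9)
      pspace_If[OF eq[of "Order_For_p Condition"] assms(10)
      pspace_If[OF eq[of "Order_For_p Assignment"] assms(11)
      pspace_If[OF eq[of "Order_Done Condition"] assms(12)
      pspace_If[OF eq[of "Order_Done Assignment"] assms(13) pspace_If[OF eq[of For_c] assms(14)
      pspace_If[OF eq[of Stable_For_prefix] assms(15) pspace_If[OF eq[of Stable_Set_k] assms(16)
      pspace_If[OF eq[of Stable_Set_s] assms(17) pspace_If[OF eq[of Stable_While] assms(18)
      pspace_If[OF eq[of Stable_Set_n] assms(19) pspace_If[OF eq[of Stable_Set_K] assms(20)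
      pspace_If[OF eq[of For_q] assms(21) pspace_If[OF eq[of Return_YES] assms(22)
      assms(23)]]]]]]]]]]]]]]]]]]]]]
  have "k = Condition \<or> k = Assignment" for k by (cases k) auto
  then show ?thesis
    by (intro pspace_cong[OF ifs]) (case_tac "l a"; simp; metis)
qed

section \<open>Reading the matrices from the input\<close>

text \<open>
  The digits of \<open>X\<close> are split off one at a time, the remaining number being part of
  the iterated value.
\<close>

lemma pspace_foldl_digits:
  fixes s :: "'a::code \<Rightarrow> 'b::code \<Rightarrow> nat \<Rightarrow> 'b"
  assumes X: "pspace X" and a: "pspace a" and s: "pspace (\<lambda>z. s (fst z) (fst (snd z)) (snd
    (snd z)))"
    and G: "poly_length G" "\<And>c k. enc (foldl (s c) (a c) (take k (digits (X c)))) \<le> G c"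
  shows "pspace (\<lambda>c. foldl (s c) (a c) (digits (X c)))"
proof -
  let ?t = "\<lambda>c z. if fst z = 0 then z
    else ((fst z - 1) div 5, s c (snd z) (Suc ((fst z - 1) mod 5)))"
  have eq: "(?t c ^^ i) (X c, a c) = (digit_value (drop i (digits (X c))),
    foldl (s c) (a c) (take i (digits (X c))))" for c i
  proof (induction i)
    case (Suc i)
    let ?ds = "digits (X c)"
    show ?case
    proof (cases "i < length ?ds")
      case True
      have "?ds ! i \<in> {1..5}" using set_digits True nth_mem by blast
      then obtain d where d: "?ds ! i = Suc d" "d < 5" by (cases "?ds ! i") auto
      have drop: "drop i ?ds = Suc d # drop (Suc i) ?ds"
        using True d(1) by (metis Cons_nth_drop_Suc)
      have take: "take (Suc i) ?ds = take i ?ds @ [Suc d]"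
        using True d(1) by (simp add: take_Suc_conv_app_nth)
      show ?thesis using Suc d(2) by (simp add: drop take del: drop_Suc)
    qed (use Suc in simp)
  qed simp
  have "pspace (\<lambda>c. (?t c ^^ X c) (X c, a c))"
  proof (rule pspace_iter[where G = "\<lambda>c. (X c + G c + 1) ^ 2"])
    show "pspace (\<lambda>z. ?t (fst z) (snd z))"
      by (intro pspace_intros pspace_comp[OF _ s, where f =
        "\<lambda>z. (fst z, snd (snd z), Suc ((fst (snd z) - 1) mod 5))",
          simplified fst_conv snd_conv])
    show "poly_length (\<lambda>c. (X c + G c + 1) ^ 2)"
      by (intro poly_length_power poly_length_add poly_length_const poly_value_const
        poly_length_nat X G)
    show "enc ((?t c ^^ i) (X c, a c)) \<le> (X c + G c + 1)\<^sup>2" for c i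
    proof -
      have "digit_value (drop i ds) \<le> digit_value ds" for ds
      proof (induction ds arbitrary: i)
        case (Cons d ds)
        show ?case using Cons[of "i - 1"] by (cases i) auto
      qed simp
      from this[of "digits (X c)"] G(2)[of c i] show ?thesis
        unfolding eq enc_prod_def by (intro prod_encode_le) auto
    qed
  qed (intro pspace_intros X a)+
  moreover have "length (digits (X c)) \<le> X c" for c
    using length_digits bit_length_le_self le_trans by blast
  ultimately show ?thesis
    using pspace_snd by (fastforce simp: eq dest!: pspace_snd)
qed

text \<open>
  A reader of the input that is interested in one entry, the one in row \<open>u\<close> and
  column \<open>w\<close>. It keeps the current row and column, and the sign and the absolute
  value of that entry as far as they have been read. The rows of both matrices are counted
  through, so the rows of \<open>B\<close> follow those of \<open>A\<close>.
\<close>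

definition parse_step :: "nat \<Rightarrow> nat \<Rightarrow> nat \<times> nat \<times> bool
  \<times> nat \<Rightarrow> nat \<Rightarrow> nat \<times> nat \<times> bool \<times> nat" where
  "parse_step u w z d =
    (if d = 5 then (Suc (fst z), 0, snd (snd z))
     else if d = 4 then (fst z, Suc (fst (snd z)), snd (snd z))
     else if fst z = u \<and> fst (snd z) = w then
       (u, w, if d = 3 then (True, snd (snd (snd z)))
              else (fst (snd (snd z)), 2 * snd (snd (snd z)) + (d - 1)))
     else z)"

lemma parse_step_simps [simp]:
  "parse_step u w (i, j, c) 5 = (Suc i, 0, c)"
  "parse_step u w (i, j, c) 4 = (i, Suc j, c)"
  "parse_step u w (u, w, b, m) 3 = (u, w, True, m)"
  "parse_step u w (u, w, b, m) 2 = (u, w, b, 2 * m + 1)"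
  "parse_step u w (u, w, b, m) (Suc 0) = (u, w, b, 2 * m)"
  "(i, j) \<noteq> (u, w) \<Longrightarrow> d < 4 \<Longrightarrow>
    parse_step u w (i, j, c) d = (i, j, c)"
  by (auto simp: parse_step_def)

definition entry :: "nat \<Rightarrow> nat \<Rightarrow> nat \<Rightarrow> int" where
  "entry X u w = (let z = snd (snd (foldl (parse_step u w) (0, 0, False, 0) (digits X)))
     in mkint (fst z) (snd z))"

definition rows :: "nat \<Rightarrow> nat" where
  "rows X = foldl (\<lambda>n d. if d = 5 then Suc n else n) 0 (digits X)"

text \<open>
  The symbol 5 ends a row, and both matrices have the same number of rows.
\<close>

definition dim :: "nat \<Rightarrow> nat" where
  "dim X = rows X div 2"

lemma parse_bound:
  assumes "set ds \<subseteq> {1..5}" "foldl (parse_step u w) (0, 0, False, 0) ds = (i, j, b, m)"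
  shows "i \<le> length ds \<and> j \<le> length ds \<and> m < 2 ^ length ds"
  using assms
proof (induction ds arbitrary: i j b m rule: rev_induct)
  case (snoc d ds)
  obtain i' j' b' m' where *: "foldl (parse_step u w) (0, 0, False, 0) ds = (i', j', b', m')"
    by (metis prod.collapse)
  then have IH: "i' \<le> length ds \<and> j' \<le> length ds \<and> m' < 2 ^ length ds"
    using snoc by simp
  then have "Suc m' \<le> 2 ^ length ds" by simp
  moreover have "parse_step u w (i', j', b', m') d = (i, j, b, m)" "1 \<le> d" "d \<le> 5"
    using snoc.prems * by auto
  ultimately show ?case using IH
    by (cases "d = 3"; cases "d = 4"; cases "d = 5") (auto simp: parse_step_def split: if_splits)
qed simp

lemma pspace_entry [pspace_intros]:
  assumes "pspace X" "pspace u" "pspace w"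
  shows "pspace (\<lambda>c. entry (X c) (u c) (w c))"
proof -
  let ?k = "\<lambda>c. bit_length (X c)"
  let ?G = "\<lambda>c. (?k c + (?k c + (1 + 2 ^ ?k c + 1) ^ 2 + 1) ^ 2 + 1) ^ 2 :: nat"
  have "pspace (\<lambda>c. foldl (parse_step (u c) (w c)) (0, 0, False, 0) (digits (X c)))"
  proof (rule pspace_foldl_digits[where G = ?G])
    show "pspace (\<lambda>z. parse_step (u (fst z)) (w (fst z)) (fst (snd z)) (snd (snd z)))"
      unfolding parse_step_def
      by (intro pspace_intros pspace_comp[OF _ assms(2)] pspace_comp[OF _ assms(3)])
    show "poly_length ?G"
      by (intro poly_length_power poly_length_add poly_length_poly_value poly_value_const
        poly_length_const poly_value_bit_length poly_length_nat assms)
    show "enc (foldl (parse_step (u c) (w c)) (0, 0, False, 0) (take k (digits (X c)))) \<le>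
      ?G c" for c k
    proof -
      obtain i j b m where *: "foldl (parse_step (u c) (w c)) (0, 0, False,
        0) (take k (digits (X c))) = (i, j, b, m)"
        by (metis prod.collapse)
      have len: "length (take k (digits (X c))) \<le> ?k c" using length_digits[of "X c"] by simp
      have "i \<le> ?k c" "j \<le> ?k c" "m < 2 ^ length (take k (digits (X c)))"
        using parse_bound[OF _ *] set_digits[of "X c"] set_take_subset[of k "digits (X c)"] len
          by fastforce+
      moreover have "(2::nat) ^ length (take k (digits (X c))) \<le> 2 ^ ?k c"
        by (rule power_increasing[OF len]) simp
      ultimately have "i \<le> ?k c" "j \<le> ?k c" "m \<le> 2 ^ ?k c" by linarith+
      then show ?thesis
        unfolding * enc_prod_def fst_conv snd_conv using enc_bool_le[of b]
        by (intro prod_encode_le) auto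
    qed
  qed (intro pspace_intros assms)+
  note 1 = pspace_snd[OF pspace_snd[OF this]]
  show ?thesis
    unfolding entry_def Let_def by (intro pspace_mkint pspace_fst[OF 1] pspace_snd[OF 1])
qed

lemma rows_le: "foldl (\<lambda>n d. if d = 5 then Suc n else n) a ds \<le> a + length ds"
proof (induction ds arbitrary: a)
  case (Cons d ds)
  show ?case using Cons[of "Suc a"] Cons[of a] by (cases "d = 5") auto
qed simp

lemma dim_le: "dim X \<le> bit_length X"
  using rows_le[of 0 "digits X"] length_digits[of X] unfolding dim_def rows_def by simp

lemma poly_value_dim: "pspace X \<Longrightarrow> poly_value (\<lambda>c. dim (X c))"
  by (rule poly_value_mono[OF poly_value_bit_length[OF poly_length_nat] dim_le])

lemma pspace_dim [pspace_intros]: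
  assumes "pspace X"
  shows "pspace (\<lambda>c. dim (X c))"
proof -
  have "pspace (\<lambda>c. foldl (\<lambda>n d. if d = 5 then Suc n else n) 0 (digits (X c)))"
  proof (rule pspace_foldl_digits[where G = "\<lambda>c. bit_length (X c)"])
    show "poly_length (\<lambda>c. bit_length (X c))"
      by (intro poly_length_poly_value poly_value_bit_length poly_length_nat assms)
    show "enc (foldl (\<lambda>n d. if d = 5 then Suc n else n) 0 (take k (digits (X c)))) \<le>
      bit_length (X c)" for c k
      using rows_le[of 0 "take k (digits (X c))"] length_digits[of "X c"] by simp
  qed (intro pspace_intros assms)+
  then show ?thesis unfolding dim_def rows_def by (intro pspace_intros)
qed

text \<open>
  At the entry that is looked for the digits are added to the value, elsewhere they are skipped.
\<close>

lemma foldl_parse_int: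
  assumes "(i, j) = (u, w) \<Longrightarrow> b = False \<and> m = 0"
  shows "foldl (parse_step u w) (i, j, b, m) (encode_int z) =
    (if (i, j) = (u, w) then (i, j, z < 0, nat \<bar>z\<bar>) else (i, j, b, m))"
proof (cases "(i, j) = (u, w)")
  case True
  have 1: "foldl (parse_step u w) (u, w, b, m) ds = (u, w, b, binval m ds)"
    if "set ds \<subseteq> {1, 2}" for ds b m
    using that by (induction ds arbitrary: m) (auto simp: binval_def numeral_2_eq_2[symmetric])
  show ?thesis
    using True assms 1[OF set_encode_nat, of _ _ "nat \<bar>z\<bar>"]
    by (auto simp: encode_int_def binval_encode_nat)
next
  case False
  have 1: "foldl (parse_step u w) (i, j, b, m) ds = (i, j, b, m)"
    if "set ds \<subseteq> {1, 2, 3}" for ds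
    using that False by (induction ds) auto
  have "set (encode_int z) \<subseteq> {1, 2, 3}"
    using set_encode_nat[of "nat \<bar>z\<bar>"] by (auto simp: encode_int_def)
  from 1[OF this] show ?thesis using False by auto
qed

lemma foldl_parse_row:
  assumes "i = u \<Longrightarrow> b = False \<and> m = 0"
  shows "foldl (parse_step u w) (i, 0, b, m) (concat (map (\<lambda>w. encode_int (f w) @ [4])
    [0..<n])) =
    (i, n, if i = u \<and> w < n then (f w < 0, nat \<bar>f w\<bar>) else (b, m))"
proof (induction n)
  case (Suc n)
  show ?case
  proof (cases "(i, n) = (u, w)")
    case True
    then show ?thesis using Suc assms foldl_parse_int[of i n u w b m "f n"]
      by simp
  next
    case False
    have "foldl (parse_step u w) (i, n, c) (encode_int (f n)) = (i, n, c)" for c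
      using False foldl_parse_int[of i n u w "fst c" "snd c" "f n"] by auto
    then show ?thesis using Suc False by (auto simp: less_Suc_eq)
  qed
qed simp

lemma foldl_parse_mat:
  assumes "dim_col A = n" "w < n" "u \<ge> i \<Longrightarrow> b = False \<and> m = 0"
  shows "foldl (parse_step u w) (i, 0, b, m) (encode_mat A) =
    (i + dim_row A, 0, if i \<le> u \<and> u < i + dim_row A
       then (A $$ (u - i, w) < 0, nat \<bar>A $$ (u - i, w)\<bar>) else (b, m))"
proof -
  let ?row = "\<lambda>u. concat (map (\<lambda>w. encode_int (A $$ (u, w)) @ [4]) [0..<n]) @ [5]"
  have "foldl (parse_step u w) (i, 0, b, m) (concat (map ?row [0..<k])) =
    (i + k, 0, if i \<le> u \<and> u < i + k
       then (A $$ (u - i, w) < 0, nat \<bar>A $$ (u - i, w)\<bar>) else (b, m))" for k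
  proof (induction k)
    case 0
    then show ?case by auto
  next
    case (Suc k)
    show ?case
    proof (cases "i + k = u")
      case True
      then show ?thesis
        using Suc assms foldl_parse_row[of u u b m w "\<lambda>w. A $$ (k, w)" n]
        by auto
    next
      case False
      have "foldl (parse_step u w) (i + k, 0, c) (concat (map (\<lambda>w. encode_int (A $$ (k,
        w)) @ [4]) [0..<n])) = (i + k, n, c)" for c
        using False foldl_parse_row[of "i + k" u "fst c" "snd c" w "\<lambda>w. A $$ (k, w)" n]
          by auto
      then show ?thesis using Suc False by auto
    qed
  qed
  from this[of "dim_row A"] show ?thesis using assms(1) by (simp add: encode_mat_def)
qed

lemma set_encode_int: "set (encode_int z) \<subseteq> {1..5}"
  using set_encode_nat[of "nat \<bar>z\<bar>"] by (auto simp: encode_int_def)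

lemma set_encode_mat: "set (encode_mat A) \<subseteq> {1..5}"
  using set_encode_int unfolding encode_mat_def by (auto dest!: subsetD)

lemma set_encode_path: "set (encode_path p) \<subseteq> {1..5}"
  unfolding encode_path_def by (auto dest!: subsetD[OF set_encode_nat])

definition input :: "int mat \<times> int mat \<Rightarrow> nat" where
  "input x = digit_value (encode_pair x)"

lemma digits_input: "digits (input x) = encode_pair x"
  unfolding input_def using set_encode_mat
  by (intro digits_digit_value) (auto simp: encode_pair_def split: prod.split)

lemma entry_input:
  assumes "A \<in> carrier_mat n n" "B \<in> carrier_mat n n" "u < n" "w < n"
  shows "entry (input (A, B)) u w = A $$ (u, w)"
    and "entry (input (A, B)) (n + u) w = B $$ (u, w)"
  using assms
    foldl_parse_mat[of A n w 0 u False 0]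
    foldl_parse_mat[of A n w 0 "n + u" False 0]
    foldl_parse_mat[where A = B and n = n and w = w and i = n and u = u and
      b = "A $$ (u, w) < 0" and m = "nat \<bar>A $$ (u, w)\<bar>"]
    foldl_parse_mat[of B n w n "n + u" False 0]
  by (auto simp: entry_def digits_input encode_pair_def mkint_def Let_def)

lemma dim_input:
  assumes "A \<in> carrier_mat n n" "B \<in> carrier_mat n n"
  shows "dim (input (A, B)) = n"
proof -
  let ?f = "\<lambda>n d. if d = 5 then Suc n else n :: nat"
  have 1: "foldl ?f a ds = a" if "5 \<notin> set ds" for a and ds :: "nat list"
    using that by (induction ds) auto
  have int: "5 \<notin> set (encode_int z)" for z
    using set_encode_nat[of "nat \<bar>z\<bar>"] by (auto simp: encode_int_def)
  have "foldl ?f a (concat (map (\<lambda>u. concat (map (\<lambda>w. encode_int (C $$ (u,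
    w)) @ [4]) [0..<n]) @ [5]) [0..<k])) = a + k"
    for a k and C :: "int mat"
    by (induction k) (auto simp: 1 int)
  then have "foldl ?f a (encode_mat C) = a + dim_row C" if "dim_col C = n" for a C
    using that by (simp add: encode_mat_def)
  then show ?thesis
    using assms by (simp add: dim_def rows_def digits_input encode_pair_def)
qed

section \<open>Exhaustive search in the lexicographic order\<close>

text \<open>
  All lists that matter are of this form: simple paths do not repeat a vertex, and simple cycles
  repeat only the first one.
\<close>

definition short_lists :: "nat \<Rightarrow> nat list set" where
  "short_lists n = {p. set p \<subseteq> {..<n} \<and> length p \<le> n + 1}"

text \<open>
  The number \<open>j\<close> determines the length of the list, as \<open>j mod (n + 2)\<close>,
  and its elements, as the digits of \<open>j div (n + 2)\<close> in base \<open>n\<close>. The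
  digits are obtained by repeated division because the power of \<open>n\<close> by an arbitrary
  exponent would be too long.
\<close>

definition candidate :: "nat \<Rightarrow> nat \<Rightarrow> nat list" where
  "candidate n j = map (\<lambda>i. ((\<lambda>x. x div n) ^^ i) (j div (n + 2)) mod n) [0..<j mod
    (n + 2)]"

lemma funpow_div: "((\<lambda>x. x div n) ^^ i) k = k div n ^ i" for n k :: nat
  by (induction i) (auto simp: div_mult2_eq[symmetric] mult.commute)

lemma digits_exist:
  "set p \<subseteq> {..<n} \<Longrightarrow> \<exists>k<n ^ length p. \<forall>i<length p. k div
    n ^ i mod n = p ! i" for n :: nat
proof (induction p)
  case (Cons a p)
  then obtain k where k: "k < n ^ length p" "\<And>i. i < length p \<Longrightarrow>
    k div n ^ i mod n = p ! i"
    by auto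
  have a: "a < n" using Cons.prems by simp
  have "a + n * k < n * (k + 1)" using a by simp
  also have "\<dots> \<le> n * n ^ length p" using k(1) by (intro mult_left_mono) auto
  finally have "a + n * k < n ^ length (a # p)" by simp
  moreover have "(a + n * k) div n ^ i mod n = (a # p) ! i" if "i < length (a # p)" for i
    using a k(2) that by (cases i) (auto simp: div_mult2_eq)
  ultimately show ?case by blast
qed simp

lemma candidate_range:
  assumes "n \<ge> 1"
  shows "candidate n ` {..<(n + 2) * n ^ (n + 1)} = short_lists n"
proof
  have "j mod (n + 2) \<le> n + 1" for j
    using mod_less_divisor[of "n + 2" j] by linarith
  then show "candidate n ` {..<(n + 2) * n ^ (n + 1)} \<subseteq> short_lists n"
    using assms by (auto simp: candidate_def short_lists_def)
  show "short_lists n \<subseteq> candidate n ` {..<(n + 2) * n ^ (n + 1)}"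
  proof
    fix p assume p: "p \<in> short_lists n"
    then obtain k where k: "k < n ^ length p" "\<And>i. i < length p \<Longrightarrow>
      k div n ^ i mod n = p ! i"
      using digits_exist[of p n] by (auto simp: short_lists_def)
    let ?j = "length p + (n + 2) * k"
    have len: "length p < n + 2" using p by (simp add: short_lists_def)
    have mod: "?j mod (n + 2) = length p" using len by (simp only: mod_mult_self2 mod_less)
    have div: "?j div (n + 2) = k" using len by (subst div_mult_self2) auto
    have "candidate n ?j = p"
      unfolding candidate_def mod div funpow_div by (rule nth_equalityI) (use k(2) in auto)
    moreover have "?j < (n + 2) * n ^ (n + 1)"
    proof -
      have "?j < (n + 2) * (k + 1)" using len by simp
      also have "\<dots> \<le> (n + 2) * n ^ length p" using k(1) by (intro mult_left_mono) auto
      also have "\<dots> \<le> (n + 2) * n ^ (n + 1)"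
        using p assms by (intro mult_left_mono power_increasing) (auto simp: short_lists_def)
      finally show ?thesis .
    qed
    ultimately show "p \<in> candidate n ` {..<(n + 2) * n ^ (n + 1)}"
      by (metis imageI lessThan_iff)
  qed
qed

text \<open>
  All candidates are tried, in an order that has nothing to do with the lexicographic one;
  \<open>b\<close> is the least success so far.
\<close>

definition search :: "nat \<Rightarrow> (nat list \<Rightarrow> bool) \<Rightarrow> nat list
  option" where
  "search n P = rec_nat None (\<lambda>j b. if P (candidate n j) \<and>
    (b = None \<or> candidate n j < the b)
     then Some (candidate n j) else b) ((n + 2) * n ^ (n + 1))"

lemma first_insert:
  "finite S \<Longrightarrow> first (insert y S) =
    (if first S = None \<or> y < the (first S) then Some y else first S)"
proof -
  assume "finite S"
  moreover have "min y m = (if y < m then y else m)" for m by (simp add: min_def le_less)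
  ultimately show ?thesis by (cases "S = {}") (simp_all only: first_def Min_insert, auto)
qed

lemma search_eq:
  assumes "n \<ge> 1"
  shows "search n P = first {p \<in> short_lists n. P p}"
proof -
  let ?f = "\<lambda>j b. if P (candidate n j) \<and> (b = None \<or> candidate n j < the b)
     then Some (candidate n j) else b"
  have "rec_nat None ?f k = first {p \<in> candidate n ` {..<k}. P p}" for k
  proof (induction k)
    case 0
    then show ?case by (simp add: first_def)
  next
    case (Suc k)
    have "{p \<in> candidate n ` {..<Suc k}. P p} = (if P (candidate n k)
        then insert (candidate n k) {p \<in> candidate n ` {..<k}. P p}
        else {p \<in> candidate n ` {..<k}. P p})"
      by (auto simp: less_Suc_eq)
    then show ?case using Suc by (simp add: first_insert)
  qed
  then show ?thesis using candidate_range[OF assms] by (simp add: search_def)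
qed

text \<open>
  The lexicographic order in terms of bounded quantifiers: \<open>i\<close> is the first position
  at which the lists differ, or the end of \<open>xs\<close>.
\<close>

lemma list_less_iff:
  "xs < ys \<longleftrightarrow> (\<exists>i<length ys. (\<forall>j<i. j < length xs \<and>
    nth_or_0 xs j = nth_or_0 ys j) \<and>
     (i < length xs \<longrightarrow> nth_or_0 xs i < nth_or_0 ys i))"
proof (induction xs arbitrary: ys)
  case Nil
  show ?case
  proof (cases ys)
    case (Cons y ys')
    then show ?thesis by (auto intro!: exI[of _ 0])
  qed simp
next
  case (Cons x xs)
  show ?case
  proof (cases ys)
    case ys: (Cons y ys')
    have nth: "nth_or_0 (z # zs) (Suc i) = nth_or_0 zs i" "nth_or_0 (z # zs) 0 = z" for z zs i
      by (simp_all add: nth_or_0_def)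
    show ?thesis
      unfolding ys length_Cons Ex_less_Suc2 All_less_Suc2 nth by (auto simp: Cons.IH nth)
  qed simp
qed

lemma pspace_list_less [pspace_intros]:
  assumes "pspace f" "pspace g"
  shows "pspace (\<lambda>c. f c < (g c :: nat list))"
  unfolding list_less_iff by (intro pspace_intros pspace_comp[OF _ assms(1)] pspace_comp[OF _
    assms(2)] assms)

lemma pspace_search [pspace_intros]:
  assumes n: "pspace n" "poly_value n" and P: "pspace (\<lambda>z. P (fst z) (snd z))"
  shows "pspace (\<lambda>c. search (n c) (P c))"
proof -
  have cand: "pspace (\<lambda>z. candidate (n (fst z)) (snd z))"
  proof -
    have n1: "pspace (\<lambda>z. n (fst (f z)))"
      if "pspace f" for f :: "'c::code \<Rightarrow> 'a \<times> nat"
      using pspace_comp[OF pspace_fst[OF that] n(1)] .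
    have shift: "pspace (\<lambda>z. ((\<lambda>x. x div n (fst (fst z))) ^^ snd z) (snd (fst z)
      div (n (fst (fst z)) + 2)))"
    proof (rule pspace_iter[where G = "\<lambda>z. snd (fst z)"])
      show "enc (((\<lambda>x. x div n (fst (fst z))) ^^ i) (snd (fst z) div (n (fst (fst z)) +
        2))) \<le> snd (fst z)"
        for z :: "('a \<times> nat) \<times> nat" and i
        unfolding funpow_div by (metis div_le_dividend enc_nat_def le_trans)
    qed (intro pspace_intros n1 poly_length_nat)+
    have poly_value: "poly_value (\<lambda>z. snd z mod (n (fst z) + 2))"
    proof (rule poly_value_mono)
      have "poly_value (\<lambda>z::'a \<times> nat. n (fst z))"
        by (rule poly_value_comp[OF n(2)]) (use pspace_length_bound[OF pspace_fst[OF pspace_id]]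
          in \<open>simp add: poly_length_def code_size_def\<close>)
      then show "poly_value (\<lambda>z::'a \<times> nat. n (fst z) + 2)"
        by (intro poly_value_add poly_value_const)
    qed (simp add: less_imp_le)
    show ?thesis unfolding candidate_def
      by (rule pspace_map_upt[OF _ _ poly_value]) (intro pspace_intros n1 shift)+
  qed
  let ?K = "\<lambda>c. (n c + 2) * n c ^ (n c + 1)"
  have K: "pspace ?K" by (intro pspace_intros pspace_power n poly_value_add poly_value_const)
  obtain B where B: "poly_length B" "\<And>c j. enc j \<le> ?K c \<Longrightarrow>
    enc (candidate (n c) j) \<le> B c"
    using poly_length_uniform[OF pspace_length_bound[OF cand] poly_length_nat[OF K]]
      by (metis fst_conv snd_conv)
  show ?thesis unfolding search_def
  proof (rule pspace_rec[where G = "\<lambda>c. B c + 1"])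
    show "pspace (\<lambda>z. if P (fst z) (candidate (n (fst z)) (fst (snd z))) \<and>
        (snd (snd z) = None \<or> candidate (n (fst z)) (fst (snd z)) < the (snd (snd z)))
        then Some (candidate (n (fst z)) (fst (snd z))) else snd (snd z))"
      by (intro pspace_intros pspace_subst2[OF P] pspace_subst2[OF cand])
    show "enc (rec_nat None (\<lambda>j b. if P c (candidate (n c) j) \<and>
      (b = None \<or> candidate (n c) j < the b)
        then Some (candidate (n c) j) else b) k) \<le> B c + 1" if "k \<le> ?K c" for c k
      using that
    proof (induction k)
      case (Suc k)
      then show ?case using B(2)[of k c] by (auto simp: enc_option_def)
    qed (simp add: enc_option_def)
    show "poly_length (\<lambda>c. B c + 1)" by (intro poly_length_add poly_length_const B)
  qed (intro K pspace_intros)+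
qed

section \<open>Simple paths and simple cycles\<close>

lemma length_path_edges: "length (path_edges p) = length p - 1"
  by (simp add: path_edges_def)

lemma nth_path_edges: "i < length p - 1 \<Longrightarrow> path_edges p ! i = (p ! i, p ! Suc i)"
  by (simp add: path_edges_def nth_tl)

lemma path_edges_E:
  assumes "e \<in> set (path_edges p)"
  obtains i where "Suc i < length p" "e = (p ! i, p ! Suc i)"
  using assms by (auto simp: in_set_conv_nth length_path_edges nth_path_edges less_diff_conv)

lemma subseq_subset: "subseq xs ys \<Longrightarrow> set xs \<subseteq> set ys"
  by (induction rule: list_emb.induct) auto

lemma cyclic_path_edges: "cyclic_edges (path_edges q) \<longleftrightarrow>
  2 \<le> length q \<and> hd q = last q"
proof -
  have 1: "path_edges q \<noteq> [] \<longleftrightarrow> 2 \<le> length q"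
    using length_path_edges[of q] by (auto simp: Suc_le_eq numeral_2_eq_2 simp flip:
      length_greater_0_conv)
  have 2: "successively (\<lambda>e f. snd e = fst f) (path_edges q)"
    by (auto simp: successively_conv_nth length_path_edges nth_path_edges)
  have 3: "fst (hd (path_edges q)) = hd q" "snd (last (path_edges q)) = last q"
    if "2 \<le> length q"
  proof -
    have "path_edges q \<noteq> []" "q \<noteq> []" using that 1 by auto
    then show "fst (hd (path_edges q)) = hd q" "snd (last (path_edges q)) = last q"
      using that by (auto simp: hd_conv_nth last_conv_nth nth_path_edges length_path_edges
        Suc_diff_Suc numeral_2_eq_2)
  qed
  show ?thesis unfolding cyclic_edges_def using 1 2 3 by auto
qed

lemma path_edges_take: "path_edges (take k p) = take (k - 1) (path_edges p)"
  by (rule nth_equalityI) (auto simp: length_path_edges nth_path_edges)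

lemma path_edges_drop: "path_edges (drop k p) = drop k (path_edges p)"
  by (simp add: path_edges_def drop_zip tl_drop drop_Suc[symmetric])

text \<open>
  The segment between two occurrences of a vertex is a cycle.
\<close>

lemma closed_segment:
  assumes "i < j" "j < length p" "p ! i = p ! j"
  shows "\<exists>es. cyclic_edges es \<and> subseq es (path_edges p) \<and> length es = j - i"
proof -
  let ?q = "take (j - i + 1) (drop i p)"
  have len: "length ?q = j - i + 1" using assms by simp
  have "hd ?q = p ! i" using assms by (simp add: hd_drop_conv_nth)
  moreover have "last ?q = p ! j"
    using assms len by (subst last_conv_nth) (auto simp del: length_take)
  ultimately have "cyclic_edges (path_edges ?q)"
    using assms len by (simp add: cyclic_path_edges)
  moreover have "subseq (path_edges ?q) (path_edges p)"
    unfolding path_edges_take path_edges_drop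
    by (rule subseq_order.order_trans[OF sublist_imp_subseq[OF sublist_take]
          sublist_imp_subseq[OF sublist_drop]])
  ultimately show ?thesis using len length_path_edges[of ?q] by auto
qed

text \<open>
  If each edge raises the position by one modulo \<open>m\<close>, then so does a walk by its
  length. A closed walk thus has a length divisible by \<open>m\<close>.
\<close>

lemma walk_position:
  assumes "\<And>e. e \<in> set es \<Longrightarrow> pos (snd e) mod m =
    (pos (fst e) + 1) mod (m::nat)"
    and "successively (\<lambda>e f. snd e = fst f) es" "es \<noteq> []"
  shows "pos (snd (last es)) mod m = (pos (fst (hd es)) + length es) mod m"
  using assms(3,1,2)
proof (induction es rule: rev_nonempty_induct)
  case (snoc e es)
  have "snd (last es) = fst e" using snoc by (simp add: successively_append_iff)
  then have "pos (snd e) mod m = (pos (snd (last es)) + 1) mod m" using snoc.prems(1)[of e] by simp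
  also have "\<dots> = (pos (fst (hd es)) + length es + 1) mod m"
    using snoc by (metis (no_types, lifting) Un_iff mod_add_left_eq set_append
      successively_append_iff)
  finally show ?case using snoc.hyps by simp
qed simp

lemma position_exists: "distinct p \<Longrightarrow> \<exists>pos. \<forall>i<length p. pos (p !
  i) = (i::nat)"
  by (rule exI[of _ "\<lambda>x. THE i. i < length p \<and> p ! i = x"])
    (auto simp: nth_eq_iff_index_eq intro!: the_equality)

text \<open>
  If the vertices are distinct, every edge of the path raises the position of the vertex on the
  path, so that no sequence of these edges can be closed, whether contiguous or not. A repeated
  vertex, on the other hand, cuts out a cycle.
\<close>

lemma simple_path_iff: "simple_path A p \<longleftrightarrow> is_path A p \<and> distinct p"
proof -
  have "distinct p" if "\<not> (\<exists>es. cyclic_edges es \<and> subseq es (path_edges p))"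
    unfolding distinct_conv_nth using that closed_segment[of _ _ p]
    by (metis linorder_neqE_nat)
  moreover have False if p: "distinct p" and es: "cyclic_edges es" "subseq es (path_edges p)" for es
  proof -
    obtain pos where pos: "\<And>i. i < length p \<Longrightarrow> pos (p ! i) = i"
      using position_exists[OF p] by blast
    have sub: "set es \<subseteq> set (path_edges p)"
      using es(2) by (rule subseq_subset)
    \<comment> \<open>A modulus so large that the congruence of positions is an equality.\<close>
    let ?m = "length p + length es"
    have step: "pos (snd e) = pos (fst e) + 1" if "e \<in> set es" for e
    proof -
      have "e \<in> set (path_edges p)" using that sub by blast
      then obtain i where "Suc i < length p" "e = (p ! i, p ! Suc i)" by (rule path_edges_E)
      then show ?thesis using pos[of i] pos[of "Suc i"] by simp
    qed
    have "pos (snd (last es)) mod ?m = (pos (fst (hd es)) + length es) mod ?m"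
      using es(1) step by (intro walk_position) (auto simp: cyclic_edges_def)
    moreover have "pos (fst (hd es)) < length p" 
    proof -
      have "hd es \<in> set (path_edges p)" using es(1) sub by (auto simp: cyclic_edges_def)
      then obtain i where "Suc i < length p" "hd es = (p ! i, p ! Suc i)" by (rule path_edges_E)
      then show ?thesis using pos[of i] by simp
    qed
    ultimately show False using es(1) by (auto simp: cyclic_edges_def)
  qed
  ultimately show ?thesis unfolding simple_path_def by blast
qed

text \<open>
  Positions on the cycle count modulo its length \<open>m\<close>, and every edge raises them by
  one. A cycle made of edges of \<open>c\<close> has a length divisible by \<open>m\<close>, hence
  cannot be a proper subsequence of the \<open>m\<close> edges of \<open>c\<close>.
\<close>

lemma simple_cycle_iff:
  "simple_cycle A c \<longleftrightarrow> is_path A c \<and> 2 \<le> length c \<and>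
    hd c = last c \<and> distinct (tl c)"
proof -
  let ?m = "length c - 1"
  have 1: "distinct (tl c)" if "\<not> (\<exists>es. cyclic_edges es \<and>
    strict_subseq es (path_edges c))" "2 \<le> length c"
  proof (rule ccontr)
    assume "\<not> distinct (tl c)"
    then obtain i j where ij: "i < j" "j < length (tl c)" "tl c ! i = tl c ! j"
      unfolding distinct_conv_nth by (metis linorder_neqE_nat)
    moreover have "Suc j < length c" using ij(2) by simp
    ultimately obtain es where es: "cyclic_edges es" "subseq es (path_edges c)" "length es = j - i"
      using closed_segment[of "Suc i" "Suc j" c] by (auto simp: nth_tl)
    have "es \<noteq> path_edges c" using es(3) ij length_path_edges[of c] by auto
    with es that(1) show False by (auto simp: strict_subseq_def subseq_order.less_le)
  qed
  have 2: False if c: "distinct (tl c)" "2 \<le> length c" "hd c = last c"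
    and es: "cyclic_edges es" "strict_subseq es (path_edges c)" for es
  proof -
    obtain pos where pos: "\<And>i. i < length (tl c) \<Longrightarrow> pos (tl c ! i) = i"
      using position_exists[OF c(1)] by blast
    have pos': "pos (c ! i) mod ?m = (i + ?m - 1) mod ?m" if "i < length c" for i
    proof (cases i)
      case 0
      have "c ! 0 = tl c ! (?m - 1)"
      proof -
        have "c \<noteq> []" "?m - 1 < length (tl c)" "Suc (?m - 1) = ?m" using c(2) by auto
        moreover from this have "c ! 0 = c ! ?m" using c(3) hd_conv_nth last_conv_nth by metis
        ultimately show ?thesis by (simp only: nth_tl)
      qed
      then show ?thesis using 0 pos[of "?m - 1"] c(2) by simp
    next
      case (Suc k)
      then have "c ! i = tl c ! k" using that by (simp add: nth_tl)
      moreover have "i + ?m - 1 = k + ?m" "k < ?m" using Suc that by auto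
      ultimately show ?thesis using pos[of k] by (simp only: mod_add_self2 length_tl)
    qed
    have sub: "subseq es (path_edges c)" "es \<noteq> path_edges c"
      using es(2) by (auto simp: subseq_order.less_le)
    then have set: "set es \<subseteq> set (path_edges c)" by (intro subseq_subset)
    have step: "pos (snd e) mod ?m = (pos (fst e) + 1) mod ?m" if "e \<in> set es" for e
    proof -
      have "e \<in> set (path_edges c)" using that set by blast
      then obtain i where i: "Suc i < length c" "e = (c ! i, c ! Suc i)" by (rule path_edges_E)
      have "(pos (c ! i) + 1) mod ?m = (i + ?m - 1 + 1) mod ?m"
        using pos'[of i] i(1) by (intro mod_add_cong) auto
      also have "i + ?m - 1 + 1 = Suc i + ?m - 1" using c(2) by simp
      also have "\<dots> mod ?m = pos (c ! Suc i) mod ?m"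
        using pos'[of "Suc i"] i(1) by simp
      finally show ?thesis using i(2) by simp
    qed
    have "pos (snd (last es)) mod ?m = (pos (fst (hd es)) + length es) mod ?m"
      using es(1) step by (intro walk_position) (auto simp: cyclic_edges_def)
    moreover have "fst (hd es) = snd (last es)" "es \<noteq> []" using es(1)
      by (auto simp: cyclic_edges_def)
    ultimately have "?m dvd length es"
      by (metis add_cancel_right_right mod_eq_dvd_iff_nat diff_add_inverse le_add1)
    then have "?m \<le> length es" using \<open>es \<noteq> []\<close> by (intro dvd_imp_le) auto
    then show False
      using sub length_path_edges[of c] list_emb_length[OF sub(1)]
      by (metis le_antisym subseq_same_length)
  qed
  show ?thesis
    unfolding simple_cycle_def cyclic_path_edges using 1 2 by blast
qed

lemma weight_eq_prod: "weight A p = (\<Prod>i<length p - 1. A $$ (p ! i, p ! Suc i))"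
  by (simp add: weight_def prod.list_conv_set_nth length_path_edges nth_path_edges atLeast0LessThan)

section \<open>One step of the algorithm\<close>

text \<open>
  From here to \<open>coded_step\<close> the algorithm is restated in terms of the number
  \<open>X\<close> of the input instead of the matrices, with list and matrix accesses that are
  total. The offset \<open>k\<close> is 0 for the matrix \<open>A\<close> and the dimension for
  \<open>B\<close>.
\<close>

definition entry_weight :: "nat \<Rightarrow> nat \<Rightarrow> nat list \<Rightarrow> int" where
  "entry_weight X k p = (\<Prod>i<length p - 1. entry X (k + nth_or_0 p i) (nth_or_0 p (Suc i)))"

definition entry_reduced :: "nat \<Rightarrow> nat list \<Rightarrow> int" where
  "entry_reduced X p = entry_weight X 0 p div gcd (entry_weight X 0 p) \<bar>entry_weight X (dim
    X) p\<bar>"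

definition coded_path :: "nat \<Rightarrow> nat list \<Rightarrow> bool" where
  "coded_path X p \<longleftrightarrow> p \<noteq> [] \<and>
    (\<forall>i<length p. nth_or_0 p i < dim X) \<and>
     (\<forall>i<length p - 1. entry X (nth_or_0 p i) (nth_or_0 p (Suc i)) \<noteq> 0)"

definition coded_simple_path :: "nat \<Rightarrow> nat \<Rightarrow> nat list \<Rightarrow> bool"
  where
  "coded_simple_path X v p \<longleftrightarrow> coded_path X p \<and>
    (\<forall>j<length p. \<forall>i<j. nth_or_0 p i \<noteq> nth_or_0 p j) \<and> nth_or_0 p 0 = v"

definition coded_simple_cycle :: "nat \<Rightarrow> nat \<Rightarrow> nat list \<Rightarrow> bool"
  where
  "coded_simple_cycle X v p \<longleftrightarrow> coded_path X p \<and> 2 \<le> length p \<and>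
    nth_or_0 p 0 = nth_or_0 p (length p - 1) \<and>
     (\<forall>j<length p. \<forall>i<j. 0 < i \<longrightarrow> nth_or_0 p i \<noteq> nth_or_0 p
       j) \<and> nth_or_0 p 0 = v"

definition coded_faithful_path :: "nat \<Rightarrow> nat \<Rightarrow> nat list \<Rightarrow>
  bool" where
  "coded_faithful_path X v p \<longleftrightarrow> coded_simple_path X v p \<and>
    entry_weight X (dim X) p \<noteq> 0"

definition coded_nonzero_cycle :: "nat \<Rightarrow> nat \<Rightarrow> nat list \<Rightarrow>
  bool" where
  "coded_nonzero_cycle X v p \<longleftrightarrow> coded_simple_cycle X v p \<and>
    entry_weight X (dim X) p \<noteq> 0"

definition coded_prefix :: "nat list \<Rightarrow> nat list \<Rightarrow> bool" where
  "coded_prefix c p \<longleftrightarrow> p \<noteq> [] \<and> length p \<le> length c \<and>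
    (\<forall>i<length p. nth_or_0 p i = nth_or_0 c i)"

definition first_list :: "nat \<Rightarrow> (nat list \<Rightarrow> bool) \<Rightarrow> nat list
  option" where
  "first_list X P = search (dim X) P"

definition next_list :: "nat \<Rightarrow> (nat list \<Rightarrow> bool) \<Rightarrow> nat list
  \<Rightarrow> nat list option" where
  "next_list X P x = search (dim X) (\<lambda>p. P p \<and> x < p)"

definition coded_next_v :: "nat \<Rightarrow> state \<Rightarrow> state" where
  "coded_next_v X s = s\<lparr>var_v := if Suc (the (var_v s)) < dim X then Some (Suc (the (var_v
    s))) else None,
     pc := For_v\<rparr>"

definition coded_next_c :: "nat \<Rightarrow> state \<Rightarrow> state" where
  "coded_next_c X s = s\<lparr>var_c := next_list X (coded_nonzero_cycle X (the (var_v s))) (the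
    (var_c s)), pc := For_c\<rparr>"

definition coded_step :: "halt_place \<Rightarrow> nat \<Rightarrow> state \<Rightarrow> state"
  where
  "coded_step h X s = (case pc s of
     Start \<Rightarrow> s\<lparr>var_v := Some 0, pc := For_v\<rparr>
   | For_v \<Rightarrow> (if var_v s = None then s\<lparr>pc := Return_YES\<rparr> else
     s\<lparr>pc := Call_Order Condition\<rparr>)
   | Call_Order k \<Rightarrow> s\<lparr>var_fp := first_list X (coded_faithful_path X (the (var_v
     s))), pc := Faithful_For_p k\<rparr>
   | Faithful_For_p k \<Rightarrow> (if var_fp s = None
       then s\<lparr>var_oN := 1, var_op := first_list X (coded_faithful_path X (the (var_v s))),
         pc := Order_For_p k\<rparr>
       else s\<lparr>var_fc := first_list X (coded_simple_cycle X (nth_or_0 (the (var_fp s))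
         (length (the (var_fp s)) - 1))),
              pc := Faithful_For_c k\<rparr>)
   | Faithful_For_c k \<Rightarrow> (if var_fc s = None
       then s\<lparr>var_fp := next_list X (coded_faithful_path X (the (var_v s))) (the (var_fp
         s)), pc := Faithful_For_p k\<rparr>
       else if \<not> (entry_weight X 0 (the (var_fc s)) =
         0 \<or> entry_weight X 0 (the (var_fc s)) dvd entry_weight X (dim X) (the (var_fc s)))
       then s\<lparr>var_oN := 0, pc := Order_Done k\<rparr>
       else s\<lparr>var_fc := next_list X (coded_simple_cycle X (nth_or_0 (the (var_fp s))
         (length (the (var_fp s)) - 1)))
                 (the (var_fc s))\<rparr>)
   | Order_For_p k \<Rightarrow> (if var_op s = None then s\<lparr>pc := Order_Done k\<rparr>
       else s\<lparr>var_oN := lcm (var_oN s) (entry_reduced X (the (var_op s))),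
              var_op := next_list X (coded_faithful_path X (the (var_v s))) (the (var_op
              s))\<rparr>)
   | Order_Done k \<Rightarrow> (if k = Condition
       then if var_oN s \<noteq> 0 then s\<lparr>pc := Call_Order Assignment\<rparr> else
         coded_next_v X s
       else s\<lparr>var_N := var_oN s, var_c := first_list X (coded_nonzero_cycle X (the (var_v
         s))), pc := For_c\<rparr>)
   | For_c \<Rightarrow> (if var_c s = None then coded_next_v X s
       else s\<lparr>var_r := 1, var_c' := first_list X (coded_prefix (the (var_c s))),
         pc := Stable_For_prefix\<rparr>)
   | Stable_For_prefix \<Rightarrow> (if var_c' s = None
       then s\<lparr>var_M := var_N s div var_r s, pc := Stable_Set_k\<rparr>
       else s\<lparr>var_r := lcm (var_r s) (entry_reduced X (the (var_c' s))),
              var_c' := next_list X (coded_prefix (the (var_c s))) (the (var_c' s))\<rparr>)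
   | Stable_Set_k \<Rightarrow>
       s\<lparr>var_k := var_M s div gcd (var_M s) (entry_weight X (dim X) (the (var_c s)) div
         entry_weight X 0 (the (var_c s))),
         pc := Stable_Set_s\<rparr>
   | Stable_Set_s \<Rightarrow> s\<lparr>var_s := var_k s, pc := Stable_While\<rparr>
   | Stable_While \<Rightarrow>
       (if var_s s \<noteq> var_s s div gcd (var_s s) (var_M s div var_s s)
        then s\<lparr>var_s := var_s s div gcd (var_s s) (var_M s div var_s s)\<rparr>
        else s\<lparr>pc := Stable_Set_n\<rparr>)
   | Stable_Set_n \<Rightarrow> s\<lparr>var_n := var_M s div var_s s, pc := Stable_Set_K\<rparr>
   | Stable_Set_K \<Rightarrow>
       s\<lparr>var_K := var_M s div var_n s, var_q := first_list X (coded_simple_path X (the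
         (var_v s))), pc := For_q\<rparr>
   | For_q \<Rightarrow> (if var_q s = None
       then if h = In_Loop then coded_next_c X s else s\<lparr>pc := Return_NO\<rparr>
       else if entry_reduced X (the (var_q s)) = var_K s then coded_next_c X s
       else if h = In_Loop then s\<lparr>pc := Return_NO\<rparr>
       else s\<lparr>var_q := next_list X (coded_simple_path X (the (var_v s))) (the (var_q
         s))\<rparr>)
   | Return_YES \<Rightarrow> s
   | Return_NO \<Rightarrow> s)"

lemma pspace_entry_weight [pspace_intros]:
  assumes "pspace X" "pspace k" "pspace p"
  shows "pspace (\<lambda>c. entry_weight (X c) (k c) (p c))"
  unfolding entry_weight_def
proof (rule pspace_int_prod)
  show "pspace (\<lambda>z. entry (X (fst z)) (k (fst z) + nth_or_0 (p (fst z)) (snd z)) (nth_or_0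
    (p (fst z)) (Suc (snd z))))"
    by (intro pspace_intros pspace_comp[OF _ assms(1)] pspace_comp[OF _ assms(2)] pspace_comp[OF _
      assms(3)])
  show "poly_value (\<lambda>c. length (p c) - 1)"
    by (rule poly_value_mono[OF poly_value_length[OF assms(3)]]) simp
qed (intro pspace_intros assms)

lemma pspace_entry_reduced [pspace_intros]: "pspace X \<Longrightarrow> pspace p \<Longrightarrow>
  pspace (\<lambda>c. entry_reduced (X c) (p c))"
  unfolding entry_reduced_def by (intro pspace_intros)

lemma pspace_coded_path [pspace_intros]:
  assumes "pspace X" "pspace p"
  shows "pspace (\<lambda>c. coded_path (X c) (p c))"
  unfolding coded_path_def
  by (intro pspace_intros assms pspace_comp[OF _ assms(1)] pspace_comp[OF _ assms(2)])

lemma pspace_coded_simple_path [pspace_intros]: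
  assumes "pspace X" "pspace v" "pspace p"
  shows "pspace (\<lambda>c. coded_simple_path (X c) (v c) (p c))"
  unfolding coded_simple_path_def by (intro pspace_intros assms pspace_comp[OF _ assms(3)])

lemma pspace_coded_simple_cycle [pspace_intros]:
  assumes "pspace X" "pspace v" "pspace p"
  shows "pspace (\<lambda>c. coded_simple_cycle (X c) (v c) (p c))"
  unfolding coded_simple_cycle_def by (intro pspace_intros assms pspace_comp[OF _ assms(3)])

lemma pspace_coded_faithful_path [pspace_intros]: "pspace X \<Longrightarrow>
  pspace v \<Longrightarrow> pspace p \<Longrightarrow> pspace (\<lambda>c. coded_faithful_path (X
    c) (v c) (p c))"
  unfolding coded_faithful_path_def by (intro pspace_intros)

lemma pspace_coded_nonzero_cycle [pspace_intros]: "pspace X \<Longrightarrow>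
  pspace v \<Longrightarrow> pspace p \<Longrightarrow> pspace (\<lambda>c. coded_nonzero_cycle (X
    c) (v c) (p c))"
  unfolding coded_nonzero_cycle_def by (intro pspace_intros)

lemma pspace_coded_prefix [pspace_intros]:
  assumes "pspace c" "pspace p"
  shows "pspace (\<lambda>a. coded_prefix (c a) (p a))"
  unfolding coded_prefix_def by (intro pspace_intros assms pspace_comp[OF _ assms(1)]
    pspace_comp[OF _ assms(2)])

lemma pspace_first_list [pspace_intros]:
  assumes "pspace X" "pspace (\<lambda>z. P (fst z) (snd z))"
  shows "pspace (\<lambda>c. first_list (X c) (P c))"
  unfolding first_list_def by (intro pspace_intros assms poly_value_dim)

lemma pspace_next_list [pspace_intros]:
  assumes "pspace X" "pspace (\<lambda>z. P (fst z) (snd z))" "pspace x"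
  shows "pspace (\<lambda>c. next_list (X c) (P c) (x c))"
  unfolding next_list_def by (intro pspace_intros assms poly_value_dim pspace_comp[OF _ assms(3)])

lemma pspace_coded_step: "pspace (\<lambda>z. coded_step h (fst z) (snd z))"
  unfolding coded_step_def coded_next_v_def coded_next_c_def by (intro pspace_intros)

locale katsura =
  fixes A B :: "int mat" and n :: nat
  assumes n_pos: "n \<ge> 1"
    and carrier: "A \<in> carrier_mat n n" "B \<in> carrier_mat n n"
    and nonneg: "\<And>u w. u < n \<Longrightarrow> w < n \<Longrightarrow> A $$ (u, w) \<ge> 0"
begin

abbreviation X :: nat where "X \<equiv> input (A, B)"

lemma dim_X [simp]: "dim X = n"
  using dim_input carrier by simp

lemma dims [simp]: "dim_row A = n" "dim_row B = n"
  using carrier by auto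

lemma nth_or_0_less: "set p \<subseteq> {..<n} \<Longrightarrow> i < length p \<Longrightarrow>
  nth_or_0 p i < n"
  using nth_mem by (fastforce simp: nth_or_0_def)

lemma entry_weight_eq:
  assumes "set p \<subseteq> {..<n}"
  shows "entry_weight X 0 p = weight A p" "entry_weight X n p = weight B p"
  unfolding entry_weight_def weight_eq_prod
  using assms nth_or_0_less entry_input[OF carrier]
  by (auto intro!: prod.cong simp: nth_or_0_def simp del: input_def)

lemma entry_reduced_eq: "set p \<subseteq> {..<n} \<Longrightarrow>
  entry_reduced X p = reduced A B p"
  by (simp add: entry_reduced_def reduced_def entry_weight_eq)

lemma is_path_iff:
  "is_path A p \<longleftrightarrow> p \<noteq> [] \<and> set p \<subseteq> {..<n} \<and>
    (\<forall>i<length p - 1. A $$ (p ! i, p ! Suc i) \<noteq> 0)"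
proof -
  have "set (path_edges p) \<subseteq> simple_graph_edges A \<longleftrightarrow>
    (\<forall>i<length p - 1. A $$ (p ! i, p ! Suc i) \<noteq> 0)"
    if "set p \<subseteq> {..<n}"
  proof -
    have "p ! i < n" if "i < length p" for i
      using \<open>set p \<subseteq> {..<n}\<close> that nth_mem by blast
    then show ?thesis
      unfolding set_conv_nth[of "path_edges p"]
      by (auto simp: length_path_edges nth_path_edges simple_graph_edges_def vertices_def)
  qed
  then show ?thesis by (auto simp: is_path_def vertices_def)
qed

lemma coded_path_eq: "coded_path X p \<longleftrightarrow> is_path A p"
proof -
  have 1: "(\<forall>i<length p. nth_or_0 p i < n) \<longleftrightarrow> set p \<subseteq> {..<n}"
    by (auto simp: nth_or_0_def in_set_conv_nth subset_iff)
  have "(\<forall>i<length p - 1. entry X (nth_or_0 p i) (nth_or_0 p (Suc i)) \<noteq> 0)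
    \<longleftrightarrow>
      (\<forall>i<length p - 1. A $$ (p ! i, p ! Suc i) \<noteq> 0)" if "set p \<subseteq> {..<n}"
    using nth_or_0_less[OF that] entry_input(1)[OF carrier]
      by (auto simp: nth_or_0_def less_diff_conv)
  then show ?thesis unfolding coded_path_def is_path_iff dim_X 1 by blast
qed

lemma coded_simple_path_eq: "coded_simple_path X v p \<longleftrightarrow> p \<in> simple_paths A v"
proof -
  have "(\<forall>j<length p. \<forall>i<j. nth_or_0 p i \<noteq> nth_or_0 p j)
    \<longleftrightarrow> distinct p"
  proof
    assume *: "\<forall>j<length p. \<forall>i<j. nth_or_0 p i \<noteq> nth_or_0 p j"
    have "p ! i \<noteq> p ! j" if "i < j" "j < length p" for i j
      using * that by (simp add: nth_or_0_def)
    then show "distinct p"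
      unfolding distinct_conv_nth by (metis linorder_neqE_nat)
  qed (auto simp: nth_or_0_def nth_eq_iff_index_eq)
  moreover have "nth_or_0 p 0 = hd p" if "p \<noteq> []" using that
    by (simp add: nth_or_0_def hd_conv_nth)
  ultimately show ?thesis
    unfolding coded_simple_path_def coded_path_eq simple_paths_def simple_path_iff mem_Collect_eq
    using is_path_iff[of p] by auto
qed

lemma coded_simple_cycle_eq: "coded_simple_cycle X v p \<longleftrightarrow>
  p \<in> simple_cycles A v"
proof -
  have "(\<forall>j<length p. \<forall>i<j. 0 < i \<longrightarrow> nth_or_0 p i \<noteq> nth_or_0
    p j) \<longleftrightarrow> distinct (tl p)"
  proof
    assume *: "\<forall>j<length p. \<forall>i<j. 0 < i \<longrightarrow> nth_or_0 p i \<noteq>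
      nth_or_0 p j"
    have "tl p ! i \<noteq> tl p ! j" if "i < j" "j < length (tl p)" for i j
      using *[rule_format, of "Suc j" "Suc i"] that by (simp add: nth_or_0_def nth_tl)
    then show "distinct (tl p)"
      unfolding distinct_conv_nth by (metis linorder_neqE_nat)
  next
    assume *: "distinct (tl p)"
    show "\<forall>j<length p. \<forall>i<j. 0 < i \<longrightarrow> nth_or_0 p i \<noteq>
      nth_or_0 p j"
    proof (intro allI impI)
      fix i j assume ij: "j < length p" "i < j" "0 < i"
      then have "tl p ! (i - 1) \<noteq> tl p ! (j - 1)"
        using * by (subst nth_eq_iff_index_eq) auto
      then show "nth_or_0 p i \<noteq> nth_or_0 p j" using ij by (simp add: nth_or_0_def nth_tl)
    qed
  qed
  moreover have "nth_or_0 p 0 = hd p" "nth_or_0 p (length p - 1) = last p" if "p \<noteq> []"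
    using that by (auto simp: nth_or_0_def hd_conv_nth last_conv_nth)
  ultimately show ?thesis
    unfolding coded_simple_cycle_def coded_path_eq simple_cycles_def simple_cycle_iff mem_Collect_eq
    using is_path_iff[of p] by auto
qed

lemma simple_path_short: "simple_path A p \<Longrightarrow> p \<in> short_lists n"
proof -
  assume "simple_path A p"
  then have p: "set p \<subseteq> {..<n}" "distinct p" by (auto simp: simple_path_iff is_path_iff)
  then have "length p \<le> n" by (metis card_lessThan card_mono distinct_card finite_lessThan)
  then show ?thesis using p by (simp add: short_lists_def)
qed

lemma simple_cycle_short: "simple_cycle A p \<Longrightarrow> p \<in> short_lists n"
proof -
  assume "simple_cycle A p"
  then have p: "set p \<subseteq> {..<n}" "distinct (tl p)"
    by (auto simp: simple_cycle_iff is_path_iff)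
  then have "set (tl p) \<subseteq> {..<n}" by (metis list.set_sel(2) subset_iff tl_Nil)
  then have "length (tl p) \<le> n"
    using p(2) by (metis card_lessThan card_mono distinct_card finite_lessThan)
  then show ?thesis using p(1) by (simp add: short_lists_def)
qed

lemma first_list_eq: "{p \<in> short_lists n. P p} = S \<Longrightarrow> first_list X P = first S"
  unfolding first_list_def dim_X search_eq[OF n_pos] by simp

lemma next_list_eq: "{p \<in> short_lists n. P p} = S \<Longrightarrow>
  next_list X P x = next_in S x"
  unfolding next_list_def dim_X search_eq[OF n_pos] next_in_def
    by (rule arg_cong[where f = first]) auto

lemma short_sets:
  "{p \<in> short_lists n. coded_simple_path X v p} = simple_paths A v"
  "{p \<in> short_lists n. coded_simple_cycle X v p} = simple_cycles A v"
  "{p \<in> short_lists n. coded_faithful_path X v p} = faithful_paths A B v"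
  "{p \<in> short_lists n. coded_nonzero_cycle X v p} = nonzero_cycles A B v"
  "c \<in> short_lists n \<Longrightarrow> {p \<in> short_lists n. coded_prefix c p} =
    path_prefixes c"
proof -
  show "{p \<in> short_lists n. coded_simple_path X v p} = simple_paths A v"
    "{p \<in> short_lists n. coded_simple_cycle X v p} = simple_cycles A v"
    using simple_path_short simple_cycle_short
    by (auto simp: coded_simple_path_eq coded_simple_cycle_eq simple_paths_def simple_cycles_def)
  have "coded_faithful_path X v p \<longleftrightarrow> p \<in> faithful_paths A B v"
    if "p \<in> short_lists n" for p
    using that unfolding coded_faithful_path_def coded_simple_path_eq dim_X
    by (auto simp: faithful_paths_def short_lists_def entry_weight_eq)
  then show "{p \<in> short_lists n. coded_faithful_path X v p} = faithful_paths A B v"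
    using simple_path_short by (auto simp: faithful_paths_def simple_paths_def)
  have "coded_nonzero_cycle X v p \<longleftrightarrow> p \<in> nonzero_cycles A B v"
    if "p \<in> short_lists n" for p
    using that unfolding coded_nonzero_cycle_def coded_simple_cycle_eq dim_X
    by (auto simp: nonzero_cycles_def short_lists_def entry_weight_eq)
  then show "{p \<in> short_lists n. coded_nonzero_cycle X v p} = nonzero_cycles A B v"
    using simple_cycle_short by (auto simp: nonzero_cycles_def simple_cycles_def)
  have "coded_prefix c p \<longleftrightarrow> p \<noteq> [] \<and> prefix p c" for p
  proof -
    have "prefix p c \<longleftrightarrow> length p \<le> length c \<and>
      (\<forall>i<length p. nth_or_0 p i = nth_or_0 c i)"
    proof
      assume "length p \<le> length c \<and> (\<forall>i<length p. nth_or_0 p i = nth_or_0 c i)"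
      then have "p = take (length p) c" by (intro nth_equalityI) (auto simp: nth_or_0_def)
      then show "prefix p c" by (metis take_is_prefix)
    qed (auto simp: prefix_def nth_or_0_def nth_append)
    then show ?thesis by (auto simp: coded_prefix_def)
  qed
  moreover have "p \<in> short_lists n" if "prefix p c" "c \<in> short_lists n" for p
    using that set_mono_prefix[OF that(1)] prefix_length_le[OF that(1)]
      by (auto simp: short_lists_def)
  ultimately show "c \<in> short_lists n \<Longrightarrow> {p \<in> short_lists n. coded_prefix c
    p} = path_prefixes c"
    by (auto simp: path_prefixes_def)
qed

lemmas first_list_simps = short_sets[THEN first_list_eq]
lemmas next_list_simps = short_sets[THEN next_list_eq]

lemma first_vertices: "first (vertices A) = Some 0"
proof -
  have "Min {..<n} = 0" using n_pos by (intro Min_eqI) auto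
  moreover have "0 \<in> {..<n}" using n_pos by simp
  ultimately show ?thesis by (auto simp: first_def vertices_def)
qed

lemma next_in_vertices: "next_in (vertices A) v = (if Suc v < n then Some (Suc v) else None)"
proof (cases "Suc v < n")
  case True
  then have "Min {y. y < n \<and> v < y} = Suc v" by (intro Min_eqI) auto
  then show ?thesis using True by (auto simp: next_in_def first_def vertices_def)
next
  case False
  then have "{y. y < n \<and> v < y} = {}" by auto
  then show ?thesis using False by (simp add: next_in_def first_def vertices_def)
qed

end

section \<open>Bounds on the values of the variables\<close>

lemma first_mem: "first S = Some x \<Longrightarrow> finite S \<Longrightarrow> x \<in> S"
  by (metis Min_in first_def option.distinct(1) option.inject)

lemma next_in_mem: "next_in S y = Some x \<Longrightarrow> finite S \<Longrightarrow>
  x \<in> S \<and> y < x"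
  unfolding next_in_def by (drule first_mem) auto

definition remaining :: "'a::linorder set \<Rightarrow> 'a option \<Rightarrow> nat" where
  "remaining S x = (case x of None \<Rightarrow> 0 | Some y \<Rightarrow> Suc (card {z \<in> S. y
    < z}))"

lemma remaining_next_in: "finite S \<Longrightarrow> remaining S (next_in S x) < remaining S (Some
  x)"
proof (cases "next_in S x")
  case (Some y)
  assume S: "finite S"
  with Some have y: "y \<in> S" "x < y" by (auto dest: next_in_mem)
  have "{z \<in> S. y < z} \<subset> {z \<in> S. x < z}" using y by auto
  then have "card {z \<in> S. y < z} < card {z \<in> S. x < z}"
    using S by (intro psubset_card_mono) auto
  then show ?thesis using Some by (simp add: remaining_def)
qed (simp add: remaining_def)

lemma finite_short_lists: "finite (short_lists n)"
  unfolding short_lists_def using finite_lists_length_le[of "{..<n}" "n + 1"] by simp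

lemma finite_path_prefixes: "finite (path_prefixes c)"
proof (rule finite_subset)
  show "path_prefixes c \<subseteq> (\<lambda>k. take k c) ` {..length c}"
  proof
    fix p assume "p \<in> path_prefixes c"
    then have "p = take (length p) c" "length p \<le> length c"
      by (auto simp: path_prefixes_def prefix_def)
    then show "p \<in> (\<lambda>k. take k c) ` {..length c}" by blast
  qed
qed simp

lemma int_div_bounds:
  fixes a b d :: int
  assumes "0 \<le> a" "a \<le> d" "0 \<le> b"
  shows "0 \<le> a div b \<and> a div b \<le> d"
proof -
  have "a div b = int (nat a div nat b)" using assms by (simp add: zdiv_int)
  moreover have "int (nat a div nat b) \<le> int (nat a)"
    by (simp only: of_nat_le_iff div_le_dividend)
  ultimately show ?thesis using assms by simp
qed

lemma nat_less_encode: "v < 2 ^ length (encode_nat v)"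
proof (induction v rule: encode_nat.induct)
  case (1 v)
  show ?case
  proof (cases "v < 2")
    case False
    have "v < 2 * (v div 2 + 1)" by presburger
    also have "\<dots> \<le> 2 * 2 ^ length (encode_nat (v div 2))" using 1[OF False] by simp
    finally show ?thesis using False by (subst encode_nat.simps) simp
  qed (subst encode_nat.simps, simp)
qed

lemma prod_encode_power_le:
  "x \<le> 2 ^ k \<Longrightarrow> y \<le> 2 ^ k \<Longrightarrow>
    prod_encode (x, y) \<le> 2 ^ (2 * k + 4)"
proof -
  assume "x \<le> 2 ^ k" "y \<le> 2 ^ k"
  then have "prod_encode (x, y) \<le> (2 ^ k + 2 ^ k + 1) ^ 2" by (rule prod_encode_le)
  also have "\<dots> \<le> (2 ^ (k + 2)) ^ 2" by (intro power_mono) (auto simp: power_add)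
  also have "\<dots> = 2 ^ ((k + 2) * 2)" by (rule power_mult[symmetric])
  also have "(k + 2) * 2 = 2 * k + 4" by simp
  finally show ?thesis .
qed

text \<open>
  With \<open>k = 3 * (len + 3) ^ 3\<close>, the code of each variable is at most \<open>2 ^
  k\<close>. Pairing leads from \<open>2 ^ k\<close> to at most \<open>2 ^ (2 * k + 4)\<close>, so
  each of the 16 pairings doubles \<open>k + 4\<close>.
\<close>

definition state_size :: "nat poly" where
  "state_size = [:2 ^ 16:] * ([:3, 1:] ^ 3 * [:3:] + [:4:])"

context katsura
begin

lemma finite_sets [simp]:
  "finite (simple_paths A v)" "finite (simple_cycles A v)"
  "finite (faithful_paths A B v)" "finite (nonzero_cycles A B v)"
  using short_sets(1-4)[of v] finite_short_lists[of n]
  by (metis (no_types, lifting) finite_subset mem_Collect_eq subsetI)+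

text \<open>
  A bound for all integer variables of the algorithm. Its length is polynomial, see
  \<open>edge_product_le\<close>.
\<close>

definition edge_product :: int where
  "edge_product = (\<Prod>e | e \<in> {..<n} \<times> {..<n} \<and> A $$ e \<noteq> 0. A $$ e)"

text \<open>
  Simple paths, simple cycles and the prefixes of simple cycles are trails; this is all that the
  bounds on weights depend on.
\<close>

definition trail :: "nat list \<Rightarrow> bool" where
  "trail p \<longleftrightarrow> is_path A p \<and> distinct (path_edges p)"

lemma edge_product_pos: "edge_product > 0"
  unfolding edge_product_def using nonneg by (intro prod_pos) (auto simp: less_le)

text \<open>
  The weight is the product over a set of edges, part of the product over all of them.
\<close>

lemma weight_trail:
  assumes "trail p"
  shows "weight A p dvd edge_product" "weight A p > 0"
proof -
  let ?S = "{e. e \<in> {..<n} \<times> {..<n} \<and> A $$ e \<noteq> 0}"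
  have sub: "set (path_edges p) \<subseteq> ?S"
    using assms by (auto simp: trail_def is_path_def simple_graph_edges_def vertices_def)
  have eq: "weight A p = (\<Prod>e\<in>set (path_edges p). A $$ e)"
    using assms unfolding weight_def trail_def by (simp add: prod.distinct_set_conv_list)
  have "finite ?S" by (rule finite_subset[of _ "{..<n} \<times> {..<n}"]) auto
  with sub show "weight A p dvd edge_product"
    unfolding eq edge_product_def by (intro prod_dvd_prod_subset)
  show "weight A p > 0"
    unfolding eq using sub nonneg by (intro prod_pos) (force simp: less_le)
qed

lemma reduced_trail:
  assumes "trail p"
  shows "reduced A B p dvd edge_product"
proof -
  have "reduced A B p dvd weight A p"
    unfolding reduced_def by (metis dvd_div_mult_self dvd_triv_left gcd_dvd1)
  then show ?thesis using weight_trail[OF assms] by (metis dvd_trans)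
qed

lemma simple_path_trail: "simple_path A p \<Longrightarrow> trail p"
  by (auto simp: simple_path_iff trail_def path_edges_def intro: distinct_zipI1)

lemma prefix_trail:
  assumes "simple_cycle A c" "p \<in> path_prefixes c"
  shows "trail p"
proof -
  obtain k where k: "p = take k c" "p \<noteq> []"
  proof
    show "p = take (length p) c" "p \<noteq> []"
      using assms(2) by (auto simp: path_prefixes_def prefix_def)
  qed
  have c: "is_path A c" "distinct (path_edges c)"
    using assms(1) by (auto simp: simple_cycle_iff path_edges_def intro: distinct_zipI2)
  have "set p \<subseteq> set c" "set (path_edges p) \<subseteq> set (path_edges c)"
    unfolding k path_edges_take by (rule set_take_subset)+
  moreover have "distinct (path_edges p)" unfolding k path_edges_take using c(2) by simp
  ultimately show ?thesis using c(1) k(2) by (auto simp: trail_def is_path_def)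
qed

section \<open>An invariant and termination\<close>

text \<open>
  Paths and cycles have to be simple to be short and to have weights that divide
  \<open>edge_product\<close>. A quotient of nonnegative integers, exact or not, never exceeds the
  dividend, which takes care of the other integers.
\<close>

definition values_ok :: "state \<Rightarrow> bool" where
  "values_ok s \<longleftrightarrow>
     (\<forall>v. var_v s = Some v \<longrightarrow> v < n) \<and>
     (\<forall>p. var_fp s = Some p \<longrightarrow> p \<in> short_lists n \<and>
       p \<noteq> []) \<and>
     (\<forall>c. var_fc s = Some c \<longrightarrow> c \<in> short_lists n) \<and>
     (\<forall>p. var_op s = Some p \<longrightarrow> simple_path A p) \<and>
     (\<forall>c. var_c s = Some c \<longrightarrow> simple_cycle A c) \<and>
     (\<forall>p. var_c' s = Some p \<longrightarrow> (\<exists>c. simple_cycle A c \<and>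
       p \<in> path_prefixes c)) \<and>
     (\<forall>q. var_q s = Some q \<longrightarrow> simple_path A q) \<and>
     {var_oN s, var_N s, var_r s, var_M s, var_k s, var_s s, var_n s,
       var_K s} \<subseteq> {0..edge_product}"

text \<open>
  Loop variables have a value inside their loops. The two variables that accumulate least common
  multiples need more than a bound: a least common multiple of divisors of
  \<open>edge_product\<close> is again one, but is not bounded in terms of bounds.
\<close>

fun line_ok :: "line \<Rightarrow> state \<Rightarrow> bool" where
  "line_ok (Faithful_For_c k) s \<longleftrightarrow> var_v s \<noteq> None \<and>
    var_fp s \<noteq> None"
| "line_ok (Order_For_p k) s \<longleftrightarrow> var_v s \<noteq> None \<and>
  var_oN s dvd edge_product"
| "line_ok Stable_For_prefix s \<longleftrightarrow> var_v s \<noteq> None \<and>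
  var_c s \<noteq> None \<and> var_r s dvd edge_product"
| "line_ok (Call_Order k) s \<longleftrightarrow> var_v s \<noteq> None"
| "line_ok (Faithful_For_p k) s \<longleftrightarrow> var_v s \<noteq> None"
| "line_ok (Order_Done k) s \<longleftrightarrow> var_v s \<noteq> None"
| "line_ok For_c s \<longleftrightarrow> var_v s \<noteq> None"
| "line_ok Stable_Set_k s \<longleftrightarrow> var_v s \<noteq> None \<and> var_c s \<noteq> None"
| "line_ok Stable_Set_s s \<longleftrightarrow> var_v s \<noteq> None \<and> var_c s \<noteq> None"
| "line_ok Stable_While s \<longleftrightarrow> var_v s \<noteq> None \<and> var_c s \<noteq> None"
| "line_ok Stable_Set_n s \<longleftrightarrow> var_v s \<noteq> None \<and> var_c s \<noteq> None"
| "line_ok Stable_Set_K s \<longleftrightarrow> var_v s \<noteq> None \<and> var_c s \<noteq> None"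
| "line_ok For_q s \<longleftrightarrow> var_v s \<noteq> None \<and> var_c s \<noteq> None"
| "line_ok _ s \<longleftrightarrow> True"

definition state_ok :: "state \<Rightarrow> bool" where
  "state_ok s \<longleftrightarrow> values_ok s \<and> line_ok (pc s) s"

lemma state_ok_initial: "state_ok initial_state"
  using edge_product_pos by (simp add: state_ok_def values_ok_def initial_state_def)

lemma last_nth_or_0: "p \<noteq> [] \<Longrightarrow> nth_or_0 p (length p - 1) = last p"
  by (simp add: nth_or_0_def last_conv_nth)

text \<open>
  The invariant ensures that matrices and lists are accessed inside of their ranges.
\<close>

lemma coded_step_eq:
  assumes "state_ok s"
  shows "coded_step h X s = alg5_step A B h s"
proof -
  have short: "set p \<subseteq> {..<n}" if "p \<in> short_lists n" for p
    using that by (simp add: short_lists_def)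
  have val: "values_ok s" and line: "line_ok (pc s) s"
    using assms by (auto simp: state_ok_def)
  note simps = coded_step_def alg5_step_def first_list_simps next_list_simps first_vertices
    next_in_vertices
    coded_next_v_def next_v_def coded_next_c_def next_c_def Let_def
  have prefix: "p \<in> short_lists n" if "var_c' s = Some p" for p
  proof -
    obtain c where c: "simple_cycle A c" "p \<in> path_prefixes c"
      using val \<open>var_c' s = Some p\<close> by (auto simp: values_ok_def)
    then show ?thesis using short_sets(5)[OF simple_cycle_short[OF c(1)]] by blast
  qed
  show ?thesis
  proof (cases "pc s")
    case (Faithful_For_p k)
    show ?thesis
    proof (cases "var_fp s")
      case (Some p)
      then have "p \<noteq> []" using val by (simp add: values_ok_def)
      then show ?thesis using Faithful_For_p Some last_nth_or_0[of p] by (simp add: simps)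
    qed (use Faithful_For_p in \<open>simp add: simps\<close>)
  next
    case (Faithful_For_c k)
    then obtain p where p: "var_fp s = Some p" using line by auto
    then have p': "p \<noteq> []" using val by (simp add: values_ok_def)
    show ?thesis
    proof (cases "var_fc s")
      case (Some c)
      then have c: "set c \<subseteq> {..<n}" using val short by (simp add: values_ok_def)
      show ?thesis
        using Faithful_For_c p Some last_nth_or_0[OF p'] entry_weight_eq[OF c]
        by (simp add: simps of_int_div_of_int_in_Ints_iff)
    qed (use Faithful_For_c p in \<open>simp add: simps\<close>)
  next
    case (Order_For_p k)
    show ?thesis
    proof (cases "var_op s")
      case (Some p)
      then have "set p \<subseteq> {..<n}" using val short simple_path_short
        by (simp add: values_ok_def)
      then show ?thesis using Order_For_p Some entry_reduced_eq by (simp add: simps)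
    qed (use Order_For_p in \<open>simp add: simps\<close>)
  next
    case (Order_Done k)
    then show ?thesis by (cases k) (simp_all add: simps)
  next
    case For_c
    show ?thesis
    proof (cases "var_c s")
      case (Some c)
      then have "c \<in> short_lists n" using val simple_cycle_short by (simp add: values_ok_def)
      then show ?thesis using For_c Some by (simp add: simps)
    qed (use For_c in \<open>simp add: simps\<close>)
  next
    case Stable_For_prefix
    then obtain c where c: "var_c s = Some c" using line by auto
    then have c': "c \<in> short_lists n" using val simple_cycle_short by (simp add: values_ok_def)
    show ?thesis
    proof (cases "var_c' s")
      case (Some p)
      then show ?thesis using Stable_For_prefix c c' entry_reduced_eq[OF short[OF prefix[OF
        Some]]] by (simp add: simps)
    qed (use Stable_For_prefix in \<open>simp add: simps\<close>)
  next
    case Stable_Set_k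
    then obtain c where c: "var_c s = Some c" using line by auto
    then have c': "c \<in> short_lists n" using val simple_cycle_short by (simp add: values_ok_def)
    then show ?thesis using Stable_Set_k c entry_weight_eq[OF short[OF c']] by (simp add: simps)
  next
    case For_q
    show ?thesis
    proof (cases "var_q s")
      case (Some p)
      then have "set p \<subseteq> {..<n}" using val short simple_path_short
        by (simp add: values_ok_def)
      then show ?thesis using For_q Some entry_reduced_eq by (cases h) (simp_all add: simps)
    qed (use For_q in \<open>cases h, simp_all add: simps\<close>)
  qed (use line in \<open>auto simp: simps split: option.split\<close>)
qed

text \<open>
  The stages of one pass of the outer loop, counted down. The procedure Order runs twice.
\<close>

definition stage :: "line \<Rightarrow> nat" where
  "stage l = (case l of For_v \<Rightarrow> 12
     | Call_Order k \<Rightarrow> if k = Condition then 11 else 7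
     | Faithful_For_p k \<Rightarrow> if k = Condition then 10 else 6
     | Faithful_For_c k \<Rightarrow> if k = Condition then 10 else 6
     | Order_For_p k \<Rightarrow> if k = Condition then 9 else 5
     | Order_Done k \<Rightarrow> if k = Condition then 8 else 4
     | _ \<Rightarrow> 3)"

definition substage :: "line \<Rightarrow> nat" where
  "substage l = (case l of Faithful_For_p k \<Rightarrow> 1 | Faithful_For_c k \<Rightarrow> 0
     | For_c \<Rightarrow> 9 | Stable_For_prefix \<Rightarrow> 8 | Stable_Set_k \<Rightarrow> 7 |
       Stable_Set_s \<Rightarrow> 6
     | Stable_While \<Rightarrow> 5 | Stable_Set_n \<Rightarrow> 4 | Stable_Set_K \<Rightarrow> 3
       | For_q \<Rightarrow> 2 | _ \<Rightarrow> 0)"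

definition vertices_left :: "state \<Rightarrow> nat" where
  "vertices_left s = (case pc s of Start \<Rightarrow> n + 3 | Return_YES \<Rightarrow> 0 |
    Return_NO \<Rightarrow> 0
     | _ \<Rightarrow> (case var_v s of None \<Rightarrow> 1 | Some v \<Rightarrow> n - v + 1))"

definition outer_left :: "state \<Rightarrow> nat" where
  "outer_left s = (let v = the (var_v s) in case pc s of
       Faithful_For_p k \<Rightarrow> remaining (faithful_paths A B v) (var_fp s)
     | Faithful_For_c k \<Rightarrow> remaining (faithful_paths A B v) (var_fp s)
     | Order_For_p k \<Rightarrow> remaining (faithful_paths A B v) (var_op s)
     | _ \<Rightarrow> remaining (nonzero_cycles A B v) (var_c s))"

definition inner_left :: "state \<Rightarrow> nat" where
  "inner_left s = (case pc s of
       Faithful_For_c k \<Rightarrow> remaining (simple_cycles A (last (the (var_fp s)))) (var_fc s)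
     | Stable_For_prefix \<Rightarrow> remaining (path_prefixes (the (var_c s))) (var_c' s)
     | Stable_While \<Rightarrow> nat (var_s s)
     | For_q \<Rightarrow> remaining (simple_paths A (the (var_v s))) (var_q s)
     | _ \<Rightarrow> 0)"

text \<open>
  A lexicographic measure: the remaining vertices, the stage within the pass for the current
  vertex, the remaining values of the loop around, the place within its body, and the remaining
  values of the loop inside. For the while loop the latter is the value of \<open>s\<close>, which
  each pass divides by a number greater than 1.
\<close>

definition progress :: "(state \<times> state) set" where
  "progress = measures [vertices_left, \<lambda>s. stage (pc s), outer_left,
    \<lambda>s. substage (pc s), inner_left]"

lemma simple_paths_D: "p \<in> simple_paths A v \<Longrightarrow> simple_path A p"
  and simple_cycles_D: "p \<in> simple_cycles A v \<Longrightarrow> simple_cycle A p"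
  and faithful_paths_D: "p \<in> faithful_paths A B v \<Longrightarrow> simple_path A p"
  and nonzero_cycles_D: "p \<in> nonzero_cycles A B v \<Longrightarrow> simple_cycle A p"
  by (auto simp: simple_paths_def simple_cycles_def faithful_paths_def nonzero_cycles_def)

lemma simple_path_nonempty: "simple_path A p \<Longrightarrow> p \<noteq> []"
  by (simp add: simple_path_def is_path_def)

lemma lcm_edge_product:
  "a dvd edge_product \<Longrightarrow> b dvd edge_product \<Longrightarrow>
   lcm a b dvd edge_product \<and> 0 \<le> lcm a b \<and> lcm a b \<le> edge_product" for a b :: int
  using edge_product_pos by (auto intro: zdvd_imp_le)

lemma values_ok_next_v: "values_ok s \<Longrightarrow> values_ok (next_v A s)"
  by (auto simp: values_ok_def next_v_def next_in_vertices)

lemma values_ok_next_c: "values_ok s \<Longrightarrow> values_ok (next_c A B s)"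
  by (auto simp: values_ok_def next_c_def dest!: next_in_mem nonzero_cycles_D)

lemma state_ok_step:
  assumes "state_ok s"
  shows "state_ok (alg5_step A B h s)"
proof -
  have val: "values_ok s" and line: "line_ok (pc s) s"
    using assms by (auto simp: state_ok_def)
  note mem = first_mem next_in_mem
  note D = simple_paths_D simple_cycles_D faithful_paths_D nonzero_cycles_D
  note short = simple_path_short simple_cycle_short simple_path_nonempty
  have nonempty [simp]: "\<not> simple_path A []" by (simp add: simple_path_def is_path_def)
  note nv = values_ok_next_v[OF val] and nc = values_ok_next_c[OF val]
  show ?thesis
  proof (cases "pc s")
    case Start
    then show ?thesis using val n_pos
      by (simp add: state_ok_def alg5_step_def first_vertices values_ok_def)
  next
    case For_v
    then show ?thesis using val
      by (auto simp: state_ok_def alg5_step_def values_ok_def split: option.split)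
  next
    case (Call_Order k)
    then show ?thesis using val line
      by (auto simp: state_ok_def alg5_step_def values_ok_def Let_def dest!: mem D intro: short)
  next
    case (Faithful_For_p k)
    then show ?thesis using val line edge_product_pos
      by (auto simp: state_ok_def alg5_step_def values_ok_def Let_def split: option.split
          dest!: first_mem D simple_cycle_short)
  next
    case (Faithful_For_c k)
    then show ?thesis using val line edge_product_pos
      by (auto simp: state_ok_def alg5_step_def values_ok_def Let_def split: option.split
          dest!: next_in_mem D intro: short)
  next
    case (Order_For_p k)
    show ?thesis
    proof (cases "var_op s")
      case (Some p)
      then have "trail p" using val simple_path_trail by (simp add: values_ok_def)
      then have "lcm (var_oN s) (reduced A B p) dvd edge_product \<and>
          0 \<le> lcm (var_oN s) (reduced A B p) \<and>
            lcm (var_oN s) (reduced A B p) \<le> edge_product"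
        using line Order_For_p reduced_trail by (intro lcm_edge_product) auto
      then show ?thesis using val line Order_For_p Some
        by (auto simp: state_ok_def alg5_step_def values_ok_def Let_def dest!: next_in_mem D)
    qed (use val line Order_For_p in \<open>auto simp: state_ok_def alg5_step_def
      values_ok_def\<close>)
  next
    case (Order_Done k)
    show ?thesis
    proof (cases k)
      case Condition
      then show ?thesis using val line Order_Done nv
        by (auto simp: state_ok_def alg5_step_def values_ok_def next_v_def)
    next
      case Assignment
      then show ?thesis using val line Order_Done
        by (auto simp: state_ok_def alg5_step_def values_ok_def Let_def dest!: first_mem D)
    qed
  next
    case For_c
    show ?thesis
    proof (cases "var_c s")
      case None
      then show ?thesis using For_c nv by (simp add: state_ok_def alg5_step_def next_v_def)
    next
      case (Some c)
      then show ?thesis using val line For_c edge_product_pos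
        by (auto simp: state_ok_def alg5_step_def values_ok_def dest!: first_mem[OF _
          finite_path_prefixes])
    qed
  next
    case Stable_For_prefix
    then obtain c where c: "var_c s = Some c" "simple_cycle A c" using line val
      by (auto simp: values_ok_def)
    show ?thesis
    proof (cases "var_c' s")
      case None
      have "0 \<le> var_N s div var_r s \<and> var_N s div var_r s \<le> edge_product"
        using val by (intro int_div_bounds) (auto simp: values_ok_def)
      then show ?thesis using val line Stable_For_prefix None
        by (auto simp: state_ok_def alg5_step_def values_ok_def)
    next
      case (Some p)
      then have "trail p" using val prefix_trail by (auto simp: values_ok_def)
      then have "lcm (var_r s) (reduced A B p) dvd edge_product \<and>
          0 \<le> lcm (var_r s) (reduced A B p) \<and>
            lcm (var_r s) (reduced A B p) \<le> edge_product"
        using line Stable_For_prefix reduced_trail by (intro lcm_edge_product) auto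
      then show ?thesis using val line Stable_For_prefix Some c
        by (auto simp: state_ok_def alg5_step_def values_ok_def
            dest!: next_in_mem[OF _ finite_path_prefixes])
    qed
  next
    case Stable_Set_k
    let ?g = "gcd (var_M s) (weight B (the (var_c s)) div weight A (the (var_c s)))"
    have "0 \<le> var_M s div ?g \<and> var_M s div ?g \<le> edge_product"
      using val by (intro int_div_bounds) (auto simp: values_ok_def)
    then show ?thesis using val line Stable_Set_k
      by (auto simp: state_ok_def alg5_step_def values_ok_def)
  next
    case Stable_While
    let ?g = "gcd (var_s s) (var_M s div var_s s)"
    have "0 \<le> var_s s div ?g \<and> var_s s div ?g \<le> edge_product"
      using val by (intro int_div_bounds) (auto simp: values_ok_def)
    then show ?thesis using val line Stable_While
      by (auto simp: state_ok_def alg5_step_def values_ok_def Let_def)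
  next
    case Stable_Set_n
    have "0 \<le> var_M s div var_s s \<and> var_M s div var_s s \<le> edge_product"
      using val by (intro int_div_bounds) (auto simp: values_ok_def)
    then show ?thesis using val line Stable_Set_n
      by (auto simp: state_ok_def alg5_step_def values_ok_def)
  next
    case Stable_Set_K
    have "0 \<le> var_M s div var_n s \<and> var_M s div var_n s \<le> edge_product"
      using val by (intro int_div_bounds) (auto simp: values_ok_def)
    then show ?thesis using val line Stable_Set_K
      by (auto simp: state_ok_def alg5_step_def values_ok_def Let_def dest!: first_mem D)
  next
    case For_q
    show ?thesis
    proof (cases "var_q s")
      case None
      then show ?thesis using val line For_q nc
        by (cases h) (auto simp: state_ok_def alg5_step_def values_ok_def next_c_def)
    next
      case (Some q)
      show ?thesis
      proof (cases "reduced A B q = var_K s")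
        case True
        then show ?thesis using line For_q Some nc
          by (auto simp: state_ok_def alg5_step_def next_c_def)
      next
        case False
        then show ?thesis using val line For_q Some
          by (cases h) (auto simp: state_ok_def alg5_step_def values_ok_def Let_def
              dest!: next_in_mem D)
      qed
    qed
  qed (use assms in \<open>auto simp: state_ok_def alg5_step_def values_ok_def\<close>)
qed

lemma next_v_progress:
  assumes "values_ok s" "var_v s \<noteq> None" "pc s \<noteq> Start" "pc s \<noteq> Return_YES"
    "pc s \<noteq> Return_NO"
  shows "(next_v A s, s) \<in> progress"
proof -
  obtain v where v: "var_v s = Some v" "v < n" using assms(1,2) by (auto simp: values_ok_def)
  then have "vertices_left s = n - v + 1"
    using assms(3-) by (cases "pc s") (auto simp: vertices_left_def)
  moreover have "vertices_left (next_v A s) \<le> n - v"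
    using v by (simp add: vertices_left_def next_v_def next_in_vertices) arith
  ultimately show ?thesis by (simp add: progress_def)
qed

lemma next_c_progress:
  assumes "var_v s \<noteq> None" "var_c s \<noteq> None" "pc s = For_q"
  shows "(next_c A B s, s) \<in> progress"
proof -
  obtain c where "var_c s = Some c" using assms(2) by auto
  then show ?thesis
    using assms remaining_next_in[of "nonzero_cycles A B (the (var_v s))" c]
    by (auto simp: progress_def next_c_def vertices_left_def stage_def outer_left_def Let_def)
qed

lemma step_progress:
  assumes "state_ok s" "pc s \<notin> {Return_YES, Return_NO}"
  shows "(alg5_step A B h s, s) \<in> progress"
proof -
  have val: "values_ok s" and line: "line_ok (pc s) s"
    using assms by (auto simp: state_ok_def)
  note simps = alg5_step_def progress_def vertices_left_def stage_def outer_left_def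
    substage_def inner_left_def Let_def first_vertices
  note nv = next_v_progress[OF val]
  show ?thesis
  proof (cases "pc s")
    case (Faithful_For_c k)
    then obtain p where p: "var_fp s = Some p" using line by auto
    show ?thesis
    proof (cases "var_fc s")
      case (Some c)
      then show ?thesis
        using Faithful_For_c p line remaining_next_in[of "simple_cycles A (last p)" c]
        by (auto simp: simps)
    qed (use Faithful_For_c p line remaining_next_in[of "faithful_paths A B (the (var_v s))" p]
        in \<open>auto simp: simps\<close>)
  next
    case (Order_For_p k)
    then show ?thesis
      using line remaining_next_in[of "faithful_paths A B (the (var_v s))"]
      by (auto simp: simps split: option.split)
  next
    case (Order_Done k)
    show ?thesis
    proof (cases k)
      case Condition
      then show ?thesis using Order_Done line nv by (auto simp: alg5_step_def) (auto simp: simps)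
    next
      case Assignment
      then show ?thesis using Order_Done line by (auto simp: simps)
    qed
  next
    case For_c
    then show ?thesis using line nv by (cases "var_c s") (auto simp: alg5_step_def,
      auto simp: simps)
  next
    case Stable_For_prefix
    then show ?thesis
      using line remaining_next_in[OF finite_path_prefixes]
      by (auto simp: simps split: option.split)
  next
    case Stable_While
    let ?g = "gcd (var_s s) (var_M s div var_s s)"
    have s: "0 \<le> var_s s" using val by (simp add: values_ok_def)
    have "nat (var_s s div ?g) < nat (var_s s)" if "var_s s \<noteq> var_s s div ?g"
    proof -
      have "0 \<le> var_s s div ?g \<and> var_s s div ?g \<le> var_s s"
        using s by (intro int_div_bounds) auto
      then show ?thesis using that by linarith
    qed
    then show ?thesis using Stable_While line by (auto simp: simps)
  next
    case For_q
    show ?thesis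
    proof (cases "var_q s")
      case None
      then show ?thesis using For_q line next_c_progress
        by (cases h) (auto simp: alg5_step_def, auto simp: simps)
    next
      case (Some q)
      have "(s\<lparr>var_q := next_in (simple_paths A (the (var_v s))) q\<rparr>,
        s) \<in> progress"
        using For_q Some line remaining_next_in[of "simple_paths A (the (var_v s))" q]
        by (auto simp: simps)
      moreover have "(s\<lparr>pc := Return_NO\<rparr>, s) \<in> progress"
        using For_q line by (auto simp: simps)
      ultimately show ?thesis using For_q Some line next_c_progress
        by (cases h) (auto simp: alg5_step_def Let_def)
    qed
  qed (use assms(2) line n_pos in \<open>auto simp: simps split: option.split\<close>)
qed

lemma terminates: "\<exists>m. pc ((alg5_step A B h ^^ m) initial_state) \<in> {Return_YES,
  Return_NO}"
proof (rule ccontr)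
  assume *: "\<nexists>m. pc ((alg5_step A B h ^^ m) initial_state) \<in> {Return_YES, Return_NO}"
  have ok: "state_ok ((alg5_step A B h ^^ m) initial_state)" for m
    by (induction m) (auto intro: state_ok_initial state_ok_step)
  then have "((alg5_step A B h ^^ Suc m) initial_state,
    (alg5_step A B h ^^ m) initial_state) \<in> progress" for m
    using * step_progress[OF ok] by auto
  then have "\<exists>f. \<forall>i. (f (Suc i), f i) \<in> progress"
    by (intro exI[of _ "\<lambda>m. (alg5_step A B h ^^ m) initial_state"]) blast
  moreover have "wf progress" by (simp add: progress_def)
  ultimately show False unfolding wf_iff_no_infinite_down_chain by blast
qed

section \<open>The size of the states\<close>

abbreviation len :: nat where
  "len \<equiv> length (encode_pair (A, B))"

text \<open>
  Every row contributes at least the symbol that ends it.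
\<close>

lemma n_le_len: "n \<le> len"
proof -
  have "length (concat (map f xs)) \<ge> length xs"
    if "\<And>x. f x \<noteq> []" for f :: "nat \<Rightarrow> nat list" and xs
  proof (induction xs)
    case (Cons x xs)
    have "length (f x) \<ge> 1" using that[of x] by (simp add: Suc_le_eq)
    with Cons show ?case by simp
  qed simp
  from this[of "\<lambda>u. concat (map (\<lambda>w. encode_int (A $$ (u,
    w)) @ [4]) [0..<dim_col A]) @ [5]" "[0..<n]"]
  show ?thesis by (simp add: encode_pair_def encode_mat_def)
qed

lemma entry_le: 
  assumes "u < n" "w < n"
  shows "A $$ (u, w) \<le> 2 ^ len"
proof -
  have le: "length (f x) \<le> length (concat (map f xs))"
    if "x \<in> set xs" for f :: "nat \<Rightarrow> nat list" and x xs
    using that by (induction xs) auto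
  let ?row = "\<lambda>u. concat (map (\<lambda>w. encode_int (A $$ (u,
    w)) @ [4]) [0..<dim_col A]) @ [5]"
  have "length (encode_int (A $$ (u, w))) \<le> length (encode_int (A $$ (u, w)) @ [4])" by simp
  also have "\<dots> \<le> length (?row u)"
    using le[of w "[0..<dim_col A]" "\<lambda>w. encode_int (A $$ (u, w)) @ [4]"] assms carrier
      by simp
  also have "\<dots> \<le> length (encode_mat A)"
    unfolding encode_mat_def using assms by (intro le) simp
  also have "\<dots> \<le> len" by (simp add: encode_pair_def)
  finally have "length (encode_nat (nat \<bar>A $$ (u, w)\<bar>)) \<le> len"
    by (simp add: encode_int_def)
  then have "(2::nat) ^ length (encode_nat (nat \<bar>A $$ (u, w)\<bar>)) \<le> 2 ^ len"
    by (intro power_increasing) auto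
  with nat_less_encode[of "nat \<bar>A $$ (u, w)\<bar>"] have "nat \<bar>A $$ (u, w)\<bar> \<le>
    2 ^ len" by linarith
  then show ?thesis using nonneg[OF assms] by (simp add: nat_le_iff)
qed

text \<open>
  At most \<open>len ^ 2\<close> factors, each with at most \<open>len\<close> binary digits.
\<close>

lemma edge_product_le: "edge_product \<le> 2 ^ len ^ 3"
proof -
  let ?S = "{e. e \<in> {..<n} \<times> {..<n} \<and> A $$ e \<noteq> 0}"
  have "card ?S \<le> card ({..<n} \<times> {..<n})" by (intro card_mono) auto
  then have card: "card ?S \<le> n * n" by simp
  have "edge_product \<le> (\<Prod>e\<in>?S. 2 ^ len)"
    unfolding edge_product_def using nonneg entry_le by (intro prod_mono) auto
  also have "\<dots> = 2 ^ (len * card ?S)" by (simp add: power_mult)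
  also have "\<dots> \<le> 2 ^ (len * (len * len))"
    using card n_le_len by (intro power_increasing mult_left_mono order_trans[OF card] mult_mono)
      auto
  finally show ?thesis by (simp add: power3_eq_cube mult.assoc)
qed

lemma enc_path_le: "p \<in> short_lists n \<Longrightarrow> enc p \<le> 2 ^ (3 * (len + 2) ^ 2)"
proof -
  assume p: "p \<in> short_lists n"
  have bit_length: "bit_length n \<le> len" using bit_length_le_self[of n] n_le_len by linarith
  have "enc p \<le> enc p + 1" by simp
  also have "\<dots> \<le> (8 ^ (bit_length n + 1) * 5) ^ length p"
    using p by (intro enc_list_le) (auto simp: short_lists_def)
  also have "\<dots> \<le> (8 ^ (bit_length n + 1) * 8) ^ length p"
    by (intro power_mono mult_left_mono) auto
  also have "\<dots> = 8 ^ ((bit_length n + 2) * length p)"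
    unfolding power_mult by simp
  also have "\<dots> \<le> 8 ^ ((len + 2) * (len + 2))"
    using bit_length p n_le_len by (intro power_increasing mult_mono) (auto simp: short_lists_def)
  also have "\<dots> = (2 ^ 3) ^ ((len + 2) * (len + 2))" by simp
  also have "\<dots> = 2 ^ (3 * (len + 2) ^ 2)"
    unfolding power_mult[symmetric] power2_eq_square by simp
  finally show ?thesis .
qed

lemma state_size_bound:
  assumes "state_ok s"
  shows "enc s \<le> 2 ^ poly state_size len"
proof -
  define k where "k = 3 * (len + 3) ^ 3"
  have val: "values_ok s" using assms by (simp add: state_ok_def)
  have mono: "x \<le> 2 ^ j \<Longrightarrow> j \<le> j' \<Longrightarrow> x \<le> 2 ^ j'"
    for x j j' :: nat
    using power_increasing[of j j' "2::nat"] by linarith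
  have k: "3 * (len + 2) ^ 2 + 1 \<le> k" "len + 1 \<le> k" "2 * (len ^ 3 + 2) \<le> k" "5 \<le> k"
    unfolding k_def by (auto simp: power2_eq_square power3_eq_cube algebra_simps)
  have path: "enc x \<le> 2 ^ k" if "\<And>p. x = Some p \<Longrightarrow> p \<in> short_lists n"
    for x :: "nat list option"
  proof (cases x)
    case (Some p)
    have "Suc (enc p) \<le> 2 ^ (3 * (len + 2) ^ 2) + 2 ^ (3 * (len + 2) ^ 2)"
      using enc_path_le[OF that[OF Some]] one_le_power[of "2::nat" "3 * (len + 2) ^ 2"] by linarith
    also have "\<dots> = 2 ^ (3 * (len + 2) ^ 2 + 1)" by simp
    finally have "Suc (enc p) \<le> 2 ^ k" using k(1) mono by blast
    then show ?thesis using Some by (simp add: enc_option_def)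
  qed (simp add: enc_option_def)
  have int: "enc z \<le> 2 ^ k" if "z \<in> {0..edge_product}" for z :: int
  proof -
    have "int (nat \<bar>z\<bar>) \<le> int (2 ^ len ^ 3)" using that edge_product_le by auto
    then have "nat \<bar>z\<bar> \<le> 2 ^ len ^ 3" by (simp only: of_nat_le_iff)
    moreover have "(2::nat) + 2 ^ len ^ 3 \<le> 4 * 2 ^ len ^ 3"
      using one_le_power[of "2::nat" "len ^ 3"] by linarith
    moreover have "(2::nat) ^ (len ^ 3 + 2) = 4 * 2 ^ len ^ 3" by (simp add: power_add)
    ultimately have "nat \<bar>z\<bar> + 2 \<le> 2 ^ (len ^ 3 + 2)" by linarith
    then have "(nat \<bar>z\<bar> + 2) ^ 2 \<le> (2 ^ (len ^ 3 + 2)) ^ 2"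
      by (rule power_mono) (rule le0)
    also have "\<dots> = 2 ^ (2 * (len ^ 3 + 2))" by (simp only: power_mult[symmetric] mult.commute)
    finally have "enc z \<le> 2 ^ (2 * (len ^ 3 + 2))" using enc_int_le le_trans by blast
    then show ?thesis using k(3) mono by blast
  qed
  have line: "enc (pc s) \<le> 2 ^ k"
    using line_number_less[of "pc s"] by (intro mono[OF _ k(4)]) (simp add: enc_line_def)
  have v: "enc (var_v s) \<le> 2 ^ k"
  proof (cases "var_v s")
    case (Some v)
    then have "v < n" using val by (simp add: values_ok_def)
    then have "Suc v \<le> len" using n_le_len by linarith
    moreover have "len < 2 ^ len" by simp
    ultimately have "Suc v \<le> 2 ^ len" by linarith
    then show ?thesis using Some mono[of "Suc v" len k] k(2) by (simp add: enc_option_def)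
  qed (simp add: enc_option_def)
  have more: "enc (state.more s) \<le> 2 ^ k" by (simp add: enc_unit_def)
  have prefix: "p \<in> short_lists n" if "var_c' s = Some p" for p
  proof -
    obtain c where c: "simple_cycle A c" "p \<in> path_prefixes c"
      using val \<open>var_c' s = Some p\<close> by (auto simp: values_ok_def)
    then show ?thesis using short_sets(5)[OF simple_cycle_short[OF c(1)]] by blast
  qed
  have paths: "enc (var_fp s) \<le> 2 ^ k" "enc (var_fc s) \<le> 2 ^ k" "enc (var_op s) \<le> 2 ^ k"
    "enc (var_c s) \<le> 2 ^ k" "enc (var_c' s) \<le> 2 ^ k" "enc (var_q s) \<le> 2 ^ k"
    using val prefix
    by (auto simp: values_ok_def intro!: path intro: simple_path_short simple_cycle_short)
  have ints: "enc (var_oN s) \<le> 2 ^ k" "enc (var_N s) \<le> 2 ^ k" "enc (var_r s) \<le> 2 ^ k"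
    "enc (var_M s) \<le> 2 ^ k" "enc (var_k s) \<le> 2 ^ k" "enc (var_s s) \<le> 2 ^ k"
    "enc (var_n s) \<le> 2 ^ k" "enc (var_K s) \<le> 2 ^ k"
    using val by (auto simp: values_ok_def intro!: int)
  \<comment> \<open>The \<open>i\<close>-th iterate of the map that takes \<open>k\<close> to
    \<open>2 * k + 4\<close>.\<close>
  let ?e = "\<lambda>i. 2 ^ i * (k + 4) - 4"
  have pair: "prod_encode (x, y) \<le> 2 ^ ?e (Suc i)"
    if "x \<le> 2 ^ k" "y \<le> 2 ^ ?e i" for x y i
  proof -
    have ge: "(k + 4) \<le> 2 ^ i * (k + 4)" by simp
    then have "k \<le> ?e i" by linarith
    then have "prod_encode (x, y) \<le> 2 ^ (2 * ?e i + 4)"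
      using that mono by (intro prod_encode_power_le) auto
    moreover have "2 * ?e i + 4 = ?e (Suc i)"
    proof -
      have "2 * (y - 4) + 4 = 2 * y - 4" if "4 \<le> y" for y :: nat using that by simp
      from this[of "2 ^ i * (k + 4)"] ge show ?thesis by (simp only: power_Suc mult.assoc)
    qed
    ultimately show ?thesis by simp
  qed
  have "enc (state.more s) \<le> 2 ^ ?e 0" using more by simp
  then have "enc s \<le> 2 ^ ?e (Suc (Suc (Suc (Suc (Suc (Suc (Suc (Suc (Suc (Suc (Suc (Suc (Suc
    (Suc (Suc (Suc 0))))))))))))))))"
    unfolding enc_state_ext_def enc_prod_def fst_conv snd_conv
    using line v paths ints by (intro pair)
  also have "\<dots> \<le> 2 ^ (2 ^ 16 * (k + 4))"
    by (intro power_increasing) (simp_all add: diff_le_mono2)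
  also have "2 ^ 16 * (k + 4) = poly state_size len"
    by (simp add: state_size_def k_def algebra_simps)
  finally show ?thesis .
qed

end

text \<open>
  Turns the number in a counter into a jump and clears the counter on the way.
\<close>

fun dispatch :: "nat \<Rightarrow> nat \<Rightarrow> nat \<Rightarrow> prog" where
  "dispatch r l 0 = Goto l"
| "dispatch r l (Suc k) = IfNZ r (Seq (Dec r) (dispatch r (Suc l) k)) (Goto l)"

lemma Goto_in_stacks: "l \<le> i \<Longrightarrow> i \<le> l + k \<Longrightarrow>
  Goto i # K \<in> stacks (dispatch r l k) K"
proof (induction k arbitrary: l)
  case (Suc k)
  then show ?case by (cases "i = l") auto
qed simp

context counter_machine
begin

lemma reach_Seq_exec:
  assumes "exec b p e e'" "\<And>i. e i \<le> b" "Seq p q # K \<in> set Ks"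
  shows "reach (Suc (bit_length b)) (conf (Seq p q # K) e) (conf (q # K) e') \<and>
    q # K \<in> set Ks"
  using reach_Seq[OF assms(3)] reach_exec[OF assms(1,2)] by (blast intro: reach_trans)

lemma reach_dispatch:
  assumes "e r < k" "dispatch r l k # K \<in> set Ks" "\<And>i. e i \<le> b"
  shows "reach (Suc (bit_length b)) (conf (dispatch r l k # K) e) (conf (Goto (l + e r) # K) (e(r
    := 0))) \<and>
    Goto (l + e r) # K \<in> set Ks"
  using assms
proof (induction k arbitrary: l e)
  case (Suc k)
  have If: "IfNZ r (Seq (Dec r) (dispatch r (Suc l) k)) (Goto l) # K \<in> set Ks"
    using Suc.prems(2) by simp
  show ?case
  proof (cases "e r = 0")
    case True
    then have "e(r := 0) = e" by auto
    then show ?thesis using reach_IfNZ[OF If, of "Suc (bit_length b)" e] True by simp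
  next
    case False
    have 1: "reach (Suc (bit_length b)) (conf (dispatch r l (Suc k) # K) e)
        (conf (Seq (Dec r) (dispatch r (Suc l) k) # K) e)"
      "Seq (Dec r) (dispatch r (Suc l) k) # K \<in> set Ks"
      using reach_IfNZ[OF If, of "Suc (bit_length b)" e] False by simp_all
    have 2: "reach (Suc (bit_length b)) (conf (Seq (Dec r) (dispatch r (Suc l) k) # K) e)
        (conf (dispatch r (Suc l) k # K) (e(r := e r - Suc 0)))"
      "dispatch r (Suc l) k # K \<in> set Ks"
      using reach_Seq_exec[OF exec_Dec[of b r e] Suc.prems(3) 1(2)] by auto
    define e' where "e' = e(r := e r - Suc 0)"
    have e': "e' r = e r - Suc 0" "e'(r := 0) = e(r := 0)" by (auto simp: e'_def)
    have "e' i \<le> b" for i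
      unfolding e'_def using Suc.prems(3)[of i] by (auto intro: le_trans)
    moreover have "e' r < k" using Suc.prems(1) False e' by simp
    ultimately have 3: "reach (Suc (bit_length b)) (conf (dispatch r (Suc l) k # K) e')
        (conf (Goto (Suc l + (e r - Suc 0)) # K) (e(r := 0)))"
      "Goto (Suc l + (e r - Suc 0)) # K \<in> set Ks"
      using Suc.IH[of e' "Suc l"] 2(2) unfolding e' by blast+
    have "Suc l + (e r - Suc 0) = l + e r" using False by simp
    then show ?thesis using reach_trans[OF 1(1) reach_trans[OF 2(1) 3(1)[unfolded e'_def]]] 3(2)
      by (simp add: fun_upd_def)
  qed
qed simp

lemma reach_block:
  assumes "exec b p e (d(r := k))" "d r = 0" "k < N" "\<And>i. e i \<le> b"
    and "[Seq p (dispatch r 0 N)] \<in> set Ks"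
  shows "reach (Suc (bit_length b)) (conf [Seq p (dispatch r 0 N)] e) (conf [Goto k] d)"
proof -
  have "(d(r := k)) i \<le> b" for i
    using exec_bound[OF assms(1) assms(4)] by simp
  moreover have "d(r := k, r := 0) = d" using assms(2) by auto
  ultimately show ?thesis
    using reach_Seq_exec[OF assms(1,4,5)] reach_dispatch[of "d(r := k)" r N 0 "[]" b] assms(3)
    by (auto intro: reach_trans)
qed

lemma reach_Goto:
  assumes "[Goto i] \<in> set Ks" "i \<notin> finals"
  shows "reach l (conf [Goto i] e) (conf [main] e)"
  using assms by (intro reach_keep) auto

lemma reach_sequence:
  assumes "reach l c0 (c 0)" "\<And>j. j < m \<Longrightarrow> reach l (c j) (c (Suc j))"
  shows "\<exists>\<tau>. (\<forall>j<m. \<tau> j < \<tau> (Suc j)) \<and>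
    (\<forall>j\<le>m. (tm_step machine ^^ \<tau> j) c0 = c j) \<and>
    (\<forall>t\<le>\<tau> m. heads_in l ((tm_step machine ^^ t) c0))"
  using assms(2)
proof (induction m)
  case 0
  from assms(1) obtain t where "(tm_step machine ^^ t) c0 = c 0"
    "\<forall>s\<le>t. heads_in l ((tm_step machine ^^ s) c0)" unfolding reach_def by blast
  then show ?case by (intro exI[of _ "\<lambda>_. t"]) auto
next
  case (Suc m)
  then obtain \<tau> where \<tau>: "\<And>j. j < m \<Longrightarrow> \<tau> j < \<tau> (Suc j)"
    "\<And>j. j \<le> m \<Longrightarrow> (tm_step machine ^^ \<tau> j) c0 = c j"
    "\<And>t. t \<le> \<tau> m \<Longrightarrow> heads_in l ((tm_step machine ^^ t) c0)"
    by (metis less_SucI)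
  obtain t where t: "t > 0" "(tm_step machine ^^ t) (c m) = c (Suc m)"
    "\<And>s. s \<le> t \<Longrightarrow> heads_in l ((tm_step machine ^^ s) (c m))"
    using Suc.prems[of m] unfolding reach_def by blast
  have add: "(tm_step machine ^^ (s + \<tau> m)) c0 = (tm_step machine ^^ s) (c m)" for s
    using \<tau>(2)[of m] by (simp add: funpow_add)
  let ?\<tau> = "\<tau>(Suc m := t + \<tau> m)"
  show ?case
  proof (intro exI[of _ ?\<tau>] conjI allI impI)
    fix j assume "j < Suc m"
    then show "?\<tau> j < ?\<tau> (Suc j)" using \<tau>(1)[of j] t(1) by (auto simp: less_Suc_eq)
  next
    fix j assume "j \<le> Suc m"
    then show "(tm_step machine ^^ ?\<tau> j) c0 = c j"
      using \<tau>(2)[of j] add[of t] t(2) by (auto simp: le_Suc_eq)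
  next
    fix u assume u: "u \<le> ?\<tau> (Suc m)"
    show "heads_in l ((tm_step machine ^^ u) c0)"
    proof (cases "u \<le> \<tau> m")
      case False
      then have "u = (u - \<tau> m) + \<tau> m" by simp
      moreover have "u - \<tau> m \<le> t" using u by simp
      ultimately show ?thesis using add t(3) by metis
    qed (rule \<tau>(3))
  qed
qed

text \<open>
  After halting the configuration does not change, so the heads visit nothing else.
\<close>

lemma space_bound:
  assumes halt: "fst ((tm_step machine ^^ k) (initial_config machine xs)) \<in> halting machine"
    and heads: "\<And>t. t \<le> k \<Longrightarrow> heads_in l ((tm_step machine ^^ t)
      (initial_config machine xs))"
  shows "uses_space_at_most machine xs (T * (l + 2))"
proof -
  let ?c = "\<lambda>t. (tm_step machine ^^ t) (initial_config machine xs)"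
  have stay: "tm_step machine c = c" if "fst c \<in> halting machine" for c
    using that by (cases c) simp
  have const: "?c (t + k) = ?c k" for t
    by (induction t) (use halt stay in auto)
  have "heads_in l (?c t)" for t
  proof (cases "t \<le> k")
    case False
    then show ?thesis using const[of "t - k"] heads[of k] by simp
  qed (rule heads)
  then have sub: "scanned_cells machine xs \<subseteq> {..<T} \<times> {-1..int l}"
    by (auto simp: scanned_cells_def config_at_def heads_in_def machine_def)
  have "card (scanned_cells machine xs) \<le> card ({..<T} \<times> {-1..int l})"
    by (rule card_mono[OF _ sub]) simp
  also have "\<dots> = T * (l + 2)"
    by (simp add: card_cartesian_product nat_add_distrib)
  finally show ?thesis
    using finite_subset[OF sub] by (simp add: uses_space_at_most_def)
qed

lemma idx_start: "idx [start] = 0"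
  using start_Ks idx_nth[of 0] by (metis hd_conv_nth length_greater_0_conv)

lemma initial_conf:
  assumes "set xs \<subseteq> {1..5}"
  shows "initial_config machine xs = conf [start] (\<lambda>i. if i = 0 then digit_value xs else 0)"
proof -
  have "(contents xs, 0) # replicate (T - 1) (contents [], 0) =
      map (\<lambda>j. (contents (digits (if j = 0 then digit_value xs else 0)), 0)) [0..<T]"
    using T_pos by (intro nth_equalityI) (auto simp: nth_Cons' digits_digit_value[OF assms])
  then show ?thesis
    by (simp add: initial_config_def conf_def tapes_def idx_start machine_def)
qed

end

lemma counter_machine_exists:
  assumes "regs start \<union> regs main \<subseteq> {..<T}" "T \<ge> 1"
  obtains Ks where "counter_machine start main T Ks" "stacks main [] \<subseteq> set Ks" "[main]
    \<in> set Ks" "[start] \<in> set Ks"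
proof -
  let ?S = "stacks start [] \<union> stacks main [] \<union> {[]}"
  have "finite (?S - {[start]})" using finite_stacks by auto
  then obtain xs where xs: "set xs = ?S - {[start]}" "distinct xs"
    using finite_distinct_list by metis
  have start: "[start] \<in> ?S" and main: "[main] \<in> ?S" using stacks_self by auto
  then have set: "set ([start] # xs) = ?S" using xs by auto
  have "counter_machine start main T ([start] # xs)"
  proof
    fix K assume K: "K \<in> set ([start] # xs)"
    then have K': "K \<in> ?S" unfolding set .
    have "succs main K \<subseteq> ?S \<union> {[], [main]}"
      using K' succs_stacks[of K start "[]" main] succs_stacks[of K main "[]" main] by auto
    then show "succs main K \<subseteq> set ([start] # xs)" unfolding set using main by blast
    fix c assume "c \<in> set K"
    then show "regs c \<subseteq> {..<T}"
      using K' regs_stacks[of K start "[]" c] regs_stacks[of K main "[]" c] assms(1) by auto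
  qed (use xs assms in auto)
  then show ?thesis using that set start main by blast
qed

section \<open>Programs for the steps and the displayed variables\<close>

text \<open>
  The number of the word to be displayed. An absent value is displayed as the empty word.
\<close>

definition show_path :: "nat list option \<Rightarrow> nat" where
  "show_path x = (case x of None \<Rightarrow> 0 | Some p \<Rightarrow> enc p)"

definition show_nat :: "nat option \<Rightarrow> nat" where
  "show_nat x = (case x of None \<Rightarrow> 0 | Some v \<Rightarrow> push_nat v 0)"

definition show_int :: "int \<Rightarrow> nat" where
  "show_int z = (if z < 0 then 3 + 5 * push_nat (nat \<bar>z\<bar>) 0 else push_nat (nat
    \<bar>z\<bar>) 0)"

lemma pspace_show_path [pspace_intros]: "pspace f \<Longrightarrow>
  pspace (\<lambda>c. show_path (f c))"
  unfolding show_path_def by (intro pspace_intros)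

lemma pspace_show_nat [pspace_intros]: "pspace f \<Longrightarrow>
  pspace (\<lambda>c. show_nat (f c))"
  unfolding show_nat_def by (intro pspace_intros)

lemma pspace_show_int [pspace_intros]: "pspace f \<Longrightarrow>
  pspace (\<lambda>c. show_int (f c))"
  unfolding show_int_def by (intro pspace_intros)

definition show_vars :: "(state \<Rightarrow> nat) list" where
  "show_vars =
     [\<lambda>s. show_nat (var_v s), \<lambda>s. show_path (var_fp s),
       \<lambda>s. show_path (var_fc s),
      \<lambda>s. show_path (var_op s), \<lambda>s. show_int (var_oN s),
        \<lambda>s. show_int (var_N s),
      \<lambda>s. show_path (var_c s), \<lambda>s. show_path (var_c' s),
        \<lambda>s. show_int (var_r s),
      \<lambda>s. show_int (var_M s), \<lambda>s. show_int (var_k s),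
        \<lambda>s. show_int (var_s s),
      \<lambda>s. show_int (var_n s), \<lambda>s. show_int (var_K s),
        \<lambda>s. show_path (var_q s)]"

lemma length_show_vars: "length show_vars = 15"
  by (simp add: show_vars_def)

lemma pspace_show_vars: "f \<in> set show_vars \<Longrightarrow> pspace f"
  unfolding show_vars_def by (simp, elim disjE; hypsubst; intro pspace_intros)

lemma digits_show_vars: "map (\<lambda>f. digits (f s)) show_vars = encode_vars s"
proof -
  have digit_value: "digit_value (encode_nat v) = push_nat v 0" for v
    using digit_value_encode_nat_append[of v "[]"] by simp
  have n: "digits (show_nat x) = encode_option encode_nat x" for x
  proof (cases x)
    case (Some v)
    have "set (encode_nat v) \<subseteq> {1..5}" using set_encode_nat[of v] by auto
    from digits_digit_value[OF this] show ?thesis using Some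
      by (simp add: show_nat_def encode_option_def digit_value)
  qed (simp add: show_nat_def encode_option_def)
  have p: "digits (show_path x) = encode_option encode_path x" for x
    using digits_digit_value[OF set_encode_path]
    by (cases x) (simp_all add: show_path_def encode_option_def digit_value_encode_path[symmetric])
  have i: "digits (show_int z) = encode_int z" for z
  proof -
    have "show_int z = digit_value (encode_int z)"
      by (simp add: show_int_def encode_int_def digit_value)
    then show ?thesis using digits_digit_value[OF set_encode_int] by simp
  qed
  show ?thesis by (simp add: show_vars_def encode_vars_def n p i)
qed

text \<open>
  Counter 16 holds the code of \<open>s\<close>; from it the values are computed into consecutive
  counters.
\<close>

lemma show_program:
  fixes fs :: "('a::code \<Rightarrow> nat) list"
  assumes "\<And>f. f \<in> set fs \<Longrightarrow> pspace f" "1 \<le> j" "j + length fs \<le> 16"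
  shows "\<exists>B p. poly_length B \<and> (\<forall>s e b. e 16 =
    enc s \<longrightarrow> (\<forall>i\<ge>17. e i =
      0) \<longrightarrow> B s \<le> b \<longrightarrow>
    exec b p e (\<lambda>i. if j \<le> i \<and> i < j + length fs then (fs ! (i - j)) s else e i))"
  using assms
proof (induction fs arbitrary: j)
  case Nil
  show ?case
  proof (intro exI conjI allI impI)
    show "poly_length (\<lambda>_ :: 'a. 0)" by (rule poly_length_const)
    show "exec b Skip e (\<lambda>i. if j \<le> i \<and>
      i < j + length [] then ([] ! (i - j)) s else e i)"
      for b s and e :: "nat \<Rightarrow> nat"
      by (rule exec_eq[OF exec_Skip]) auto
  qed
next
  case (Cons f fs)
  obtain B' p' where p': "poly_length B'" "\<And>s e b. e 16 = enc s \<Longrightarrow>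
    (\<And>i. i \<ge> 17 \<Longrightarrow> e i = 0) \<Longrightarrow> B' s \<le> b \<Longrightarrow>
    exec b p' e (\<lambda>i. if Suc j \<le> i \<and> i < Suc j + length fs then (fs ! (i - Suc j))
      s else e i)"
    using Cons.IH[of "Suc j"] Cons.prems by (auto simp: less_Suc_eq_le) blast
  have "pspace f" using Cons.prems(1) by simp
  then obtain Bf pf where f: "poly_length Bf" "\<And>a. enc (f a) \<le> Bf a"
    "computes pf Bf f"
    by (rule pspace_E) (rule that)
  have j: "1 \<le> j" "j < 16" using Cons.prems by auto
  let ?p = "Seq (clear j) (Seq (pf 16 17) (Seq (move_add 17 j) p'))"
  have "exec b ?p e (\<lambda>i. if j \<le> i \<and> i < j + length (f # fs) then ((f # fs) ! (i -
    j)) s else e i)"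
    if e: "e 16 = enc s" "\<forall>i\<ge>17. e i = 0" and b: "Bf s + B' s \<le> b" for s e b
  proof -
    have 1: "exec b (clear j) e (e(j := 0))" by (rule exec_clear)
    have 2: "exec b (pf 16 17) (e(j := 0)) (e(j := 0, 17 := f s))"
      using e b j by (intro computesD[OF f(3), unfolded enc_nat_def]) auto
    have 3: "exec b (move_add 17 j) (e(j := 0, 17 := f s)) (e(j := f s))"
      by (rule exec_eq[OF exec_move_add]) (use e b j f(2)[of s] in \<open>auto simp:
        fun_eq_iff\<close>)
    have 4: "exec b p' (e(j := f s)) (\<lambda>i. if Suc j \<le> i \<and> i < Suc j + length fs
        then (fs ! (i - Suc j)) s else (e(j := f s)) i)"
      using e b j by (intro p'(2)) auto
    have "(\<lambda>i. if Suc j \<le> i \<and> i < Suc j + length fs then (fs ! (i - Suc j)) s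
      else (e(j := f s)) i) =
        (\<lambda>i. if j \<le> i \<and> i < j + length (f # fs) then ((f # fs) ! (i - j)) s else
          e i)"
    proof
      fix i
      consider "i \<le> j" | k where "i = Suc (j + k)"
        by (metis less_imp_Suc_add not_le)
      then show "(if Suc j \<le> i \<and> i < Suc j + length fs then (fs ! (i - Suc j)) s else
        (e(j := f s)) i) =
        (if j \<le> i \<and> i < j + length (f # fs) then ((f # fs) ! (i - j)) s else e i)"
        by cases auto
    qed
    with 4 show ?thesis by (intro exec_Seq[OF 1 exec_Seq[OF 2 exec_Seq[OF 3]]]) simp
  qed
  moreover have "poly_length (\<lambda>s. Bf s + B' s)" by (intro poly_length_add f(1) p'(1))
  ultimately show ?case by blast
qed

text \<open>
  The counters when a state is displayed: the input, the 15 displayed variables, the code of the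
  state, and cleared scratch space.
\<close>

definition display_env :: "nat \<Rightarrow> state \<Rightarrow> nat \<Rightarrow> nat" where
  "display_env X s i =
     (if i = 0 then X else if i < 16 then (show_vars ! (i - 1)) s else if i = 16 then enc s else 0)"

lemma display_env_bound:
  "\<exists>B. poly_length B \<and> (\<forall>X s i. display_env X s i \<le> B (X, s))"
proof -
  have "\<exists>B. poly_length B \<and> (\<forall>s. \<forall>f\<in>set fs. f s \<le> B s)"
    if "\<And>f. f \<in> set fs \<Longrightarrow> pspace f"
    for fs :: "(state \<Rightarrow> nat) list"
    using that
  proof (induction fs)
    case Nil
    then show ?case using poly_length_const by fastforce
  next
    case (Cons f fs)
    then obtain B where B: "poly_length B" "\<And>s f. f \<in> set fs \<Longrightarrow>
      f s \<le> B s" by auto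
    have "pspace f" using Cons.prems by simp
    then have "poly_length (\<lambda>s. f s + B s)" by (intro poly_length_add poly_length_nat B)
    moreover have "g s \<le> f s + B s" if "g \<in> set (f # fs)" for g s
      using that B(2)[of g s] by auto
    ultimately show ?case by blast
  qed
  then obtain B where B: "poly_length B" "\<And>s f. f \<in> set show_vars \<Longrightarrow>
    f s \<le> B s"
    using pspace_show_vars by meson
  let ?B = "\<lambda>z. fst z + B (snd z) + enc (snd z)"
  have "poly_length ?B"
    by (intro poly_length_add poly_length_nat pspace_length_bound poly_length_comp[OF B(1)]
      pspace_intros)
  moreover have "display_env X s i \<le> ?B (X, s)" for X s i
    using B(2)[of "show_vars ! (i - 1)" s] length_show_vars by (auto simp: display_env_def)
  ultimately show ?thesis by blast
qed

text \<open>
  What is common to the first and to all later steps: once the code of the new state is in counter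
  16, the displayed variables are renewed and the number of the next line is left in counter 17.
\<close>

lemma finish_program:
  "\<exists>B p. poly_length B \<and> (\<forall>X s e b. e 0 = X \<longrightarrow> e 16 =
    enc s \<longrightarrow> (\<forall>i\<ge>17. e i =
      0) \<longrightarrow> B s \<le> b \<longrightarrow>
    exec b p e ((display_env X s)(17 := line_number (pc s))))"
proof -
  obtain B p where p: "poly_length B" "\<And>s e b. e 16 = enc s \<Longrightarrow>
    (\<And>i. i \<ge> 17 \<Longrightarrow> e i = 0) \<Longrightarrow> B s \<le> b \<Longrightarrow>
    exec b p e (\<lambda>i. if 1 \<le> i \<and> i < 1 + length show_vars then (show_vars ! (i -
      1)) s else e i)"
    using show_program[of show_vars 1] pspace_show_vars length_show_vars by auto blast
  have "pspace (\<lambda>s :: state. pc s)" by (intro pspace_intros)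
  then obtain Bl pl where l: "poly_length Bl" "computes pl Bl (\<lambda>s :: state. pc s)"
    by (rule pspace_E) (rule that)
  have "exec b (Seq p (pl 16 17)) e ((display_env X s)(17 := line_number (pc s)))"
    if e: "e 0 = X" "e 16 = enc s" "\<forall>i\<ge>17. e i = 0" and b: "B s + Bl s \<le> b"
      for X s e b
  proof -
    have "(\<lambda>i. if 1 \<le> i \<and> i < 1 + length show_vars then (show_vars ! (i - 1)) s
      else e i) = display_env X s"
      using e by (auto simp: display_env_def fun_eq_iff length_show_vars)
    then have 1: "exec b p e (display_env X s)"
      using p(2)[of e s b] e b by simp
    have 2: "exec b (pl 16 17) (display_env X s) ((display_env X s)(17 := line_number (pc s)))"
      using b by (intro computesD[OF l(2), unfolded enc_line_def]) (auto simp: display_env_def)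
    show ?thesis by (rule exec_Seq[OF 1 2])
  qed
  moreover have "poly_length (\<lambda>s. B s + Bl s)" by (intro poly_length_add p(1) l(1))
  ultimately show ?thesis by blast
qed

lemma step_program:
  "\<exists>B p. poly_length B \<and> (\<forall>X s b. B (X, s) \<le> b \<longrightarrow>
    exec b p (display_env X s)
      ((display_env X (coded_step h X s))(17 := line_number (pc (coded_step h X s)))))"
proof -
  obtain Bs qs where s: "poly_length Bs" "\<And>z. enc (coded_step h (fst z) (snd z)) \<le> Bs z"
    "computes qs Bs (\<lambda>z. coded_step h (fst z) (snd z))"
    by (rule pspace_E[OF pspace_coded_step[of h]]) (rule that)
  obtain Bf pf where f: "poly_length Bf"
    "\<And>X s e b. e 0 = X \<Longrightarrow> e 16 = enc s \<Longrightarrow>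
      (\<And>i. i \<ge> 17 \<Longrightarrow> e i = 0) \<Longrightarrow>
        Bf s \<le> b \<Longrightarrow>
      exec b pf e ((display_env X s)(17 := line_number (pc s)))"
    using finish_program by blast
  let ?p = "Seq (pairing 0 16 17) (Seq (qs 17 18) (Seq (clear 16) (Seq (clear 17) (Seq (move_add
    18 16) pf))))"
  let ?B = "\<lambda>z. enc z + Bs z + Bf (coded_step h (fst z) (snd z))"
  have "poly_length ?B"
    by (intro poly_length_add poly_length_enc s(1) poly_length_comp[OF f(1)] pspace_length_bound
      pspace_coded_step)
  moreover have "exec b ?p (display_env X s)
      ((display_env X (coded_step h X s))(17 := line_number (pc (coded_step h X s))))"
    if b: "?B (X, s) \<le> b" for X s b
  proof -
    let ?e = "display_env X s" and ?t = "coded_step h X s"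
    have e: "?e 0 = X" "?e 16 = enc s" "\<And>i. i \<ge> 17 \<Longrightarrow> ?e i = 0"
      by (auto simp: display_env_def)
    have 1: "exec b (pairing 0 16 17) ?e (?e(17 := enc (X, s)))"
      by (rule exec_eq[OF exec_pairing]) (use e b in \<open>auto simp: enc_prod_def\<close>)
    have 2: "exec b (qs 17 18) (?e(17 := enc (X, s))) (?e(17 := enc (X, s), 18 := enc ?t))"
      by (rule exec_eq[OF computesD[OF s(3), where a = "(X, s)"]]) (use e b in auto)
    have 3: "exec b (clear 16) (?e(17 := enc (X, s), 18 := enc ?t)) (?e(17 := enc (X, s),
      18 := enc ?t, 16 := 0))"
      by (rule exec_clear)
    have 4: "exec b (clear 17) (?e(17 := enc (X, s), 18 := enc ?t, 16 := 0)) (?e(18 := enc ?t,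
      16 := 0))"
      by (rule exec_eq[OF exec_clear]) (use e in \<open>auto simp: fun_eq_iff\<close>)
    have 5: "exec b (move_add 18 16) (?e(18 := enc ?t, 16 := 0)) (?e(16 := enc ?t))"
      by (rule exec_eq[OF exec_move_add]) (use e b s(2)[of "(X,
        s)"] in \<open>auto simp: fun_eq_iff\<close>)
    have 6: "exec b pf (?e(16 := enc ?t)) ((display_env X ?t)(17 := line_number (pc ?t)))"
      using e b by (intro f(2)) auto
    show ?thesis
      by (rule exec_Seq[OF 1 exec_Seq[OF 2 exec_Seq[OF 3 exec_Seq[OF 4 exec_Seq[OF 5 6]]]]])
  qed
  ultimately show ?thesis by blast
qed

lemma start_program:
  "\<exists>B p. poly_length B \<and> (\<forall>X b. B X \<le> b \<longrightarrow>
    exec b p (\<lambda>i. if i = 0 then X else 0)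
      ((display_env X initial_state)(17 := line_number (pc initial_state))))"
proof -
  have "pspace (\<lambda>X::nat. initial_state)" by (rule pspace_const)
  then obtain Bs qs where s: "poly_length Bs" "computes qs Bs (\<lambda>X::nat. initial_state)"
    by (rule pspace_E) (rule that)
  obtain Bf pf where f: "poly_length Bf"
    "\<And>X s e b. e 0 = X \<Longrightarrow> e 16 = enc s \<Longrightarrow>
      (\<And>i. i \<ge> 17 \<Longrightarrow> e i = 0) \<Longrightarrow>
        Bf s \<le> b \<Longrightarrow>
      exec b pf e ((display_env X s)(17 := line_number (pc s)))"
    using finish_program by blast
  have "exec b (Seq (qs 0 16) pf) (\<lambda>i. if i = 0 then X else 0)
      ((display_env X initial_state)(17 := line_number (pc initial_state)))"
    if b: "Bs X + Bf initial_state \<le> b" for X b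
  proof -
    let ?e = "\<lambda>i. if i = 0 then X else 0"
    have 1: "exec b (qs 0 16) ?e (?e(16 := enc initial_state))"
      using b by (intro computesD[OF s(2), where a = X]) auto
    have 2: "exec b pf (?e(16 := enc initial_state))
        ((display_env X initial_state)(17 := line_number (pc initial_state)))"
      using b by (intro f(2)) auto
    show ?thesis by (rule exec_Seq[OF 1 2])
  qed
  moreover have "poly_length (\<lambda>X. Bs X + Bf initial_state)"
    by (intro poly_length_add poly_length_const s(1))
  ultimately show ?thesis by blast
qed

section \<open>The machine for the algorithm\<close>

lemma digit_value_less: "set ds \<subseteq> {1..5} \<Longrightarrow>
  digit_value ds + 1 \<le> 8 ^ length ds"
  by (induction ds) auto

lemma bound_uniform:
  assumes "\<And>z. bit_length (G z) \<le> poly q (code_size z)" "code_size z \<le> poly r k"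
  shows "G z \<le> 2 ^ poly (pcompose q r) k"
proof -
  have "bit_length (G z) \<le> poly q (poly r k)"
    using assms poly_nat_mono le_trans by blast
  then show ?thesis by (simp add: bit_length_le_iff poly_pcompose)
qed

definition pair_size :: "nat poly" where
  "pair_size = [:2:] * ([:0, 3:] + state_size) + [:5:]"

context katsura
begin

lemma X_le: "X \<le> 2 ^ (3 * len)"
proof -
  have "X + 1 \<le> 8 ^ len"
    unfolding input_def using set_encode_mat by (intro digit_value_less) (auto simp:
      encode_pair_def)
  also have "(8::nat) ^ len = 2 ^ (3 * len)" by (simp add: power_mult)
  finally show ?thesis by simp
qed

lemma code_size_bounds:
  shows "code_size X \<le> poly pair_size len"
    and "state_ok s \<Longrightarrow> code_size (X, s) \<le> poly pair_size len"
proof -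
  have less: "bit_length x \<le> k + 1" if "x \<le> 2 ^ k" for x k
    using that by (simp add: bit_length_le_iff less_le_trans[of _ "2 ^ k + 1"] le_imp_less_Suc)
  show "code_size X \<le> poly pair_size len"
    using less[OF X_le] by (simp add: code_size_def pair_size_def)
  assume s: "state_ok s"
  let ?k = "3 * len + poly state_size len"
  have "X \<le> 2 ^ ?k" "enc s \<le> 2 ^ ?k"
    using X_le state_size_bound[OF s]
    by (auto elim!: order_trans intro!: power_increasing)
  then have "enc (X, s) \<le> 2 ^ (2 * ?k + 4)"
    unfolding enc_prod_def by (intro prod_encode_power_le) auto
  from less[OF this] show "code_size (X, s) \<le> poly pair_size len"
    by (simp add: code_size_def pair_size_def)
qed

end

text \<open>
  The machine first runs \<open>start\<close>, which displays the initial state, and then, again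
  and again, \<open>main\<close>, which displays the next one.
\<close>

theorem proposition7p7:
  fixes h :: halt_place
  shows "runs_in_polynomial_space (algorithm5 h) encode_pair {(A, B). katsura_pair A B}"
proof -
  obtain B0 p0 where p0: "poly_length B0" "\<And>X b. B0 X \<le> b \<Longrightarrow>
    exec b p0 (\<lambda>i. if i = 0 then X else 0)
      ((display_env X initial_state)(17 := line_number (pc initial_state)))"
    using start_program by blast
  obtain B1 p1 where p1: "poly_length B1" "\<And>X s b. B1 (X, s) \<le> b \<Longrightarrow>
    exec b p1 (display_env X s)
      ((display_env X (coded_step h X s))(17 := line_number (pc (coded_step h X s))))"
    using step_program[of h] by blast
  obtain B2 where B2: "poly_length B2" "\<And>X s i. display_env X s i \<le> B2 (X, s)"
    using display_env_bound by blast
  obtain q0 :: "nat poly" where q0: "\<And>z. bit_length (B0 z) \<le> poly q0 (code_size z)"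
    using p0(1) unfolding poly_length_def poly_value_def by blast
  obtain q1 :: "nat poly" where q1: "\<And>z. bit_length (B1 z) \<le> poly q1 (code_size z)"
    using p1(1) unfolding poly_length_def poly_value_def by blast
  obtain q2 :: "nat poly" where q2: "\<And>z. bit_length (B2 z) \<le> poly q2 (code_size z)"
    using B2(1) unfolding poly_length_def poly_value_def by blast
  define Q where "Q = pcompose q0 pair_size + pcompose q1 pair_size + pcompose q2 pair_size"
  \<comment> \<open>There are 22 lines, numbered from 0.\<close>
  define start where "start = Seq p0 (dispatch 17 0 22)"
  define main where "main = Seq p1 (dispatch 17 0 22)"
  define T where "T = Suc (Max (insert 17 (regs start \<union> regs main)))"
  have regs: "regs start \<union> regs main \<subseteq> {..<T}" "17 < T"
    unfolding T_def by (auto simp: less_Suc_eq_le finite_regs)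
  then have "T \<ge> 1" by simp
  then obtain Ks where Ks: "counter_machine start main T Ks" "stacks main [] \<subseteq> set Ks"
    "[main] \<in> set Ks" "[start] \<in> set Ks"
    by (rule counter_machine_exists[OF regs(1)])
  \<comment> \<open>The numbers of the lines \<open>Return_YES\<close> and
    \<open>Return_NO\<close>.\<close>
  interpret counter_machine start main "{20, 21}" T Ks by (rule Ks(1))
  define lab where "lab l = 4 * idx [Goto (line_number l)]" for l
  have Goto: "[Goto (line_number l)] \<in> set Ks" for l
  proof -
    have "[Goto (line_number l)] \<in> stacks (dispatch 17 0 22) []"
      using line_number_less[of l] by (intro Goto_in_stacks) auto
    then show ?thesis using Ks(2) by (auto simp: main_def)
  qed
  have "inj lab"
  proof
    fix l l' assume "lab l = lab l'"
    then have "[Goto (line_number l)] = [Goto (line_number l')]"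
      unfolding lab_def using nth_idx[OF Goto] by (metis mult_left_cancel zero_neq_numeral)
    then show "l = l'" by (simp add: line_number_inj)
  qed
  have main_case: "executes machine lab (algorithm5 h) encode_pair (A, B) \<and>
      uses_space_at_most machine (encode_pair (A, B))
        (poly ([:T:] * (Q + [:4:])) (length (encode_pair (A, B))))"
    if AB: "katsura_pair A B" for A B
  proof -
    obtain n where "n \<ge> 1" "A \<in> carrier_mat n n" "B \<in> carrier_mat n n"
      "\<forall>u<n. \<forall>w<n. A $$ (u, w) \<ge> 0"
      using AB by (auto simp: katsura_pair_def)
    then interpret katsura A B n by unfold_locales auto
    define s where "s = run (algorithm5 h) (A, B)"
    have s0: "s 0 = initial_state" and s_Suc: "s (Suc j) = alg5_step A B h (s j)" for j
      by (auto simp: s_def run_def algorithm5_def)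
    have ok: "state_ok (s j)" for j
      by (induction j) (auto simp: s0 s_Suc intro: state_ok_initial state_ok_step)
    have step: "s (Suc j) = coded_step h X (s j)" for j
      using coded_step_eq[OF ok] by (simp add: s_Suc)
    have line: "line_of (algorithm5 h) (s j) = pc (s j)" for j
      by (simp add: algorithm5_def)
    have "s j = (alg5_step A B h ^^ j) initial_state" for j
      by (induction j) (auto simp: s0 s_Suc)
    then have "\<exists>m. pc (s m) \<in> {Return_YES, Return_NO}" using terminates by simp
    then have "\<exists>m. pc (s m) \<in> {Return_YES, Return_NO} \<and>
        (\<forall>j<m. pc (s j) \<notin> {Return_YES, Return_NO})"
      by (subst (asm) exists_least_iff)
    then obtain m where m: "pc (s m) \<in> {Return_YES, Return_NO}"
      "\<And>j. j < m \<Longrightarrow> pc (s j) \<notin> {Return_YES, Return_NO}"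
      by blast
    define b :: nat where "b = 2 ^ poly Q len"
    have le_b: "x \<le> b" if "x \<le> 2 ^ k" "k \<le> poly Q len" for x k
      unfolding b_def using that power_increasing[of k "poly Q len" "2::nat"] by linarith
    have b0: "B0 X \<le> b"
      by (rule le_b[OF bound_uniform[OF q0 code_size_bounds(1)]]) (simp add: Q_def)
    have b1: "B1 (X, s j) \<le> b" for j
      by (rule le_b[OF bound_uniform[OF q1 code_size_bounds(2)[OF ok]]]) (simp add: Q_def)
    have b2: "display_env X (s j) i \<le> b" for i j
      by (rule order_trans[OF B2(2)], rule le_b[OF bound_uniform[OF q2 code_size_bounds(2)[OF ok]]])
        (simp add: Q_def)
    let ?l = "Suc (bit_length b)"
    define c where "c j = conf [Goto (line_number (pc (s j)))] (display_env X (s j))" for j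
    have env17: "display_env X t 17 = 0" for t by (simp add: display_env_def)
    have xs: "set (encode_pair (A, B)) \<subseteq> {1..5}"
      using set_encode_mat by (auto simp: encode_pair_def)
    have "reach ?l (conf [start] (\<lambda>i. if i = 0 then X else 0)) (c 0)"
      unfolding c_def s0 start_def
    proof (rule reach_block[OF p0(2)[OF b0] env17 line_number_less])
      show "(if i = 0 then X else 0) \<le> b" for i
        using b2[of 0 0] by (simp add: display_env_def)
    qed (use Ks(4) start_def in simp)
    then have first: "reach ?l (initial_config machine (encode_pair (A, B))) (c 0)"
      unfolding initial_conf[OF xs] input_def[symmetric] .
    have next_c: "reach ?l (c j) (c (Suc j))" if "j < m" for j
    proof -
      have "line_number (pc (s j)) \<notin> {20, 21}"
        using m(2)[OF that] line_number_inj[of "pc (s j)" Return_YES] line_number_inj[of "pc (s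
          j)" Return_NO]
        by auto
      then have "reach ?l (c j) (conf [main] (display_env X (s j)))"
        unfolding c_def by (intro reach_Goto Goto)
      moreover have "reach ?l (conf [main] (display_env X (s j))) (c (Suc j))"
      proof -
        have "[Seq p1 (dispatch 17 0 22)] \<in> set Ks" using Ks(3) main_def by simp
        note block = reach_block[OF p1(2)[OF b1] env17 line_number_less b2 this]
        show ?thesis unfolding c_def step by (rule block[folded main_def])
      qed
      ultimately show ?thesis by (rule reach_trans)
    qed
    obtain \<tau> where \<tau>: "\<And>j. j < m \<Longrightarrow> \<tau> j < \<tau> (Suc j)"
      "\<And>j. j \<le> m \<Longrightarrow> config_at machine (encode_pair (A, B)) (\<tau> j) = c j"
      "\<And>t. t \<le> \<tau> m \<Longrightarrow> heads_in ?l (config_at machine (encode_pair (A,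
        B)) t)"
      using reach_sequence[of ?l _ c m, OF first next_c] unfolding config_at_def by blast
    have disp: "displays (algorithm5 h) lab (c j) (s j)" for j
    proof -
      have vars: "shown_vars (algorithm5 h) (s j) = encode_vars (s j)"
        by (simp add: algorithm5_def)
      have len15: "length (encode_vars (s j)) = 15" by (simp add: encode_vars_def)
      have "map fst (take 15 (tl (tapes (display_env X (s j))))) = map contents (encode_vars (s j))"
      proof (rule nth_equalityI)
        show "length (map fst (take 15 (tl (tapes (display_env X (s j)))))) =
          length (map contents (encode_vars (s j)))"
          using regs(2) len15 by simp
        fix i assume "i < length (map fst (take 15 (tl (tapes (display_env X (s j))))))"
        then have i: "i < 15" by simp
        have "encode_vars (s j) ! i = digits ((show_vars ! i) (s j))"
          using i length_show_vars by (simp flip: digits_show_vars)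
        then show "map fst (take 15 (tl (tapes (display_env X (s j))))) ! i =
          map contents (encode_vars (s j)) ! i"
          using i regs(2) len15 by (simp add: nth_tl tapes_def display_env_def)
      qed
      then show ?thesis
        unfolding displays_def vars line len15 by (simp add: c_def conf_def lab_def)
    qed
    have halt: "fst (c m) \<in> halting machine"
      using m(1) Goto[of "pc (s m)"] by (auto simp: c_def conf_def machine_def)
    have "executes machine lab (algorithm5 h) encode_pair (A, B)"
      unfolding executes_def s_def[symmetric]
      using m \<tau>(1,2) disp halt
      by (intro exI[of _ m] exI[of _ \<tau>]) (auto simp: line, auto simp: algorithm5_def)
    moreover have "uses_space_at_most machine (encode_pair (A, B)) (T * (?l + 2))"
      using halt \<tau>(2)[of m] \<tau>(3) unfolding config_at_def
        by (intro space_bound[of "\<tau> m"]) auto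
    moreover have "T * (?l + 2) \<le> poly ([:T:] * (Q + [:4:])) len"
    proof -
      have "bit_length b \<le> poly Q len + 1" by (simp add: bit_length_le_iff b_def)
      then have "T * (?l + 2) \<le> T * (poly Q len + 4)" by (intro mult_left_mono) auto
      then show ?thesis by (simp add: add.commute)
    qed
    ultimately show ?thesis
      unfolding uses_space_at_most_def using order_trans by blast
  qed
  show ?thesis
    unfolding runs_in_polynomial_space_def
    using turing_machine_machine \<open>inj lab\<close> main_case
    by (intro exI[of _ machine] exI[of _ lab] exI[of _ "[:T:] * (Q + [:4:])"]) auto
qed

end
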